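(* Let $\left(\frac{\cdot}{3}\right)$ and $\left(\frac{\cdot}{5}\right)$ be the Legendre symbols modulo $3$ and $5$, and let $\psi$ be the non-principal Dirichlet character modulo $4$. Then $\eta_{(\cdot/3)}$, $\eta_{\psi}$ and $\eta_{(\cdot/5)}$ are generalized modular functions (of weight $0$) on $\Gamma_0(9)$, $\Gamma_0(16)$ and $\Gamma_0(25)$ respectively, whose characters are unitary and take values in the twelfth roots of unity; each has a cuspidal divisor and none of them is an $\eta$-quotient. Explicitly, $$\eta_{(\cdot/3)}(\tau)=\prod_{n\ge1}\Big(\tfrac{1-e^{2\pi i/3}q^n}{1-e^{4\pi i/3}q^n}\Big)^{(n/3)},\quad \eta_{\psi}(\tau)=\prod_{n\ge1}\Big(\tfrac{1-iq^n}{1+iq^n}\Big)^{\psi(n)},\quad \eta_{(\cdot/5)}(\tau)=\prod_{n\ge1}\Big(\tfrac{1-\frac{1-\sqrt5}{2}q^n+q^{2n}}{1-\frac{1+\sqrt5}{2}q^n+q^{2n}}\Big)^{(n/5)}.$$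
   Context: $q=e^{2\pi i\tau}$, $\tau\in\mathcal{H}$ (upper half-plane). For a Dirichlet character $\chi$ of conductor $u$, $\eta_{\chi}(\tau):=\prod_{n\ge1}\prod_{a=1}^{u}(1-e^{2\pi i a/u}q^n)^{\bar\chi(an)}$ (the displayed products are this definition specialized). The Dedekind function is $\eta(\tau)=q^{1/24}\prod_{n\ge1}(1-q^n)$; with $(f|V_t)(\tau)=f(t\tau)$, a function $f$ on $\mathcal{H}$ is an $\eta$-quotient if $f=c\prod_{t\mid M}(\eta|V_t)^{a_t}$ for some positive integer $M$ and complex numbers $c,(a_t)$ (powers via the principal branch of the logarithm). For $\Gamma\subset\mathrm{SL}_2(\mathbf{Z})$ of finite index, a generalized modular function of weight $0$ on $\Gamma$ is a holomorphic $f$ on $\mathcal{H}$ with $f(\gamma\tau)=\nu(\gamma)f(\tau)$ for all $\gamma\in\Gamma$ for some character $\nu:\Gamma\to\mathbf{C}^*$ (its character), and which is meromorphic at the cusps of $\Gamma$. A cuspidal divisor means no zeros or poles in $\mathcal{H}$. $\Gamma_0(N)=\{\left(\begin{smallmatrix}a&b\\c&d\end{smallmatrix}\right)\in\mathrm{SL}_2(\mathbf{Z}):N\mid c\}$.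
   Formalization: In the third displayed product the middle terms are taken with a plus sign, 1+((1∓√5)/2)q^n+q^{2n}, since the printed minus signs contradict the definition of η_{(·/5)} (the q-coefficient would be +√5 instead of −√5). *)

theory Defs
  imports
    "HOL-Complex_Analysis.Complex_Analysis"
    "HOL-Number_Theory.Number_Theory"
    "HOL-Algebra.Coset"
begin

definition uhp :: "complex set" where
  "uhp = {\<tau>. Im \<tau> > 0}"

definition nome :: "complex \<Rightarrow> complex" where
  "nome \<tau> = exp (2 * of_real pi * \<i> * \<tau>)"

section \<open>Dirichlet characters\<close>

definition dirichlet_char :: "nat \<Rightarrow> (int \<Rightarrow> complex) \<Rightarrow> bool" where
  "dirichlet_char N X \<longleftrightarrow> N > 0 \<and>
     (\<forall>a b. X (a * b) = X a * X b) \<and>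
     (\<forall>a. X (a + int N) = X a) \<and>
     (\<forall>a. X a \<noteq> 0 \<longleftrightarrow> coprime a (int N))"

definition principal_char :: "nat \<Rightarrow> int \<Rightarrow> complex" where
  "principal_char N a = (if coprime a (int N) then 1 else 0)"

text \<open>The conductor: the smallest modulus of a character inducing \<open>X\<close>, that is, agreeing
  with \<open>X\<close> wherever \<open>X\<close> does not vanish.\<close>

definition conductor :: "(int \<Rightarrow> complex) \<Rightarrow> nat" where
  "conductor X = (LEAST u. \<exists>X'. dirichlet_char u X' \<and> (\<forall>a. X a \<noteq> 0 \<longrightarrow> X' a = X a))"

definition legendre_char :: "nat \<Rightarrow> int \<Rightarrow> complex" where
  "legendre_char p a = of_int (Legendre a (int p))"

section \<open>The functions \<open>\<eta>\<^sub>X\<close>, \<open>\<eta>\<close> and \<open>\<eta>\<close>-quotients\<close>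

text \<open>The infinite product \<open>\<Prod>n. F n\<close> runs over \<open>n \<ge> 0\<close>, hence the shifts by one below. For
  \<open>\<tau>\<close> in the upper half-plane \<open>1 - \<zeta> q\<^sup>n\<close> has positive real part, so the principal
  power \<open>powr\<close> is holomorphic there.\<close>

definition eta_char :: "(int \<Rightarrow> complex) \<Rightarrow> complex \<Rightarrow> complex" where
  "eta_char X \<tau> =
     (\<Prod>n. \<Prod>a = 1..conductor X.
        (1 - exp (2 * of_real pi * \<i> * of_nat a / of_nat (conductor X)) * nome \<tau> ^ (n + 1))
          powr cnj (X (int (a * (n + 1)))))"

definition dedekind_eta :: "complex \<Rightarrow> complex" where
  "dedekind_eta \<tau> = exp (2 * of_real pi * \<i> * \<tau> / 24) * (\<Prod>n. 1 - nome \<tau> ^ (n + 1))"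

text \<open>The holomorphic power \<open>\<eta>\<^sup>s\<close>: the principal branch is applied to the factors
  \<open>1 - q\<^sup>n\<close>, and \<open>q\<close> to the power \<open>s/24\<close> is read as \<open>exp (2 \<pi> i \<tau> s / 24)\<close>.\<close>

definition dedekind_eta_pow :: "complex \<Rightarrow> complex \<Rightarrow> complex" where
  "dedekind_eta_pow s \<tau> =
     exp (2 * of_real pi * \<i> * \<tau> * s / 24) * (\<Prod>n. (1 - nome \<tau> ^ (n + 1)) powr s)"

text \<open>Applying the principal power to the value \<open>\<eta> (t \<tau>)\<close> itself gives a function that jumps
  where that value crosses the negative real axis, unless the exponent is an integer; the
  holomorphic power avoids this. Functions of either shape count as \<open>\<eta>\<close>-quotients here, so that
  not being an \<open>\<eta>\<close>-quotient excludes both.\<close>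

definition is_eta_quotient :: "(complex \<Rightarrow> complex) \<Rightarrow> bool" where
  "is_eta_quotient f \<longleftrightarrow>
     (\<exists>(M::nat) (c::complex) (a :: nat \<Rightarrow> complex). M > 0 \<and>
        ((\<forall>\<tau>\<in>uhp. f \<tau> = c * (\<Prod>t | t dvd M. dedekind_eta (of_nat t * \<tau>) powr a t)) \<or>
         (\<forall>\<tau>\<in>uhp. f \<tau> = c * (\<Prod>t | t dvd M. dedekind_eta_pow (a t) (of_nat t * \<tau>)))))"

section \<open>Generalized modular functions\<close>

definition SL2Z :: "(int^2^2) monoid" where
  "SL2Z = \<lparr>carrier = {A. det A = 1}, mult = (**), one = mat 1\<rparr>"

definition Gamma0 :: "nat \<Rightarrow> (int^2^2) set" where
  "Gamma0 N = {A. det A = 1 \<and> int N dvd A $ 2 $ 1}"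

definition moebius :: "int^2^2 \<Rightarrow> complex \<Rightarrow> complex" where
  "moebius A \<tau> =
     (of_int (A $ 1 $ 1) * \<tau> + of_int (A $ 1 $ 2)) / (of_int (A $ 2 $ 1) * \<tau> + of_int (A $ 2 $ 2))"

definition translation :: "nat \<Rightarrow> int^2^2" where
  "translation w = vector [vector [1, int w], vector [0, 1]]"

definition group_char :: "(int^2^2) set \<Rightarrow> (int^2^2 \<Rightarrow> complex) \<Rightarrow> bool" where
  "group_char \<Gamma> \<nu> \<longleftrightarrow>
     (\<forall>A\<in>\<Gamma>. \<nu> A \<noteq> 0) \<and> (\<forall>A\<in>\<Gamma>. \<forall>B\<in>\<Gamma>. \<nu> (A ** B) = \<nu> A * \<nu> B)"

text \<open>At the cusp \<open>A \<infinity>\<close> choose \<open>w > 0\<close> such that \<open>B = A T\<^sup>w A\<^sup>-\<^sup>1\<close> lies in \<open>\<Gamma>\<close>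
  (with \<open>T \<tau> = \<tau> + 1\<close>). Then \<open>f (A (\<tau> + w)) = \<nu> B * f (A \<tau>)\<close>, so \<open>f (A \<tau>)\<close>
  is \<open>exp (2 \<pi> i \<kappa> \<tau> / w)\<close>, where \<open>exp (2 \<pi> i \<kappa>) = \<nu> B\<close>, times a function \<open>g\<close> of
  \<open>exp (2 \<pi> i \<tau> / w)\<close>. Meromorphy at the cusp says that \<open>g\<close> is meromorphic at 0, i.e. that
  the expansion is left-finite. As \<open>\<nu>\<close> need not be unitary, \<open>\<kappa>\<close> may be non-real.\<close>

definition meromorphic_at_cusps ::
    "(int^2^2) set \<Rightarrow> (int^2^2 \<Rightarrow> complex) \<Rightarrow> (complex \<Rightarrow> complex) \<Rightarrow> bool" where
  "meromorphic_at_cusps \<Gamma> \<nu> f \<longleftrightarrow>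
     (\<forall>A\<in>carrier SL2Z. \<exists>w>0. \<exists>B\<in>\<Gamma>. \<exists>\<kappa> g.
        B ** A = A ** translation w \<and>
        exp (2 * of_real pi * \<i> * \<kappa>) = \<nu> B \<and>
        g meromorphic_on {0} \<and>
        (\<forall>\<tau>\<in>uhp. f (moebius A \<tau>) =
           exp (2 * of_real pi * \<i> * \<kappa> * \<tau> / of_nat w) * g (nome (\<tau> / of_nat w))))"

definition generalized_modular_function ::
    "(int^2^2) set \<Rightarrow> (int^2^2 \<Rightarrow> complex) \<Rightarrow> (complex \<Rightarrow> complex) \<Rightarrow> bool" where
  "generalized_modular_function \<Gamma> \<nu> f \<longleftrightarrow>
     subgroup \<Gamma> SL2Z \<and> finite (rcosets\<^bsub>SL2Z\<^esub> \<Gamma>) \<and>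
     group_char \<Gamma> \<nu> \<and>
     f holomorphic_on uhp \<and>
     (\<forall>A\<in>\<Gamma>. \<forall>\<tau>\<in>uhp. f (moebius A \<tau>) = \<nu> A * f \<tau>) \<and>
     meromorphic_at_cusps \<Gamma> \<nu> f"

definition cuspidal_divisor :: "(complex \<Rightarrow> complex) \<Rightarrow> bool" where
  "cuspidal_divisor f \<longleftrightarrow> (\<forall>\<tau>\<in>uhp. f \<tau> \<noteq> 0 \<and> \<not> is_pole f \<tau>)"

text \<open>Weight 0 and with a unitary character whose values are twelfth roots of unity. The
  character of a function that is not identically zero is unique on \<open>\<Gamma>\<close>.\<close>

definition gmf_with_twelfth_root_char :: "(int^2^2) set \<Rightarrow> (complex \<Rightarrow> complex) \<Rightarrow> bool" where
  "gmf_with_twelfth_root_char \<Gamma> f \<longleftrightarrow>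
     (\<exists>\<nu>. generalized_modular_function \<Gamma> \<nu> f \<and>
          (\<forall>A\<in>\<Gamma>. norm (\<nu> A) = 1) \<and> (\<forall>A\<in>\<Gamma>. \<nu> A ^ 12 = 1))"

end

theory Submission
  imports Defs
begin

text \<open>
  For a real primitive character \<open>X\<close> of conductor \<open>N\<close>, multiplication by \<open>n\<close> permutes the units modulo \<open>N\<close>
  if \<open>n\<close> is prime to \<open>N\<close>, and the factors with the other \<open>n\<close> cancel; hence \<open>\<eta>\<^sub>X(\<tau>)\<close> is a constant times
  \<open>\<Prod>\<^sub>b \<eta>(\<tau> + b/N)\<close> to the powers \<open>X(b)\<close>. Conjugating \<open>\<Gamma>\<^sub>0(N\<^sup>2)\<close> by these translations lands in
  \<open>SL\<^sub>2(\<int>)\<close>, permutes the \<open>b\<close> without changing \<open>X(b)\<close>, and gives the same automorphy factor for every \<open>b\<close>.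
  As the exponents \<open>X(b)\<close> add up to 0, the twelfth power of \<open>\<eta>\<^sub>X\<close> is invariant, and by connectedness
  \<open>\<eta>\<^sub>X\<close> itself is multiplied by a twelfth root of unity. The expansions at the cusps are found in the same way.

  All this needs only the transformation of \<open>\<eta>\<^sup>1\<^sup>2\<close> under \<open>\<tau> \<mapsto> -1/\<tau>\<close>. The quotient of the theta
  functions for the lattices of \<open>-1/\<tau>\<close> and \<open>\<tau>\<close> (times a Gaussian) is entire and doubly periodic, hence
  constant; its behaviour at 0 expresses the constant through \<open>\<eta>\<close>, and multiplying its values at the three
  half periods, where the theta values have an elementary product, determines the cube of the constant.

  The \<open>k\<close>-th coefficient of \<open>log \<eta>\<^sub>X\<close> is a multiple of \<open>X(k) \<sigma>\<^sub>-\<^sub>1(k)\<close>, whereas for an \<open>\<eta>\<close>-quotient of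
  level \<open>M\<close> the coefficients with \<open>k\<close> prime to \<open>M\<close> are a fixed multiple of \<open>\<sigma>\<^sub>-\<^sub>1(k)\<close>. These are
  incompatible because \<open>X(k) = -1\<close> for some \<open>k\<close> prime to \<open>M\<close>.
\<close>

unbundle no Formal_Power_Series.fps_syntax

section \<open>The q-Pochhammer symbol and the theta function\<close>

definition qpoch :: "complex \<Rightarrow> complex \<Rightarrow> complex" where
  "qpoch x q = (\<Prod>n. 1 - x * q ^ n)"

lemma qpoch_has_prod:
  assumes "norm q < 1"
  shows "(\<lambda>n. 1 - x * q ^ n) has_prod qpoch x q"
proof -
  have "summable (\<lambda>n. norm x * norm q ^ n)"
    using assms by (intro summable_mult summable_geometric) auto
  hence "abs_convergent_prod (\<lambda>n. 1 - x * q ^ n)"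
    by (simp add: abs_convergent_prod_conv_summable norm_mult norm_power)
  thus ?thesis
    unfolding qpoch_def by (intro convergent_prod_has_prod abs_convergent_prod_imp_convergent_prod)
qed

lemma qpoch_tendsto:
  assumes "norm q < 1"
  shows "(\<lambda>N. \<Prod>n<N. 1 - x * q ^ n) \<longlonglongrightarrow> qpoch x q"
  using has_prod_imp_tendsto'[OF qpoch_has_prod[OF assms]] .

lemma qpoch_rec:
  assumes "norm q < 1"
  shows "qpoch x q = (1 - x) * qpoch (q * x) q"
proof -
  have "(\<lambda>N. \<Prod>n<Suc N. 1 - x * q ^ n) \<longlonglongrightarrow> qpoch x q"
    using qpoch_tendsto[OF assms] by (rule LIMSEQ_Suc)
  moreover have "(\<Prod>n<Suc N. 1 - x * q ^ n) = (1 - x) * (\<Prod>n<N. 1 - (q * x) * q ^ n)" for N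
    by (subst prod.lessThan_Suc_shift) (simp add: mult_ac)
  moreover have "(\<lambda>N. (1 - x) * (\<Prod>n<N. 1 - (q * x) * q ^ n)) \<longlonglongrightarrow> (1 - x) * qpoch (q * x) q"
    by (intro tendsto_mult tendsto_const qpoch_tendsto assms)
  ultimately show ?thesis
    by (simp add: LIMSEQ_unique)
qed

lemma qpoch_eq_0_iff:
  assumes "norm q < 1"
  shows "qpoch x q = 0 \<longleftrightarrow> (\<exists>n. x * q ^ n = 1)"
  using has_prod_eq_0_iff[OF qpoch_has_prod[OF assms, of x]] by auto

text \<open>Factor by factor this is a difference of two squares.\<close>

lemma qpoch_uminus_mult:
  assumes "norm q < 1"
  shows "qpoch x q * qpoch (- x) q = qpoch (x ^ 2) (q ^ 2)"
proof -
  have "norm (q ^ 2) < 1"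
    using assms by (simp add: norm_power power_less_one_iff)
  hence "(\<lambda>N. \<Prod>n<N. 1 - x ^ 2 * (q ^ 2) ^ n) \<longlonglongrightarrow> qpoch (x ^ 2) (q ^ 2)"
    by (rule qpoch_tendsto)
  moreover have "(\<lambda>N. (\<Prod>n<N. 1 - x * q ^ n) * (\<Prod>n<N. 1 - (- x) * q ^ n)) \<longlonglongrightarrow> qpoch x q * qpoch (- x) q"
    by (intro tendsto_mult qpoch_tendsto assms)
  moreover have "(\<Prod>n<N. 1 - x * q ^ n) * (\<Prod>n<N. 1 - (- x) * q ^ n) = (\<Prod>n<N. 1 - x ^ 2 * (q ^ 2) ^ n)" for N
    unfolding prod.distrib[symmetric] by (intro prod.cong) (auto simp: algebra_simps power2_eq_square power_mult_distrib)
  ultimately show ?thesis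
    by (simp add: LIMSEQ_unique)
qed

text \<open>The factors with even and with odd exponent are collected separately.\<close>

lemma qpoch_even_odd:
  assumes "norm q < 1"
  shows "qpoch x q = qpoch x (q ^ 2) * qpoch (x * q) (q ^ 2)"
proof -
  have q2: "norm (q ^ 2) < 1"
    using assms by (simp add: norm_power power_less_one_iff)
  have "filterlim (\<lambda>N. 2 * N) at_top (sequentially :: nat filter)"
    by (rule filterlim_subseq) (simp add: strict_mono_def)
  with qpoch_tendsto[OF assms]
  have "(\<lambda>N. \<Prod>n<2 * N. 1 - x * q ^ n) \<longlonglongrightarrow> qpoch x q"
    by (rule filterlim_compose)
  moreover have "(\<lambda>N. (\<Prod>n<N. 1 - x * (q ^ 2) ^ n) * (\<Prod>n<N. 1 - (x * q) * (q ^ 2) ^ n)) \<longlonglongrightarrow> 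
     qpoch x (q ^ 2) * qpoch (x * q) (q ^ 2)"
    by (intro tendsto_mult qpoch_tendsto q2)
  moreover have "(\<Prod>n<2 * N. 1 - x * q ^ n) = 
     (\<Prod>n<N. 1 - x * (q ^ 2) ^ n) * (\<Prod>n<N. 1 - (x * q) * (q ^ 2) ^ n)" for N
    by (induction N) (simp_all add: power_mult [symmetric] mult_ac)
  ultimately show ?thesis
    by (simp add: LIMSEQ_unique)
qed

text \<open>On a closed disc in \<open>A\<close> the function \<open>f\<close> is bounded and
  \<open>norm (g z)\<close> has a maximum below 1, so a geometric series dominates and the partial
  products converge uniformly.\<close>

lemma holomorphic_qpoch [holomorphic_intros]:
  assumes "open A" "f holomorphic_on A" "g holomorphic_on A" "\<And>z. z \<in> A \<Longrightarrow> norm (g z) < 1"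
  shows "(\<lambda>z. qpoch (f z) (g z)) holomorphic_on A"
proof (rule holomorphic_uniform_sequence[OF \<open>open A\<close>])
  fix N
  show "(\<lambda>z. \<Prod>n<N. 1 - f z * g z ^ n) holomorphic_on A"
    by (intro holomorphic_intros assms)
next
  fix z0 assume "z0 \<in> A"
  then obtain d where d: "d > 0" "cball z0 d \<subseteq> A"
    using \<open>open A\<close> open_contains_cball by blast
  let ?K = "cball z0 d"
  have K: "compact ?K" by simp
  have cf: "continuous_on ?K f" and cg: "continuous_on ?K g"
    using assms d by (meson continuous_on_subset holomorphic_on_imp_continuous_on)+
  have "bounded (f ` ?K)"
    using compact_continuous_image[OF cf K] by (rule compact_imp_bounded)
  then obtain B where B: "\<And>z. z \<in> ?K \<Longrightarrow> norm (f z) \<le> B"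
    unfolding bounded_iff by blast
  have "?K \<noteq> {}" using d by auto
  then obtain z1 where z1: "z1 \<in> ?K" "\<And>z. z \<in> ?K \<Longrightarrow> norm (g z) \<le> norm (g z1)"
    using continuous_attains_sup[OF K _ continuous_on_norm[OF cg]] by blast
  have r: "norm (g z1) < 1" using z1 d assms(4) by auto
  have "uniformly_convergent_on ?K (\<lambda>N z. \<Prod>n<N. 1 - f z * g z ^ n)"
  proof (rule uniformly_convergent_on_prod')
    show "uniformly_convergent_on ?K (\<lambda>N z. \<Sum>n<N. norm (1 - f z * g z ^ n - 1))"
    proof (rule Weierstrass_m_test')
      fix n z assume z: "z \<in> ?K"
      have "0 \<le> B"
        using B[OF z] norm_ge_zero[of "f z"] by linarith
      hence "norm (f z) * norm (g z) ^ n \<le> B * norm (g z1) ^ n"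
        using B[OF z] z1(2)[OF z] by (intro mult_mono power_mono) auto
      thus "norm (norm (1 - f z * g z ^ n - 1)) \<le> B * norm (g z1) ^ n"
        by (simp add: norm_mult norm_power)
    next
      show "summable (\<lambda>n. B * norm (g z1) ^ n)"
        using r by (intro summable_mult summable_geometric) auto
    qed
  qed (use cf cg in \<open>auto intro!: continuous_intros\<close>)
  then obtain L where L: "uniform_limit ?K (\<lambda>N z. \<Prod>n<N. 1 - f z * g z ^ n) L sequentially"
    unfolding uniformly_convergent_on_def by blast
  have "L z = qpoch (f z) (g z)" if "z \<in> ?K" for z
    using tendsto_uniform_limitI[OF L that] qpoch_tendsto[of "g z" "f z"] assms(4) d that
    by (meson LIMSEQ_unique subsetD)
  with L have "uniform_limit ?K (\<lambda>N z. \<Prod>n<N. 1 - f z * g z ^ n) (\<lambda>z. qpoch (f z) (g z)) sequentially"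
    by (metis (mono_tags, lifting) uniform_limit_cong')
  with d show "\<exists>d>0. cball z0 d \<subseteq> A \<and> uniform_limit (cball z0 d) (\<lambda>N z. \<Prod>n<N. 1 - f z * g z ^ n)
      (\<lambda>z. qpoch (f z) (g z)) sequentially"
    by blast
qed

section \<open>The nome as a homomorphism from addition to multiplication\<close>

lemma nome_add: "nome (a + b) = nome a * nome b"
  by (simp add: nome_def distrib_left exp_add)

lemma nome_diff: "nome (a - b) = nome a / nome b"
  by (simp add: nome_def right_diff_distrib exp_diff)

lemma nome_minus: "nome (- a) = inverse (nome a)"
  by (simp add: nome_def exp_minus)

lemma nome_nonzero [simp]: "nome a \<noteq> 0"
  by (simp add: nome_def)

lemma nome_0 [simp]: "nome 0 = 1"
  by (simp add: nome_def)

lemma nome_eq_1_iff: "nome z = 1 \<longleftrightarrow> z \<in> \<int>"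
proof -
  have "nome z = 1 \<longleftrightarrow> (\<exists>n::int. 2 * of_real pi * \<i> * z = of_int (2 * n) * pi * \<i>)"
    unfolding nome_def exp_eq_1 by (auto simp: complex_eq_iff mult_ac)
  also have "\<dots> \<longleftrightarrow> (\<exists>n::int. z = of_int n)"
    by (intro arg_cong[where f = Ex] ext) (auto simp: field_simps)
  finally show ?thesis by (auto simp: Ints_def)
qed

lemma nome_inverse_neq_1:
  fixes k :: int
  assumes "k > 1"
  shows "nome (1 / of_int k) \<noteq> 1"
proof
  assume "nome (1 / of_int k) = 1"
  then obtain m where "(1 / of_int k :: complex) = of_int m"
    by (auto simp: nome_eq_1_iff elim: Ints_cases)
  hence "of_int (k * m) = (of_int 1 :: complex)"
    using assms by (simp add: field_simps)
  hence "k * m = 1"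
    by (simp only: of_int_eq_iff)
  thus False
    using assms by (auto simp: zmult_eq_1_iff)
qed

lemma nome_of_int [simp]: "nome (of_int n) = 1"
  by (simp add: nome_eq_1_iff)

lemma nome_1 [simp]: "nome 1 = 1"
  using nome_of_int[of 1] by simp

lemma nome_of_nat [simp]: "nome (of_nat n) = 1"
  using nome_of_int[of "int n"] by simp

lemma nome_mult_of_nat: "nome (of_nat n * z) = nome z ^ n"
  by (induction n) (auto simp: distrib_right nome_add)

lemma nome_power: "nome z ^ n = nome (of_nat n * z)"
  by (simp add: nome_mult_of_nat)

lemma nome_half: "nome (1 / 2) = -1"
  by (simp add: nome_def)

lemma nome_quarter: "nome (1 / 4) = \<i>"
  by (simp add: nome_def complex_eq_iff Re_exp Im_exp)

lemma norm_nome: "norm (nome z) = exp (- 2 * pi * Im z)"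
  by (simp add: nome_def norm_exp_eq_Re)

lemma norm_nome_less_1_iff: "norm (nome z) < 1 \<longleftrightarrow> z \<in> uhp"
  by (auto simp: norm_nome uhp_def zero_less_mult_iff)

lemma norm_nome_less_1: "z \<in> uhp \<Longrightarrow> norm (nome z) < 1"
  by (simp add: norm_nome_less_1_iff)

lemma holomorphic_nome [holomorphic_intros]:
  "f holomorphic_on A \<Longrightarrow> (\<lambda>z. nome (f z)) holomorphic_on A"
  unfolding nome_def by (intro holomorphic_intros)

lemma uhp_neg_inverse: "\<tau> \<in> uhp \<Longrightarrow> -1 / \<tau> \<in> uhp"
  by (auto simp: uhp_def Im_divide sum_power2_gt_zero_iff intro!: divide_pos_pos)

lemma uhp_nonzero: "\<tau> \<in> uhp \<Longrightarrow> \<tau> \<noteq> 0"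
  by (auto simp: uhp_def)

text \<open>Up to a factor depending only on \<open>\<tau>\<close> this is Jacobi's \<open>\<theta>\<^sub>1\<close>.\<close>

definition theta :: "complex \<Rightarrow> complex \<Rightarrow> complex" where
  "theta z \<tau> = nome (- z / 2) * qpoch (nome z) (nome \<tau>) * qpoch (nome \<tau> / nome z) (nome \<tau>)"

section \<open>Quasi-periods and zeros of theta\<close>

lemma theta_plus_1: "theta (z + 1) \<tau> = - theta z \<tau>"
proof -
  have "- (z + 1) / 2 = - z / 2 - 1 / 2"
    by (simp add: field_simps)
  hence "nome (- (z + 1) / 2) = - nome (- z / 2)"
    by (simp only: nome_diff nome_half) simp
  thus ?thesis
    by (simp only: theta_def nome_add nome_1 mult_1_right) simp
qed

text \<open>Adding \<open>\<tau>\<close> multiplies \<open>w = nome z\<close> by \<open>q\<close>: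
  the first product loses the factor \<open>1 - w\<close>, the second gains
  \<open>1 - 1 / w\<close>, and the quotient of these two is \<open>- 1 / w\<close>.\<close>

lemma theta_plus_tau:
  assumes "\<tau> \<in> uhp"
  shows "theta (z + \<tau>) \<tau> = - nome (- \<tau> / 2 - z) * theta z \<tau>"
proof -
  define w q where "w = nome z" and "q = nome \<tau>"
  have nz: "w \<noteq> 0" "q \<noteq> 0" and q: "norm q < 1"
    using norm_nome_less_1[OF assms] by (auto simp: w_def q_def)
  have 1: "qpoch w q = (1 - w) * qpoch (w * q) q"
    using qpoch_rec[OF q, of w] by (simp add: mult_ac)
  have 2: "qpoch (1 / w) q = (1 - 1 / w) * qpoch (q / w) q"
    using qpoch_rec[OF q, of "1 / w"] by simp
  have "- (z + \<tau>) / 2 = - z / 2 + - \<tau> / 2"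
    by (simp add: field_simps)
  hence 3: "nome (- (z + \<tau>) / 2) = nome (- z / 2) * nome (- \<tau> / 2)"
    by (simp only: nome_add)
  have "theta (z + \<tau>) \<tau> = nome (- z / 2) * nome (- \<tau> / 2) * qpoch (w * q) q * qpoch (1 / w) q"
    using nz by (simp only: theta_def nome_add 3 flip: w_def q_def) (simp add: mult_ac)
  also have "\<dots> = - (nome (- \<tau> / 2) / w) * (nome (- z / 2) * qpoch w q * qpoch (q / w) q)"
    using nz by (simp add: 1 2 field_simps)
  finally show ?thesis
    by (simp only: theta_def nome_diff w_def q_def)
qed

text \<open>This confines the singularities of a quotient by theta to the period lattice.\<close>

lemma theta_eq_0D:
  assumes "\<tau> \<in> uhp" "theta z \<tau> = 0"
  shows "\<exists>m n :: int. z = of_int m + of_int n * \<tau>"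
proof -
  have q: "norm (nome \<tau>) < 1"
    using norm_nome_less_1[OF assms(1)] .
  from assms(2) consider "qpoch (nome z) (nome \<tau>) = 0" | "qpoch (nome \<tau> / nome z) (nome \<tau>) = 0"
    by (auto simp: theta_def)
  thus ?thesis
  proof cases
    case 1
    then obtain n where "nome z * nome \<tau> ^ n = 1"
      using qpoch_eq_0_iff[OF q] by blast
    hence "nome (z + of_nat n * \<tau>) = 1"
      by (simp add: nome_add nome_mult_of_nat)
    then obtain m where "z + of_nat n * \<tau> = of_int m"
      by (auto simp: nome_eq_1_iff elim: Ints_cases)
    hence "z = of_int m + of_int (- int n) * \<tau>"
      by (simp add: algebra_simps)
    thus ?thesis by blast
  next
    case 2
    then obtain n where "nome \<tau> / nome z * nome \<tau> ^ n = 1"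
      using qpoch_eq_0_iff[OF q] by blast
    hence "nome (\<tau> - z + of_nat n * \<tau>) = 1"
      by (simp add: nome_add nome_diff nome_mult_of_nat)
    then obtain m where "\<tau> - z + of_nat n * \<tau> = of_int m"
      by (auto simp: nome_eq_1_iff elim: Ints_cases)
    hence "z = of_int (- m) + of_int (int n + 1) * \<tau>"
      by (simp add: algebra_simps)
    thus ?thesis by blast
  qed
qed

lemma holomorphic_theta [holomorphic_intros]:
  assumes "\<tau> \<in> uhp" "f holomorphic_on A" "open A"
  shows "(\<lambda>z. theta (f z) \<tau>) holomorphic_on A"
  unfolding theta_def using norm_nome_less_1[OF assms(1)]
  by (intro holomorphic_intros assms) auto

text \<open>The factor \<open>1 - nome z\<close> carries the zero at 0, so the derivative there is,
  up to a constant, the rest of the product at 0, namely the square of the eta product. This value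
  ties theta to eta.\<close>

lemma theta_simple_zero:
  assumes "\<tau> \<in> uhp"
  obtains g where "g holomorphic_on UNIV" "\<And>z. theta z \<tau> = z * g z"
    "g 0 = - 2 * of_real pi * \<i> * qpoch (nome \<tau>) (nome \<tau>) ^ 2"
proof -
  define q where "q = nome \<tau>"
  have q: "norm q < 1"
    using norm_nome_less_1[OF assms] by (simp add: q_def)
  define v where "v = (\<lambda>z. nome (- z / 2) * qpoch (q * nome z) q * qpoch (q / nome z) q)"
  have v: "v holomorphic_on UNIV"
    unfolding v_def using q by (intro holomorphic_intros) auto
  have theta: "theta z \<tau> = (1 - nome z) * v z" for z
    using qpoch_rec[OF q, of "nome z"] by (simp add: theta_def v_def q_def mult_ac)
  \<comment> \<open>The value at 0 fills the removable singularity of the difference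
    quotient.\<close>
  define g where "g = (\<lambda>z. if z = 0 then deriv (\<lambda>z. theta z \<tau>) 0 else theta z \<tau> / z)"
  have "(\<lambda>z. if z = 0 then deriv (\<lambda>z. theta z \<tau>) 0 else theta z \<tau> / z - theta 0 \<tau> / (z - 0)) holomorphic_on UNIV"
    by (rule pole_theorem[where S = UNIV]) (auto intro!: holomorphic_intros assms)
  moreover have "theta 0 \<tau> = 0"
    by (simp add: theta)
  ultimately have "g holomorphic_on UNIV"
    unfolding g_def by (simp only: div_0 diff_zero)
  moreover have "theta z \<tau> = z * g z" for z
    by (auto simp: g_def theta)
  moreover have "g 0 = - 2 * of_real pi * \<i> * qpoch q q ^ 2"
  proof -
    have dv: "(v has_field_derivative deriv v 0) (at 0)"
      using v by (intro holomorphic_derivI) auto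
    have "((\<lambda>z. (1 - nome z) * v z) has_field_derivative (- 2 * of_real pi * \<i> * v 0)) (at 0)"
      unfolding nome_def by (rule derivative_eq_intros dv refl | simp)+
    hence "deriv (\<lambda>z. theta z \<tau>) 0 = - 2 * of_real pi * \<i> * v 0"
      unfolding theta by (rule DERIV_imp_deriv)
    thus ?thesis
      by (simp add: g_def v_def power2_eq_square)
  qed
  ultimately show ?thesis
    by (intro that[of g]) (simp_all add: q_def)
qed

section \<open>Entire functions with equal multipliers\<close>

lemma int_periodic:
  fixes f :: "complex \<Rightarrow> 'a"
  assumes "\<And>z. f (z + a) = f z"
  shows "f (z + of_int n * a) = f z"
proof (induction n arbitrary: z rule: int_induct[where k = 0])
  case (step1 i)
  have "f (z + of_int (i + 1) * a) = f ((z + of_int i * a) + a)"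
    by (simp add: algebra_simps)
  thus ?case
    using assms step1 by simp
next
  case (step2 i)
  have "f (z + of_int i * a) = f ((z + of_int (i - 1) * a) + a)"
    by (simp add: algebra_simps)
  thus ?case
    using assms step2 by simp
qed simp

text \<open>Liouville's theorem for \<open>f / g\<close>: equal multipliers make the quotient doubly
  periodic, and its possible singularities, the lattice points, are removable because the zero of
  \<open>g\<close> at 0 is simple and \<open>f\<close> vanishes there too.\<close>

lemma entire_ratio_constant:
  assumes \<tau>: "\<tau> \<in> uhp"
  assumes hol: "f holomorphic_on UNIV" "g holomorphic_on UNIV"
  assumes f1: "\<And>z. f (z + 1) = \<mu> z * f z" and g1: "\<And>z. g (z + 1) = \<mu> z * g z"
  assumes f\<tau>: "\<And>z. f (z + \<tau>) = \<kappa> z * f z" and g\<tau>: "\<And>z. g (z + \<tau>) = \<kappa> z * g z"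
  assumes nz: "\<And>z. \<mu> z \<noteq> 0" "\<And>z. \<kappa> z \<noteq> 0"
  assumes zeros: "\<And>z. g z = 0 \<Longrightarrow> \<exists>m n :: int. z = of_int m + of_int n * \<tau>"
  assumes f': "f' holomorphic_on UNIV" "\<And>z. f z = z * f' z"
  assumes g': "g' holomorphic_on UNIV" "\<And>z. g z = z * g' z" "g' 0 \<noteq> 0"
  shows "f z = f' 0 / g' 0 * g z"
proof -
  \<comment> \<open>At the zeros of \<open>g\<close>, where division would give the default value 0,
    the limit of \<open>f / g\<close> at 0 is inserted.\<close>
  define R where "R = (\<lambda>z. if g z = 0 then f' 0 / g' 0 else f z / g z)"
  have R1: "R (z + 1) = R z" and R\<tau>: "R (z + \<tau>) = R z" for z
    using nz by (auto simp: R_def f1 g1 f\<tau> g\<tau>)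
  have R_shift: "R (z + of_int m + of_int n * \<tau>) = R z" for z m n
    using int_periodic[of R \<tau>, OF R\<tau>] int_periodic[of R 1, OF R1] by simp
  have "R field_differentiable at z" for z
  proof (cases "g z = 0")
    case False
    have "open {z. g z \<noteq> 0}"
      using hol(2) by (intro open_Collect_neq holomorphic_on_imp_continuous_on continuous_on_const)
    moreover have "(\<lambda>z. f z / g z) holomorphic_on {z. g z \<noteq> 0}"
      using hol by (intro holomorphic_intros) (auto intro: holomorphic_on_subset)
    hence "R holomorphic_on {z. g z \<noteq> 0}"
      by (rule holomorphic_transform) (auto simp: R_def)
    ultimately show ?thesis
      using False by (auto simp: holomorphic_on_open field_differentiable_def)
  next
    case True
    then obtain m n where mn: "z = of_int m + of_int n * \<tau>"
      using zeros by blast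
    have "open {z. g' z \<noteq> 0}"
      using g'(1) by (intro open_Collect_neq holomorphic_on_imp_continuous_on continuous_on_const)
    moreover have "(\<lambda>z. f' z / g' z) holomorphic_on {z. g' z \<noteq> 0}"
      using f' g' by (intro holomorphic_intros) (auto intro: holomorphic_on_subset)
    hence "R holomorphic_on {z. g' z \<noteq> 0}"
      by (rule holomorphic_transform) (auto simp: R_def f' g')
    ultimately have "R field_differentiable at 0"
      using g'(3) by (auto simp: holomorphic_on_open field_differentiable_def)
    \<comment> \<open>Periodicity carries differentiability at 0 over to the lattice point
      \<open>z\<close>.\<close>
    hence "(R \<circ> (\<lambda>w. w - z)) field_differentiable at z"
      by (intro field_differentiable_compose derivative_intros) (auto intro!: derivative_intros)
    moreover have "R w = R (w - z)" for w
      using R_shift[of "w - z" m n] by (simp add: mn algebra_simps)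
    hence "R \<circ> (\<lambda>w. w - z) = R"
      by (auto simp: fun_eq_iff)
    ultimately show ?thesis by simp
  qed
  hence holR: "R holomorphic_on UNIV"
    by (simp add: holomorphic_on_def field_differentiable_at_within)
  \<comment> \<open>Replacing the coordinates with respect to 1 and \<open>\<tau>\<close> by their
    fractional parts moves every point into one fixed disc, on which \<open>R\<close> is bounded by
    compactness.\<close>
  have "range R \<subseteq> R ` cball 0 (1 + norm \<tau>)"
  proof safe
    fix z
    define x where "x = Im z / Im \<tau>"
    define y where "y = Re z - x * Re \<tau>"
    have z: "z = of_real y + of_real x * \<tau>"
      using \<tau> by (auto simp: complex_eq_iff x_def y_def uhp_def)
    define z' where "z' = of_real (frac y) + of_real (frac x) * \<tau>"
    have "z = z' + of_int \<lfloor>y\<rfloor> + of_int \<lfloor>x\<rfloor> * \<tau>"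
      unfolding z z'_def frac_def by (simp add: algebra_simps)
    hence "R z = R z'"
      by (simp only: R_shift)
    moreover have "norm z' \<le> frac y + frac x * norm \<tau>"
      unfolding z'_def by (rule norm_triangle_le) (simp add: norm_mult)
    hence "norm z' \<le> 1 + 1 * norm \<tau>"
      by (rule order_trans) (intro add_mono mult_right_mono, auto simp: less_imp_le frac_lt_1)
    ultimately show "R z \<in> R ` cball 0 (1 + norm \<tau>)"
      by auto
  qed
  moreover have "bounded (R ` cball 0 (1 + norm \<tau>))"
    using holR by (intro compact_imp_bounded compact_continuous_image)
      (auto intro: continuous_on_subset holomorphic_on_imp_continuous_on)
  ultimately have "bounded (range R)"
    by (rule bounded_subset[rotated])
  with holR have "R constant_on UNIV"
    by (rule Liouville_theorem)
  hence "R z = R 0"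
    by (auto simp: constant_on_def)
  moreover have "g 0 = 0"
    by (simp add: g')
  \<comment> \<open>At a zero of \<open>g\<close> the constancy of \<open>R\<close> says nothing
    about \<open>f\<close>; but \<open>f\<close> vanishes at 0 and its multipliers never vanish, so
    it is zero on the whole lattice.\<close>
  moreover have "f z = 0" if "g z = 0"
  proof -
    obtain m n where mn: "z = of_int m + of_int n * \<tau>"
      using zeros[OF \<open>g z = 0\<close>] by blast
    have "(f (0 + of_int m * 1 + of_int n * \<tau>) = 0) = (f 0 = 0)"
      using int_periodic[of "\<lambda>z. f z = 0" \<tau> "0 + of_int m * 1" n] int_periodic[of "\<lambda>z. f z = 0" 1 0 m] nz
      by (simp add: f1 f\<tau>)
    thus ?thesis
      by (simp add: mn f')
  qed
  ultimately show ?thesis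
    by (auto simp: R_def field_simps split: if_splits)
qed

lemma qpoch_nome_nonzero: "\<tau> \<in> uhp \<Longrightarrow> qpoch (nome \<tau>) (nome \<tau>) \<noteq> 0"
proof
  assume \<tau>: "\<tau> \<in> uhp" and "qpoch (nome \<tau>) (nome \<tau>) = 0"
  then obtain n where "nome \<tau> ^ Suc n = 1"
    using qpoch_eq_0_iff[OF norm_nome_less_1[OF \<tau>]] by auto
  hence "norm (nome \<tau>) ^ Suc n = 1"
    by (metis norm_one norm_power)
  moreover have "norm (nome \<tau>) ^ Suc n < 1"
    using norm_nome_less_1[OF \<tau>] by (subst power_less_one_iff) auto
  ultimately show False by simp
qed

text \<open>As functions of \<open>z\<close> both sides have the same multipliers under 1 and
  \<open>\<tau>\<close>: the Gaussian \<open>nome (z ^ 2 / (2 * \<tau>))\<close> compensates for the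
  exchanged roles of the periods. The second equation compares the leading terms at 0.\<close>

lemma theta_inversion:
  assumes "\<tau> \<in> uhp"
  obtains c where "\<And>z. theta (z / \<tau>) (-1 / \<tau>) = c * nome (z ^ 2 / (2 * \<tau>)) * theta z \<tau>"
    "c * \<tau> * qpoch (nome \<tau>) (nome \<tau>) ^ 2 = qpoch (nome (-1 / \<tau>)) (nome (-1 / \<tau>)) ^ 2"
proof -
  define \<tau>' where "\<tau>' = -1 / \<tau>"
  have \<tau>': "\<tau>' \<in> uhp" and nz: "\<tau> \<noteq> 0"
    using assms uhp_neg_inverse uhp_nonzero by (auto simp: \<tau>'_def)
  obtain g where g: "g holomorphic_on UNIV" "\<And>z. theta z \<tau> = z * g z"
    "g 0 = - 2 * of_real pi * \<i> * qpoch (nome \<tau>) (nome \<tau>) ^ 2"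
    using theta_simple_zero[OF assms] by blast
  obtain h where h: "h holomorphic_on UNIV" "\<And>z. theta z \<tau>' = z * h z"
    "h 0 = - 2 * of_real pi * \<i> * qpoch (nome \<tau>') (nome \<tau>') ^ 2"
    using theta_simple_zero[OF \<tau>'] by blast
  have "theta (z / \<tau>) \<tau>' = (h (0 / \<tau>) / \<tau>) / (nome (0 ^ 2 / (2 * \<tau>)) * g 0) * (nome (z ^ 2 / (2 * \<tau>)) * theta z \<tau>)" for z
  proof (rule entire_ratio_constant[OF assms, where f = "\<lambda>z. theta (z / \<tau>) \<tau>'"
        and g = "\<lambda>z. nome (z ^ 2 / (2 * \<tau>)) * theta z \<tau>" and f' = "\<lambda>z. h (z / \<tau>) / \<tau>"
        and g' = "\<lambda>z. nome (z ^ 2 / (2 * \<tau>)) * g z" and \<mu> = "\<lambda>z. - nome ((2 * z + 1) / (2 * \<tau>))" and \<kappa> = "\<lambda>_. -1"])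
    fix z :: complex
    \<comment> \<open>Adding 1 to \<open>z\<close> subtracts \<open>\<tau>'\<close> from
      \<open>z / \<tau>\<close>, so the rule for the second period is used backwards.\<close>
    have "theta ((z + 1) / \<tau> + \<tau>') \<tau>' = - nome (- \<tau>' / 2 - (z + 1) / \<tau>) * theta ((z + 1) / \<tau>) \<tau>'"
      by (rule theta_plus_tau[OF \<tau>'])
    also have "(z + 1) / \<tau> + \<tau>' = z / \<tau>"
      by (simp add: \<tau>'_def add_divide_distrib)
    also have "- \<tau>' / 2 - (z + 1) / \<tau> = - ((2 * z + 1) / (2 * \<tau>))"
      using nz by (simp add: \<tau>'_def field_simps)
    finally show "theta ((z + 1) / \<tau>) \<tau>' = - nome ((2 * z + 1) / (2 * \<tau>)) * theta (z / \<tau>) \<tau>'"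
      by (simp add: nome_minus)
    have "(z + 1) ^ 2 / (2 * \<tau>) = (2 * z + 1) / (2 * \<tau>) + z ^ 2 / (2 * \<tau>)"
      by (simp add: add_divide_distrib[symmetric] power2_eq_square algebra_simps)
    hence "nome ((z + 1) ^ 2 / (2 * \<tau>)) = nome ((2 * z + 1) / (2 * \<tau>)) * nome (z ^ 2 / (2 * \<tau>))"
      by (simp only: nome_add)
    thus "nome ((z + 1) ^ 2 / (2 * \<tau>)) * theta (z + 1) \<tau> =
       - nome ((2 * z + 1) / (2 * \<tau>)) * (nome (z ^ 2 / (2 * \<tau>)) * theta z \<tau>)"
      by (simp add: theta_plus_1)
    have "(z + \<tau>) / \<tau> = z / \<tau> + 1"
      using nz by (simp add: field_simps)
    thus "theta ((z + \<tau>) / \<tau>) \<tau>' = - 1 * theta (z / \<tau>) \<tau>'"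
      by (simp add: theta_plus_1)
    have "(z + \<tau>) ^ 2 / (2 * \<tau>) + (- \<tau> / 2 - z) = z ^ 2 / (2 * \<tau>)"
      using nz by (simp add: field_simps power2_eq_square)
    hence "nome ((z + \<tau>) ^ 2 / (2 * \<tau>)) * nome (- \<tau> / 2 - z) = nome (z ^ 2 / (2 * \<tau>))"
      by (simp only: nome_add[symmetric])
    thus "nome ((z + \<tau>) ^ 2 / (2 * \<tau>)) * theta (z + \<tau>) \<tau> = - 1 * (nome (z ^ 2 / (2 * \<tau>)) * theta z \<tau>)"
      by (simp add: theta_plus_tau[OF assms])
    show "\<exists>m n :: int. z = of_int m + of_int n * \<tau>" if "nome (z ^ 2 / (2 * \<tau>)) * theta z \<tau> = 0"
      using that by (intro theta_eq_0D assms) auto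
    show "theta (z / \<tau>) \<tau>' = z * (h (z / \<tau>) / \<tau>)"
      by (simp add: h(2))
    show "nome (z ^ 2 / (2 * \<tau>)) * theta z \<tau> = z * (nome (z ^ 2 / (2 * \<tau>)) * g z)"
      by (simp add: g(2))
    have "(h \<circ> (\<lambda>z. z / \<tau>)) holomorphic_on UNIV"
      using nz by (intro holomorphic_on_compose_gen[OF _ h(1)] holomorphic_intros) auto
    thus "(\<lambda>z. h (z / \<tau>) / \<tau>) holomorphic_on UNIV"
      using nz by (intro holomorphic_intros) (auto simp: o_def)
  qed (use nz g(1) assms \<tau>' qpoch_nome_nonzero[OF assms] in \<open>auto intro!: holomorphic_intros simp: g(3)\<close>)
  moreover have "h 0 = g 0 * (qpoch (nome \<tau>') (nome \<tau>') ^ 2 / qpoch (nome \<tau>) (nome \<tau>) ^ 2)"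
    using qpoch_nome_nonzero[OF assms] by (simp add: g(3) h(3))
  moreover have "g 0 \<noteq> 0"
    using qpoch_nome_nonzero[OF assms] by (simp add: g(3))
  ultimately show ?thesis
    using nz qpoch_nome_nonzero[OF assms]
    by (intro that[of "qpoch (nome \<tau>') (nome \<tau>') ^ 2 / qpoch (nome \<tau>) (nome \<tau>) ^ 2 / \<tau>"]) (simp_all add: \<tau>'_def)
qed

text \<open>Euler's identity behind partitions into distinct and into odd parts: the product of all
  \<open>1 + q ^ n\<close> with \<open>n \<ge> 1\<close> is inverse to the product of all
  \<open>1 - q ^ k\<close> with \<open>k\<close> odd.\<close>

lemma qpoch_euler:
  assumes "norm q < 1" "qpoch q q \<noteq> 0" "s ^ 2 = q"
  shows "qpoch (- q) q * qpoch s q * qpoch (- s) q = 1"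
proof -
  have "qpoch q q = qpoch q (q ^ 2) * qpoch (q ^ 2) (q ^ 2)"
    using qpoch_even_odd[OF assms(1), of q] by (simp add: power2_eq_square)
  also have "qpoch (q ^ 2) (q ^ 2) = qpoch q q * qpoch (- q) q"
    using qpoch_uminus_mult[OF assms(1), of q] by simp
  also have "qpoch q (q ^ 2) = qpoch s q * qpoch (- s) q"
    using qpoch_uminus_mult[OF assms(1), of s] assms(3) by simp
  finally show ?thesis
    using assms(2) by (simp add: mult_ac)
qed

text \<open>Each value is an elementary factor times the square of one of the three factors in
  \<open>qpoch_euler\<close>, so all infinite products disappear together.\<close>

lemma theta_half_periods:
  assumes "\<tau> \<in> uhp"
  shows "theta (1 / 2) \<tau> * theta (\<tau> / 2) \<tau> * theta (\<tau> / 2 + 1 / 2) \<tau> = - 2 * nome (- \<tau> / 2)"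
proof -
  define q s where "q = nome \<tau>" and "s = nome (\<tau> / 2)"
  have q: "norm q < 1"
    using norm_nome_less_1[OF assms] by (simp add: q_def)
  have s2: "s ^ 2 = q"
    by (simp add: s_def q_def nome_power)
  have s: "s \<noteq> 0" "q / s = s"
    by (simp_all add: s_def flip: s2) (simp add: power2_eq_square)
  have m1: "qpoch (-1) q = 2 * qpoch (- q) q"
    using qpoch_rec[OF q, of "-1"] by simp
  have i: "nome (- (1 / 4)) = - \<i>"
    by (simp add: nome_minus nome_quarter)
  have "theta (1 / 2) \<tau> = - \<i> * 2 * qpoch (- q) q ^ 2"
    using i by (simp add: theta_def nome_half m1 power2_eq_square flip: q_def)
  moreover have "theta (\<tau> / 2) \<tau> = nome (- \<tau> / 4) * qpoch s q ^ 2"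
    using s by (simp add: theta_def power2_eq_square flip: q_def s_def)
  moreover have "theta (\<tau> / 2 + 1 / 2) \<tau> = - \<i> * nome (- \<tau> / 4) * qpoch (- s) q ^ 2"
  proof -
    have "- (\<tau> / 2 + 1 / 2) / 2 = - (1 / 4) + - \<tau> / 4"
      by (simp add: field_simps)
    hence "nome (- (\<tau> / 2 + 1 / 2) / 2) = - \<i> * nome (- \<tau> / 4)"
      by (simp only: nome_add i)
    thus ?thesis
      using s by (simp only: theta_def nome_add nome_half flip: q_def s_def) (simp add: power2_eq_square)
  qed
  ultimately have "theta (1 / 2) \<tau> * theta (\<tau> / 2) \<tau> * theta (\<tau> / 2 + 1 / 2) \<tau> =
     - 2 * nome (- \<tau> / 4) ^ 2 * (qpoch (- q) q * qpoch s q * qpoch (- s) q) ^ 2"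
    by (simp add: power2_eq_square)
  also have "nome (- \<tau> / 4) ^ 2 = nome (- \<tau> / 2)"
    by (simp add: nome_power)
  also have "qpoch (- q) q * qpoch s q * qpoch (- s) q = 1"
    using qpoch_nome_nonzero[OF assms] by (intro qpoch_euler q s2) (simp add: q_def)
  finally show ?thesis by simp
qed

section \<open>Inversion of the twelfth power of eta\<close>

lemma dedekind_eta_altdef: "dedekind_eta \<tau> = nome (\<tau> / 24) * qpoch (nome \<tau>) (nome \<tau>)"
  by (simp add: dedekind_eta_def qpoch_def nome_def mult_ac)

lemma dedekind_eta_nonzero: "\<tau> \<in> uhp \<Longrightarrow> dedekind_eta \<tau> \<noteq> 0"
  by (simp add: dedekind_eta_altdef qpoch_nome_nonzero)

lemma dedekind_eta_power_12: "dedekind_eta \<tau> ^ 12 = nome (\<tau> / 2) * qpoch (nome \<tau>) (nome \<tau>) ^ 12"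
  by (simp add: dedekind_eta_altdef power_mult_distrib nome_power)

lemma dedekind_eta_power_12_plus_1: "dedekind_eta (\<tau> + 1) ^ 12 = - (dedekind_eta \<tau> ^ 12)"
  by (simp add: dedekind_eta_power_12 nome_add add_divide_distrib nome_half)

lemma dedekind_eta_power_12_inversion:
  assumes "\<tau> \<in> uhp"
  shows "dedekind_eta (-1 / \<tau>) ^ 12 = - (\<tau> ^ 6 * dedekind_eta \<tau> ^ 12)"
proof -
  define \<tau>' where "\<tau>' = -1 / \<tau>"
  define P where "P = (\<lambda>\<tau>. qpoch (nome \<tau>) (nome \<tau>))"
  have \<tau>': "\<tau>' \<in> uhp" and nz: "\<tau> \<noteq> 0"
    using assms uhp_neg_inverse uhp_nonzero by (auto simp: \<tau>'_def)
  obtain c where c: "\<And>z. theta (z / \<tau>) \<tau>' = c * nome (z ^ 2 / (2 * \<tau>)) * theta z \<tau>"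
    and cP: "c * \<tau> * P \<tau> ^ 2 = P \<tau>' ^ 2"
    using theta_inversion[OF assms] unfolding P_def \<tau>'_def by blast
  have t1: "theta (-1 / 2) \<tau> = - theta (1 / 2) \<tau>"
    using theta_plus_1[of "-1/2" \<tau>] by simp
  have t2: "theta (\<tau> / 2 - 1 / 2) \<tau> = - theta (\<tau> / 2 + 1 / 2) \<tau>"
    using theta_plus_1[of "\<tau> / 2 - 1/2" \<tau>] by (simp add: add.commute)
  \<comment> \<open>At \<open>\<tau> / 2\<close>, \<open>-1 / 2\<close> and
    \<open>(\<tau> - 1) / 2\<close> the inversion formula yields the half periods of the inverted
    lattice. Both triple products are known, so multiplying the relations leaves
    \<open>c ^ 3\<close> as the only unknown.\<close>
  have "theta (1 / 2) \<tau>' = c * nome (\<tau> / 8) * theta (\<tau> / 2) \<tau>"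
    using c[of "\<tau> / 2"] nz by (simp add: power2_eq_square)
  moreover have "theta (\<tau>' / 2) \<tau>' = - (c * nome (1 / (8 * \<tau>)) * theta (1 / 2) \<tau>)"
    using c[of "- 1 / 2"] nz t1 by (simp add: power2_eq_square \<tau>'_def mult_ac)
  moreover have "theta (\<tau>' / 2 + 1 / 2) \<tau>' = - (c * nome ((\<tau> / 2 - 1 / 2) ^ 2 / (2 * \<tau>)) * theta (\<tau> / 2 + 1 / 2) \<tau>)"
  proof -
    have "\<tau>' / 2 + 1 / 2 = (\<tau> / 2 - 1 / 2) / \<tau>"
      using nz by (simp add: \<tau>'_def field_simps)
    thus ?thesis
      using c[of "\<tau> / 2 - 1 / 2"] t2 by simp
  qed
  ultimately have "- 2 * nome (- \<tau>' / 2) = 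
     c ^ 3 * (nome (\<tau> / 8) * nome (1 / (8 * \<tau>)) * nome ((\<tau> / 2 - 1 / 2) ^ 2 / (2 * \<tau>))) *
       (theta (1 / 2) \<tau> * theta (\<tau> / 2) \<tau> * theta (\<tau> / 2 + 1 / 2) \<tau>)"
    unfolding theta_half_periods[OF \<tau>', symmetric] by (simp add: power3_eq_cube)
  also have "nome (\<tau> / 8) * nome (1 / (8 * \<tau>)) * nome ((\<tau> / 2 - 1 / 2) ^ 2 / (2 * \<tau>)) = 
      nome (\<tau> / 4 + 1 / (4 * \<tau>) - 1 / 4)"
    unfolding nome_add[symmetric] using nz
    by (intro arg_cong[where f = nome]) (simp add: field_simps power2_eq_square)
  finally have "nome (- \<tau>' / 2) = c ^ 3 * (nome (\<tau> / 4 + 1 / (4 * \<tau>) - 1 / 4) * nome (- \<tau> / 2))"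
    unfolding theta_half_periods[OF assms] by simp
  \<comment> \<open>Squaring produces \<open>c ^ 6\<close>, the power that occurs when
    \<open>cP\<close> is raised to the sixth power to reach \<open>P ^ 12\<close>.\<close>
  hence "nome (- \<tau>' / 2) ^ 2 = c ^ 6 * (nome (\<tau> / 4 + 1 / (4 * \<tau>) - 1 / 4) * nome (- \<tau> / 2)) ^ 2"
    by (simp add: power_mult_distrib flip: power_mult)
  moreover have "nome (- \<tau>' / 2) ^ 2 = nome (1 / \<tau>)"
    by (simp add: nome_power \<tau>'_def)
  moreover have "(nome (\<tau> / 4 + 1 / (4 * \<tau>) - 1 / 4) * nome (- \<tau> / 2)) ^ 2 = nome (1 / (2 * \<tau>) - \<tau> / 2 - 1 / 2)"
    unfolding nome_power nome_add[symmetric] using nz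
    by (intro arg_cong[where f = nome]) (simp add: field_simps)
  \<comment> \<open>The summand \<open>- 1 / 2\<close> in the exponent is the source of the minus
    sign in the transformation law.\<close>
  ultimately have c6: "nome (1 / \<tau>) = - (c ^ 6 * nome (1 / (2 * \<tau>)) / nome (\<tau> / 2))"
    by (simp add: nome_diff nome_half)
  have "nome (1 / \<tau>) = nome (1 / (2 * \<tau>)) * nome (1 / (2 * \<tau>))"
    using nz by (simp flip: nome_add)
  with c6 have "(c ^ 6 + nome (\<tau> / 2) * nome (1 / (2 * \<tau>))) * nome (1 / (2 * \<tau>)) = 0"
    by (simp add: field_simps del: mult_eq_0_iff)
  hence "c ^ 6 = - (nome (\<tau> / 2) * nome (1 / (2 * \<tau>)))"
    by (simp add: eq_neg_iff_add_eq_0)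
  hence c6': "nome (- (1 / (2 * \<tau>))) * c ^ 6 = - nome (\<tau> / 2)"
    by (simp add: nome_minus)
  have "dedekind_eta \<tau>' ^ 12 = nome (- (1 / (2 * \<tau>))) * (P \<tau>' ^ 2) ^ 6"
    by (simp add: dedekind_eta_power_12 P_def \<tau>'_def mult_ac flip: power_mult)
  also have "\<dots> = nome (- (1 / (2 * \<tau>))) * c ^ 6 * \<tau> ^ 6 * P \<tau> ^ 12"
    by (simp flip: cP power_mult add: power_mult_distrib)
  also have "\<dots> = - (\<tau> ^ 6 * dedekind_eta \<tau> ^ 12)"
    unfolding c6' by (simp add: dedekind_eta_power_12 P_def)
  finally show ?thesis by (simp add: \<tau>'_def)
qed

section \<open>The twelfth power of the Dedekind eta function\<close>

lemma affine_nonzero_uhp: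
  fixes c d :: int
  assumes "\<tau> \<in> uhp" "c \<noteq> 0 \<or> d \<noteq> 0"
  shows "of_int c * \<tau> + of_int d \<noteq> 0"
proof
  assume eq: "of_int c * \<tau> + of_int d = 0"
  hence "Im (of_int c * \<tau> + of_int d) = 0" by simp
  hence "c = 0" using assms by (simp add: uhp_def)
  thus False using eq assms by simp
qed

lemma moebius_in_uhp:
  fixes a b c d :: int
  assumes "\<tau> \<in> uhp" "a * d - b * c = 1"
  shows "(of_int a * \<tau> + of_int b) / (of_int c * \<tau> + of_int d) \<in> uhp"
proof -
  have "c \<noteq> 0 \<or> d \<noteq> 0"
    using assms by auto
  hence nz: "of_int c * \<tau> + of_int d \<noteq> 0"
    by (rule affine_nonzero_uhp[OF assms(1)])
  have "Im ((of_int a * \<tau> + of_int b) / (of_int c * \<tau> + of_int d)) =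
    of_int (a * d - b * c) * Im \<tau> / norm (of_int c * \<tau> + of_int d) ^ 2"
    by (simp add: Im_divide cmod_power2) (simp add: algebra_simps power2_eq_square)
  also have "\<dots> > 0"
    using assms nz by (auto simp: uhp_def)
  finally show ?thesis by (simp add: uhp_def)
qed

lemma dedekind_eta_power_12_plus_int:
  "dedekind_eta (\<tau> + of_int n) ^ 12 = (if even n then 1 else -1) * dedekind_eta \<tau> ^ 12"
proof (induction n arbitrary: \<tau> rule: int_induct[where k = 0])
  case (step1 i)
  have "\<tau> + of_int (i + 1) = (\<tau> + of_int i) + 1" by simp
  thus ?case using step1 dedekind_eta_power_12_plus_1[of "\<tau> + of_int i"] by (simp only:) auto
next
  case (step2 i)
  have "dedekind_eta (\<tau> + of_int (i - 1)) ^ 12 = - (dedekind_eta (\<tau> + of_int i) ^ 12)"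
    using dedekind_eta_power_12_plus_1[of "\<tau> + of_int (i - 1)"] by simp
  thus ?case using step2(2)[of \<tau>] by (simp only:) auto
qed simp

text \<open>The sign \<open>(-1)\<^bsup>ab + bc + cd\<^esup>\<close> is the signature of the matrix in
  \<open>SL\<^sub>2(\<int>/2) = S\<^sub>3\<close>.\<close>

lemma dedekind_eta_power_12_modular:
  fixes a b c d :: int
  assumes "a * d - b * c = 1" "\<tau> \<in> uhp"
  shows "dedekind_eta ((of_int a * \<tau> + of_int b) / (of_int c * \<tau> + of_int d)) ^ 12 =
    (if even (a * b + b * c + c * d) then 1 else -1) * (of_int c * \<tau> + of_int d) ^ 6 * dedekind_eta \<tau> ^ 12"
  using assms
\<comment> \<open>This is the Euclidean algorithm on the bottom row: a translation replaces
  \<open>d\<close> by \<open>d mod c\<close>, and an inversion makes \<open>- d'\<close> the new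
  lower left entry, of smaller absolute value.\<close>
proof (induction "nat \<bar>c\<bar>" arbitrary: a b c d \<tau> rule: less_induct)
  case less
  show ?case
  proof (cases "c = 0")
    case True
    hence "a * d = 1" using less.prems by simp
    hence ad: "a = 1 \<and> d = 1 \<or> a = -1 \<and> d = -1"
      using zmult_eq_1_iff by blast
    hence "(of_int a * \<tau> + of_int b) / (of_int c * \<tau> + of_int d) = \<tau> + of_int (b * d)"
      using True by auto
    hence "dedekind_eta ((of_int a * \<tau> + of_int b) / (of_int c * \<tau> + of_int d)) ^ 12 =
        (if even (b * d) then 1 else -1) * dedekind_eta \<tau> ^ 12"
      by (simp only: dedekind_eta_power_12_plus_int)
    thus ?thesis
      using True ad by auto
  next
    case False
    define k where "k = d div c"
    define b' d' where "b' = b - a * k" and "d' = d - c * k"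
    have bd: "b = b' + a * k" "d = d' + c * k"
      by (simp_all add: b'_def d'_def)
    have det: "a * d' - b' * c = 1"
      using less.prems(1) by (simp add: b'_def d'_def algebra_simps)
    have "d' = d mod c"
      by (simp add: d'_def k_def minus_mult_div_eq_mod)
    hence lt: "nat \<bar>- d'\<bar> < nat \<bar>c\<bar>"
      using False abs_mod_less[of c d] by simp
    define \<tau>1 where "\<tau>1 = \<tau> + of_int k"
    have \<tau>1: "\<tau>1 \<in> uhp"
      using less.prems by (simp add: \<tau>1_def uhp_def)
    have nz: "\<tau>1 \<noteq> 0" "of_int c * \<tau>1 + of_int d' \<noteq> 0"
      using \<tau>1 uhp_nonzero affine_nonzero_uhp[OF \<tau>1, of c d'] False by auto
    have "(of_int (- b') * (-1 / \<tau>1) + of_int a) / (of_int (- d') * (-1 / \<tau>1) + of_int c) =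
      (of_int a * \<tau>1 + of_int b') / (of_int c * \<tau>1 + of_int d')"
      using nz by (simp add: divide_simps) (simp add: algebra_simps)
    also have "\<dots> = (of_int a * \<tau> + of_int b) / (of_int c * \<tau> + of_int d)"
      by (simp add: \<tau>1_def bd algebra_simps)
    finally have eq: "(of_int (- b') * (-1 / \<tau>1) + of_int a) / (of_int (- d') * (-1 / \<tau>1) + of_int c) =
      (of_int a * \<tau> + of_int b) / (of_int c * \<tau> + of_int d)" .
    have "- b' * c - a * - d' = 1"
      using det by simp
    from less.hyps[OF lt this uhp_neg_inverse[OF \<tau>1]]
    have "dedekind_eta ((of_int a * \<tau> + of_int b) / (of_int c * \<tau> + of_int d)) ^ 12 =
      (if even (- b' * a + a * - d' + - d' * c) then 1 else -1) * (of_int (- d') * (-1 / \<tau>1) + of_int c) ^ 6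
       * dedekind_eta (-1 / \<tau>1) ^ 12"
      unfolding eq .
    also have "of_int (- d') * (-1 / \<tau>1) + of_int c = (of_int c * \<tau> + of_int d) / \<tau>1"
      using nz by (simp add: \<tau>1_def bd field_simps)
    also have "dedekind_eta (-1 / \<tau>1) ^ 12 = - (\<tau>1 ^ 6 * ((if even k then 1 else -1) * dedekind_eta \<tau> ^ 12))"
      by (simp only: dedekind_eta_power_12_inversion[OF \<tau>1]) (simp add: \<tau>1_def dedekind_eta_power_12_plus_int)
    finally have "dedekind_eta ((of_int a * \<tau> + of_int b) / (of_int c * \<tau> + of_int d)) ^ 12 =
      - (if even (- b' * a + a * - d' + - d' * c) then 1 else -1) * (if even k then 1 else -1) *
      (of_int c * \<tau> + of_int d) ^ 6 * dedekind_eta \<tau> ^ 12"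
      using nz by (simp add: power_divide)
    moreover have "odd (a * d' - b' * c)"
      using det by simp
    \<comment> \<open>The two signs are compared by parities alone; the input is that the
      determinant is odd.\<close>
    hence "even (a * b + b * c + c * d) \<longleftrightarrow> \<not> (even (- b' * a + a * - d' + - d' * c) \<longleftrightarrow> even k)"
      unfolding bd by (simp only: even_add even_diff even_mult_iff even_minus) blast
    ultimately show ?thesis
      by (auto split: if_splits)
  qed
qed

text \<open>\<open>a'\<close>, \<open>b'\<close>, \<open>c\<close>, \<open>d'\<close> are the
  entries after multiplying by the translation by \<open>j / n\<close> on the left and by
  \<open>- j' / n\<close> on the right. They are integers because \<open>n ^ 2\<close> divides
  \<open>c\<close> and \<open>n\<close> divides \<open>j * d - j' * a\<close>; the denominator at
  the shifted point is still that of \<open>\<tau>\<close>.\<close>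

lemma dedekind_eta_power_12_shift_Gamma0:
  fixes a b c d j j' k m :: int
  assumes "a * d - b * (n ^ 2 * m) = 1" "c = n ^ 2 * m" "j * d - j' * a = n * k" "n \<noteq> 0" "\<tau> \<in> uhp"
  defines "a' \<equiv> a + j * n * m" and "b' \<equiv> b + k - j * j' * m" and "d' \<equiv> d - j' * n * m"
  shows "dedekind_eta ((of_int a * \<tau> + of_int b) / (of_int c * \<tau> + of_int d) + of_int j / of_int n) ^ 12 =
    (if even (a' * b' + b' * c + c * d') then 1 else -1) * (of_int c * \<tau> + of_int d) ^ 6 *
      dedekind_eta (\<tau> + of_int j' / of_int n) ^ 12"
proof -
  define \<sigma> where "\<sigma> = \<tau> + of_int j' / of_int n"
  have \<sigma>: "\<sigma> \<in> uhp"
    using assms(5) by (simp add: \<sigma>_def uhp_def Im_divide)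
  have "a' * d' - b' * c = (a * d - b * (n ^ 2 * m)) + n * m * (j * d - j' * a - n * k)"
    by (simp add: a'_def b'_def d'_def assms(2) power2_eq_square algebra_simps)
  also have "\<dots> = 1"
    using assms(1,3) by simp
  finally have det: "a' * d' - b' * c = 1" .
  have "c \<noteq> 0 \<or> d \<noteq> 0"
    using assms by auto
  hence nz: "of_int c * \<tau> + of_int d \<noteq> 0"
    by (rule affine_nonzero_uhp[OF assms(5)])
  have n: "(of_int n :: complex) \<noteq> 0"
    using assms by simp
  have 1: "of_int c * \<sigma> + of_int d' = of_int c * \<tau> + of_int d"
    using n by (simp add: \<sigma>_def d'_def assms(2) field_simps power2_eq_square)
  have "of_int k = (of_int j * of_int d - of_int j' * of_int a) / (of_int n :: complex)"
    using n arg_cong[OF assms(3), of "of_int :: int \<Rightarrow> complex"] by (simp add: field_simps)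
  hence "of_int a' * \<sigma> + of_int b' = of_int a * \<tau> + of_int b + of_int j / of_int n * (of_int c * \<tau> + of_int d)"
    using n by (simp add: \<sigma>_def a'_def b'_def assms(2) field_simps power2_eq_square)
  hence "(of_int a' * \<sigma> + of_int b') / (of_int c * \<sigma> + of_int d') =
     (of_int a * \<tau> + of_int b) / (of_int c * \<tau> + of_int d) + of_int j / of_int n"
    unfolding 1 using nz by (simp add: add_divide_distrib)
  with dedekind_eta_power_12_modular[OF det \<sigma>] show ?thesis
    unfolding 1 by (simp add: \<sigma>_def)
qed

text \<open>The matrix of \<open>\<tau> \<mapsto> A \<tau> + j/n\<close>, scaled by \<open>n\<close>, is brought to Hermite normal form
  \<open>(\<alpha> \<beta>; 0 \<delta>)\<close> by a left factor in \<open>SL\<^sub>2(\<int>)\<close>.\<close>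

lemma dedekind_eta_power_12_shift_cusp:
  fixes a b c d j :: int and n :: nat
  assumes "a * d - b * c = 1" "n > 0"
  obtains \<alpha> \<delta> :: nat and \<beta> :: int and s :: complex
  where "\<alpha> > 0" "\<delta> > 0" "\<alpha> * \<delta> = n ^ 2" "s \<noteq> 0"
    "\<And>\<tau>. \<tau> \<in> uhp \<Longrightarrow> dedekind_eta ((of_int a * \<tau> + of_int b) / (of_int c * \<tau> + of_int d) + of_int j / of_nat n) ^ 12 =
       s * (of_int c * \<tau> + of_int d) ^ 6 * dedekind_eta ((of_nat \<alpha> * \<tau> + of_int \<beta>) / of_nat \<delta>) ^ 12"
proof -
  define N where "N = int n"
  define x y where "x = N * a + j * c" and "y = N * c"
  have N: "N > 0" using assms by (simp add: N_def)
  have det: "x * (N * d) - y * (N * b + j * d) = N ^ 2"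
  proof -
    have "x * (N * d) - y * (N * b + j * d) = N ^ 2 * (a * d - b * c)"
      by (simp add: x_def y_def power2_eq_square algebra_simps)
    thus ?thesis using assms by simp
  qed
  \<comment> \<open>This gcd will be \<open>\<alpha>\<close>. Dividing it out of the first column
    \<open>(x, y)\<close> leaves a primitive column, which Bezout's identity completes to a matrix
    of determinant 1.\<close>
  define g where "g = gcd x y"
  have "x \<noteq> 0 \<or> y \<noteq> 0"
    using det N by auto
  hence g: "g > 0" unfolding g_def using gcd_pos_int by blast
  obtain x' y' where x': "x = g * x'" and y': "y = g * y'" "coprime x' y'"
    using gcd_coprime_exists[of x y] g unfolding g_def by (metis mult.commute less_irrefl)
  obtain v u where "v * x' + u * y' = 1"
    using bezout_int[of x' y'] y'(2) by (auto simp: coprime_iff_gcd_eq_1)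
  then obtain u where uv: "x' * v - u * y' = 1"
    using that by (metis diff_minus_eq_add mult.commute mult_minus_left)
  \<comment> \<open>\<open>\<beta>\<close> and \<open>\<delta>\<close> arise by applying the inverse
    of that matrix to the second column \<open>(N * b + j * d, N * d)\<close>.\<close>
  define \<beta> where "\<beta> = v * (N * b + j * d) - u * (N * d)"
  define \<delta> where "\<delta> = x' * (N * d) - y' * (N * b + j * d)"
  have g\<delta>: "g * \<delta> = N ^ 2"
    using det by (simp add: \<delta>_def x' y' algebra_simps)
  hence \<delta>: "\<delta> > 0"
    using g N by (metis zero_less_mult_pos zero_less_power)
  have e1: "x' * \<beta> + u * \<delta> = N * b + j * d"
  proof -
    have "x' * \<beta> + u * \<delta> = (x' * v - u * y') * (N * b + j * d)"
      by (simp add: \<beta>_def \<delta>_def algebra_simps)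
    thus ?thesis by (simp add: uv)
  qed
  have e2: "y' * \<beta> + v * \<delta> = N * d"
  proof -
    have "y' * \<beta> + v * \<delta> = (x' * v - u * y') * (N * d)"
      by (simp add: \<beta>_def \<delta>_def algebra_simps)
    thus ?thesis by (simp add: uv)
  qed
  \<comment> \<open>At \<open>\<sigma>\<close> the denominator of the left factor is
    \<open>N / \<delta>\<close> times the original one, whence the sixth power.\<close>
  define s :: complex where "s = (if even (x' * u + u * y' + y' * v) then 1 else -1) * (of_int N / of_int \<delta>) ^ 6"
  have "dedekind_eta ((of_int a * \<tau> + of_int b) / (of_int c * \<tau> + of_int d) + of_int j / of_nat n) ^ 12 =
       s * (of_int c * \<tau> + of_int d) ^ 6 * dedekind_eta ((of_nat (nat g) * \<tau> + of_int \<beta>) / of_nat (nat \<delta>)) ^ 12"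
    if \<tau>: "\<tau> \<in> uhp" for \<tau>
  proof -
    define \<sigma> where "\<sigma> = (of_int g * \<tau> + of_int \<beta>) / (of_int \<delta> :: complex)"
    have nz: "(of_int \<delta> :: complex) \<noteq> 0" "(of_int N :: complex) \<noteq> 0"
      using \<delta> N by auto
    have "Im \<sigma> = of_int g * Im \<tau> / of_int \<delta>"
      using nz by (simp add: \<sigma>_def Im_divide power2_eq_square)
    hence \<sigma>: "\<sigma> \<in> uhp"
      using \<tau> g \<delta> by (simp add: uhp_def)
    have "c \<noteq> 0 \<or> d \<noteq> 0"
      using assms by auto
    hence nz': "of_int c * \<tau> + of_int d \<noteq> 0"
      by (rule affine_nonzero_uhp[OF \<tau>])
    have "of_int y' * \<sigma> + of_int v = (of_int (g * y') * \<tau> + of_int (y' * \<beta> + v * \<delta>)) / of_int \<delta>"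
      using nz by (simp add: \<sigma>_def field_simps)
    also have "\<dots> = of_int N / of_int \<delta> * (of_int c * \<tau> + of_int d)"
      unfolding e2 y'(1)[symmetric] by (simp add: y_def field_simps)
    finally have 1: "of_int y' * \<sigma> + of_int v = of_int N / of_int \<delta> * (of_int c * \<tau> + of_int d)" .
    have "of_int x' * \<sigma> + of_int u = (of_int (g * x') * \<tau> + of_int (x' * \<beta> + u * \<delta>)) / of_int \<delta>"
      using nz by (simp add: \<sigma>_def field_simps)
    also have "\<dots> = of_int N / of_int \<delta> * (of_int a * \<tau> + of_int b) + of_int j / of_int \<delta> * (of_int c * \<tau> + of_int d)"
      unfolding e1 x'[symmetric] by (simp add: x_def field_simps add_divide_distrib)
    finally have 2: "of_int x' * \<sigma> + of_int u = of_int N / of_int \<delta> * (of_int a * \<tau> + of_int b) + of_int j / of_int \<delta> * (of_int c * \<tau> + of_int d)" .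
    have *: "(K / D * X + J / D * Y) / (K / D * Y) = X / Y + J / K"
      if "K \<noteq> 0" "D \<noteq> 0" "Y \<noteq> 0" for K D X Y J :: complex
      using that by (simp add: field_simps)
    have "(of_int x' * \<sigma> + of_int u) / (of_int y' * \<sigma> + of_int v) =
      (of_int a * \<tau> + of_int b) / (of_int c * \<tau> + of_int d) + of_int j / of_int N"
      unfolding 1 2 using nz nz' by (intro *) auto
    with dedekind_eta_power_12_modular[OF uv \<sigma>] show ?thesis
      unfolding 1 using g \<delta> by (simp add: s_def power_mult_distrib power_divide N_def) (simp add: \<sigma>_def)
  qed
  moreover have "s \<noteq> 0"
    using \<delta> N by (simp add: s_def)
  moreover have "nat g * nat \<delta> = n ^ 2"
    using g\<delta> g \<delta> by (simp add: N_def nat_mult_distrib[symmetric] nat_power_eq)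
  ultimately show ?thesis
    using g \<delta> by (intro that[of "nat g" "nat \<delta>" s \<beta>]) auto
qed

section \<open>Congruence subgroups\<close>

text \<open>For determinant 1 this is the inverse matrix.\<close>

definition adjugate2 :: "int^2^2 \<Rightarrow> int^2^2" where
  "adjugate2 A = vector [vector [A $ 2 $ 2, - (A $ 1 $ 2)], vector [- (A $ 2 $ 1), A $ 1 $ 1]]"

lemma mat2_eq_iff:
  "(A :: 'a^2^2) = B \<longleftrightarrow> A $ 1 $ 1 = B $ 1 $ 1 \<and> A $ 1 $ 2 = B $ 1 $ 2 \<and> A $ 2 $ 1 = B $ 2 $ 1 \<and> A $ 2 $ 2 = B $ 2 $ 2"
  by (auto simp: vec_eq_iff forall_2)

lemma matrix_mult_2: "((A :: 'a::semiring_1^2^2) ** B) $ i $ j = A $ i $ 1 * B $ 1 $ j + A $ i $ 2 * B $ 2 $ j"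
  by (simp add: matrix_matrix_mult_def sum_2)

lemma mat_1_2 [simp]: "(mat 1 :: int^2^2) $ 1 $ 1 = 1" "(mat 1 :: int^2^2) $ 1 $ 2 = 0"
  "(mat 1 :: int^2^2) $ 2 $ 1 = 0" "(mat 1 :: int^2^2) $ 2 $ 2 = 1"
  by (simp_all add: mat_def)

lemma det_adjugate2: "det (adjugate2 A) = det A"
  by (simp add: adjugate2_def det_2)

lemma adjugate2_mult: "det A = 1 \<Longrightarrow> adjugate2 A ** A = mat 1"
  by (simp add: mat2_eq_iff matrix_mult_2 adjugate2_def det_2 mult_ac)

lemma group_SL2Z: "group SL2Z"
proof (rule groupI)
  show "\<exists>B\<in>carrier SL2Z. B \<otimes>\<^bsub>SL2Z\<^esub> A = \<one>\<^bsub>SL2Z\<^esub>" if "A \<in> carrier SL2Z" for A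
    using that by (intro bexI[of _ "adjugate2 A"]) (auto simp: SL2Z_def adjugate2_mult det_adjugate2)
qed (simp_all add: SL2Z_def det_mul matrix_mul_assoc)

lemma inv_SL2Z: "A \<in> carrier SL2Z \<Longrightarrow> inv\<^bsub>SL2Z\<^esub> A = adjugate2 A"
  by (rule group.inv_equality[OF group_SL2Z]) (auto simp: SL2Z_def adjugate2_mult det_adjugate2)

lemma subgroup_Gamma0: "subgroup (Gamma0 N) SL2Z"
proof (rule group.subgroupI[OF group_SL2Z])
  show "Gamma0 N \<subseteq> carrier SL2Z"
    by (auto simp: Gamma0_def SL2Z_def)
  have "mat 1 \<in> Gamma0 N"
    by (simp add: Gamma0_def)
  thus "Gamma0 N \<noteq> {}" by blast
  show "inv\<^bsub>SL2Z\<^esub> A \<in> Gamma0 N" if "A \<in> Gamma0 N" for A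
  proof -
    have "A \<in> carrier SL2Z"
      using that by (simp add: Gamma0_def SL2Z_def)
    thus ?thesis
      using that by (simp add: inv_SL2Z Gamma0_def det_adjugate2) (simp add: adjugate2_def)
  qed
  show "A \<otimes>\<^bsub>SL2Z\<^esub> B \<in> Gamma0 N" if "A \<in> Gamma0 N" "B \<in> Gamma0 N" for A B
    using that by (auto simp: Gamma0_def SL2Z_def det_mul matrix_mult_2)
qed

text \<open>A coset depends only on the bottom row modulo \<open>N\<close>: if the bottom rows of
  \<open>A\<close> and \<open>B\<close> agree modulo \<open>N\<close>, the lower left entry of
  \<open>A\<close> times the inverse of \<open>B\<close> is divisible by \<open>N\<close>.\<close>

lemma finite_rcosets_Gamma0:
  assumes "N > 0"
  shows "finite (rcosets\<^bsub>SL2Z\<^esub> (Gamma0 N))"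
proof -
  let ?C = "carrier SL2Z" and ?F = "\<lambda>A. Gamma0 N #>\<^bsub>SL2Z\<^esub> A"
  define \<phi> where "\<phi> = (\<lambda>A :: int^2^2. (A $ 2 $ 1 mod int N, A $ 2 $ 2 mod int N))"
  have eq: "?F A = ?F B" if AB: "A \<in> ?C" "B \<in> ?C" "\<phi> A = \<phi> B" for A B
  proof -
    have "int N dvd A $ 2 $ 1 - B $ 2 $ 1" "int N dvd A $ 2 $ 2 - B $ 2 $ 2"
      using AB(3) by (simp_all add: \<phi>_def mod_eq_dvd_iff)
    hence "int N dvd (A $ 2 $ 1 - B $ 2 $ 1) * B $ 2 $ 2 - (A $ 2 $ 2 - B $ 2 $ 2) * B $ 2 $ 1"
      by (rule dvd_diff[OF dvd_mult2 dvd_mult2])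
    hence "A ** adjugate2 B \<in> Gamma0 N"
      using AB by (simp add: Gamma0_def SL2Z_def det_mul det_adjugate2)
        (simp add: matrix_mult_2 adjugate2_def algebra_simps)
    moreover have "A = (A ** adjugate2 B) \<otimes>\<^bsub>SL2Z\<^esub> B"
      using AB by (simp add: SL2Z_def matrix_mul_assoc[symmetric] adjugate2_mult)
    ultimately have "A \<in> ?F B"
      unfolding r_coset_def by blast
    thus ?thesis
      using group.repr_independence[OF group_SL2Z _ AB(2) subgroup_Gamma0] by metis
  qed
  have "\<phi> ` ?C \<subseteq> {0..<int N} \<times> {0..<int N}"
    using assms by (auto simp: \<phi>_def)
  hence "finite (\<phi> ` ?C)"
    by (rule finite_subset) auto
  hence "finite ((\<lambda>x. ?F (inv_into ?C \<phi> x)) ` \<phi> ` ?C)"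
    by (rule finite_imageI)
  moreover have "?F ` ?C \<subseteq> (\<lambda>x. ?F (inv_into ?C \<phi> x)) ` \<phi> ` ?C"
  proof
    fix X assume "X \<in> ?F ` ?C"
    then obtain A where A: "A \<in> ?C" "X = ?F A" by blast
    have "?F A = ?F (inv_into ?C \<phi> (\<phi> A))"
      using A by (intro eq) (auto intro: inv_into_into simp: f_inv_into_f)
    thus "X \<in> (\<lambda>x. ?F (inv_into ?C \<phi> x)) ` \<phi> ` ?C"
      using A by blast
  qed
  ultimately have "finite (?F ` ?C)"
    by (rule finite_subset[rotated])
  moreover have "rcosets\<^bsub>SL2Z\<^esub> (Gamma0 N) = ?F ` ?C"
    by (auto simp: RCOSETS_def)
  ultimately show ?thesis by simp
qed

section \<open>The action on the upper half-plane\<close>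

lemma moebius_uhp:
  assumes "det A = 1" "\<tau> \<in> uhp"
  shows "moebius A \<tau> \<in> uhp"
  unfolding moebius_def using assms by (intro moebius_in_uhp) (auto simp: det_2)

lemma moebius_denom_nonzero:
  fixes A :: "int^2^2"
  assumes "det A = 1" "\<tau> \<in> uhp"
  shows "of_int (A $ 2 $ 1) * \<tau> + of_int (A $ 2 $ 2) \<noteq> 0"
  using assms by (intro affine_nonzero_uhp) (auto simp: det_2)

lemma moebius_mult:
  assumes "det A = 1" "det B = 1" "\<tau> \<in> uhp"
  shows "moebius (A ** B) \<tau> = moebius A (moebius B \<tau>)"
proof -
  have *: "(a * (x / y) + b) / (c * (x / y) + d) = (a * x + b * y) / (c * x + d * y)" if "y \<noteq> 0" for a b c d x y :: complex
  proof -
    have "a * (x / y) + b = (a * x + b * y) / y" "c * (x / y) + d = (c * x + d * y) / y"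
      using that by (simp_all add: field_simps)
    thus ?thesis using that by simp
  qed
  show ?thesis
    unfolding moebius_def[of A] moebius_def[of B]
    by (subst *[OF moebius_denom_nonzero[OF assms(2,3)]])
       (simp add: moebius_def matrix_mult_2 algebra_simps)
qed

lemma moebius_translation: "moebius (translation w) \<tau> = \<tau> + of_nat w"
  by (simp add: moebius_def translation_def)

lemma det_translation: "det (translation w) = 1"
  by (simp add: translation_def det_2)

lemma holomorphic_moebius:
  assumes "det A = 1"
  shows "moebius A holomorphic_on uhp"
  unfolding moebius_def[abs_def] using moebius_denom_nonzero[OF assms]
  by (intro holomorphic_intros) auto

text \<open>With \<open>c\<close> the lower left entry of \<open>A\<close>, that of the conjugate is
  \<open>- (c ^ 2 * w)\<close>. Hence for level \<open>N ^ 2\<close> the width \<open>N ^ 2\<close>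
  serves at every cusp.\<close>

lemma Gamma0_conj_translation:
  assumes "det A = 1"
  obtains B where "B \<in> Gamma0 w" "B ** A = A ** translation w"
proof
  define B where "B = A ** translation w ** adjugate2 A"
  have "A ** adjugate2 A = mat 1"
    using assms by (simp add: mat2_eq_iff matrix_mult_2 adjugate2_def det_2 mult_ac)
  thus "B \<in> Gamma0 w"
    using assms by (simp add: Gamma0_def B_def det_mul det_translation det_adjugate2)
      (simp add: matrix_mult_2 translation_def adjugate2_def algebra_simps)
  show "B ** A = A ** translation w"
    using assms by (simp add: B_def matrix_mul_assoc[symmetric] adjugate2_mult)
qed

section \<open>Products of shifted eta functions\<close>

lemma open_uhp: "open uhp"
  using open_halfspace_Im_gt[of 0] by (simp add: uhp_def)

lemma connected_uhp: "connected uhp"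
  using convex_connected[OF convex_halfspace_Im_gt[of 0]] by (simp add: uhp_def)

lemma ii_in_uhp [simp]: "\<i> \<in> uhp"
  by (simp add: uhp_def)

lemma uhp_add_Reals:
  assumes "\<tau> \<in> uhp" "Im x = 0"
  shows "\<tau> + x \<in> uhp"
  using assms by (simp add: uhp_def)

lemma holomorphic_power_int [holomorphic_intros]:
  assumes "f holomorphic_on A" "\<And>z. z \<in> A \<Longrightarrow> f z \<noteq> 0"
  shows "(\<lambda>z. f z powi n) holomorphic_on A"
  using assms unfolding power_int_def by (cases "n \<ge> 0") (auto intro!: holomorphic_intros)

lemma holomorphic_dedekind_eta: "dedekind_eta holomorphic_on uhp"
  unfolding dedekind_eta_altdef[abs_def] using norm_nome_less_1
  by (intro holomorphic_intros open_uhp) auto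

text \<open>\<open>F / G\<close> is continuous with values among the finitely many
  \<open>n\<close>-th roots of \<open>C\<close>, hence constant on the connected half-plane.
  Identities for twelfth powers descend to the functions themselves in this way.\<close>

lemma holomorphic_eq_const_mult_of_power_eq:
  assumes "n > 0" "F holomorphic_on uhp" "G holomorphic_on uhp"
    and nz: "\<And>\<tau>. \<tau> \<in> uhp \<Longrightarrow> G \<tau> \<noteq> 0" and eq: "\<And>\<tau>. \<tau> \<in> uhp \<Longrightarrow> F \<tau> ^ n = C * G \<tau> ^ n"
  obtains k where "k ^ n = C" "\<And>\<tau>. \<tau> \<in> uhp \<Longrightarrow> F \<tau> = k * G \<tau>"
proof -
  let ?r = "\<lambda>\<tau>. F \<tau> / G \<tau>"
  have r: "?r \<tau> ^ n = C" if "\<tau> \<in> uhp" for \<tau>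
    using eq[OF that] nz[OF that] by (simp add: power_divide)
  have "?r constant_on uhp"
  proof (rule continuous_finite_range_constant[OF connected_uhp])
    show "continuous_on uhp ?r"
      using assms by (intro continuous_on_divide holomorphic_on_imp_continuous_on) auto
    have "?r ` uhp \<subseteq> {z. z ^ n = C}"
      using r by auto
    thus "finite (?r ` uhp)"
      using finite_nth_roots[OF assms(1), of C] by (rule finite_subset)
  qed
  then obtain k where k: "\<And>\<tau>. \<tau> \<in> uhp \<Longrightarrow> ?r \<tau> = k"
    unfolding constant_on_def by blast
  show ?thesis
  proof (rule that)
    show "k ^ n = C"
      using r[of \<i>] k[of \<i>] by simp
    show "F \<tau> = k * G \<tau>" if "\<tau> \<in> uhp" for \<tau>
      using k[OF that] nz[OF that] by (simp add: field_simps)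
  qed
qed

lemma prod_power_int_const:
  fixes c :: "'a :: field"
  assumes "c \<noteq> 0"
  shows "(\<Prod>j\<in>S. c powi e j) = c powi (\<Sum>j\<in>S. e j)"
  using assms by (induction S rule: infinite_finite_induct) (auto simp: power_int_add)

lemma prod_power_int_power:
  fixes x :: "'b \<Rightarrow> 'a :: field"
  shows "(\<Prod>j\<in>S. x j powi e j) ^ n = (\<Prod>j\<in>S. (x j ^ n) powi e j)"
  by (simp add: prod_power_distrib power_int_power power_int_power' mult.commute)

text \<open>The condition \<open>sum_e\<close> expresses weight 0: an automorphy factor common to
  all shifts cancels. Integer exponents avoid any choice of branch.\<close>

locale eta_shift_product =
  fixes N :: nat and S :: "nat set" and e :: "nat \<Rightarrow> int" and K :: complex and f :: "complex \<Rightarrow> complex"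
  assumes N: "N > 0" and S: "finite S" and sum_e: "(\<Sum>j\<in>S. e j) = 0" and K: "K \<noteq> 0"
    and f_eq: "\<And>\<tau>. \<tau> \<in> uhp \<Longrightarrow> f \<tau> = K * (\<Prod>j\<in>S. dedekind_eta (\<tau> + of_nat j / of_nat N) powi e j)"
begin

lemma shift_in_uhp: "\<tau> \<in> uhp \<Longrightarrow> \<tau> + of_nat j / of_nat N \<in> uhp"
  by (rule uhp_add_Reals) (simp_all add: Im_divide)

lemma f_nonzero: "\<tau> \<in> uhp \<Longrightarrow> f \<tau> \<noteq> 0"
  using K S by (simp add: f_eq power_int_eq_0_iff dedekind_eta_nonzero shift_in_uhp)

lemma holomorphic_eta_prod:
  assumes "\<And>j. j \<in> S \<Longrightarrow> \<sigma> j holomorphic_on uhp" "\<And>j \<tau>. j \<in> S \<Longrightarrow> \<tau> \<in> uhp \<Longrightarrow> \<sigma> j \<tau> \<in> uhp"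
  shows "(\<lambda>\<tau>. \<Prod>j\<in>S. dedekind_eta (\<sigma> j \<tau>) powi e j) holomorphic_on uhp"
proof (intro holomorphic_on_prod holomorphic_power_int)
  fix j assume j: "j \<in> S"
  have "(dedekind_eta \<circ> \<sigma> j) holomorphic_on uhp"
    using assms j by (intro holomorphic_on_compose_gen[OF _ holomorphic_dedekind_eta]) auto
  thus "(\<lambda>\<tau>. dedekind_eta (\<sigma> j \<tau>)) holomorphic_on uhp"
    by (simp add: o_def)
  show "dedekind_eta (\<sigma> j \<tau>) \<noteq> 0" if "\<tau> \<in> uhp" for \<tau>
    using assms j that by (intro dedekind_eta_nonzero) auto
qed

lemma holomorphic_f: "f holomorphic_on uhp"
proof -
  have "(\<lambda>\<tau>. K * (\<Prod>j\<in>S. dedekind_eta (\<tau> + of_nat j / of_nat N) powi e j)) holomorphic_on uhp"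
    by (intro holomorphic_intros holomorphic_eta_prod) (auto intro!: holomorphic_intros shift_in_uhp N)
  thus ?thesis
    by (rule holomorphic_transform) (simp add: f_eq)
qed

text \<open>In the twelfth power of the product the common factor \<open>J \<tau>\<close> occurs
  with total exponent 0, so only the constants \<open>s j\<close> survive; the twelfth root is
  extracted by \<open>holomorphic_eq_const_mult_of_power_eq\<close>.\<close>

lemma f_moebius:
  assumes A: "det A = 1"
    and eq: "\<And>j \<tau>. j \<in> S \<Longrightarrow> \<tau> \<in> uhp \<Longrightarrow>
       dedekind_eta (moebius A \<tau> + of_nat j / of_nat N) ^ 12 = s j * J \<tau> * dedekind_eta (\<sigma> j \<tau>) ^ 12"
    and J: "\<And>\<tau>. \<tau> \<in> uhp \<Longrightarrow> J \<tau> \<noteq> 0"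
    and \<sigma>: "\<And>j. j \<in> S \<Longrightarrow> \<sigma> j holomorphic_on uhp" "\<And>j \<tau>. j \<in> S \<Longrightarrow> \<tau> \<in> uhp \<Longrightarrow> \<sigma> j \<tau> \<in> uhp"
  obtains k where "k ^ 12 = K ^ 12 * (\<Prod>j\<in>S. s j powi e j)"
    "\<And>\<tau>. \<tau> \<in> uhp \<Longrightarrow> f (moebius A \<tau>) = k * (\<Prod>j\<in>S. dedekind_eta (\<sigma> j \<tau>) powi e j)"
proof (rule holomorphic_eq_const_mult_of_power_eq)
  show "(\<lambda>\<tau>. f (moebius A \<tau>)) holomorphic_on uhp"
    using holomorphic_on_compose_gen[OF holomorphic_moebius[OF A] holomorphic_f] moebius_uhp[OF A]
    by (auto simp: o_def)
  show "(\<lambda>\<tau>. \<Prod>j\<in>S. dedekind_eta (\<sigma> j \<tau>) powi e j) holomorphic_on uhp"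
    using \<sigma> by (rule holomorphic_eta_prod)
  show "(\<Prod>j\<in>S. dedekind_eta (\<sigma> j \<tau>) powi e j) \<noteq> 0" if "\<tau> \<in> uhp" for \<tau>
    using that \<sigma> S by (auto simp: power_int_eq_0_iff dedekind_eta_nonzero)
  show "f (moebius A \<tau>) ^ 12 = (K ^ 12 * (\<Prod>j\<in>S. s j powi e j)) * (\<Prod>j\<in>S. dedekind_eta (\<sigma> j \<tau>) powi e j) ^ 12"
    if "\<tau> \<in> uhp" for \<tau>
  proof -
    have "f (moebius A \<tau>) ^ 12 = K ^ 12 * (\<Prod>j\<in>S. (s j * J \<tau> * dedekind_eta (\<sigma> j \<tau>) ^ 12) powi e j)"
      using that A by (simp add: f_eq moebius_uhp power_mult_distrib prod_power_int_power eq)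
    also have "\<dots> = K ^ 12 * ((\<Prod>j\<in>S. s j powi e j) * (\<Prod>j\<in>S. J \<tau> powi e j) * (\<Prod>j\<in>S. dedekind_eta (\<sigma> j \<tau>) powi e j) ^ 12)"
      by (simp add: prod_power_int_power power_int_mult_distrib prod.distrib)
    also have "(\<Prod>j\<in>S. J \<tau> powi e j) = 1"
      using J[OF that] by (simp add: prod_power_int_const sum_e)
    finally show ?thesis by simp
  qed
qed auto

lemma cuspidal_divisor_f: "cuspidal_divisor f"
  unfolding cuspidal_divisor_def
proof (intro ballI conjI)
  fix \<tau> assume \<tau>: "\<tau> \<in> uhp"
  show "f \<tau> \<noteq> 0"
    using \<tau> by (rule f_nonzero)
  have "f analytic_on {\<tau>}"
    using holomorphic_f open_uhp \<tau> by (meson analytic_at)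
  thus "\<not> is_pole f \<tau>"
    using analytic_at_imp_no_pole by blast
qed

text \<open>At the cusp every shifted eta function turns into eta at some
  \<open>(\<alpha> * \<tau> + \<beta>) / \<delta>\<close>. The fractional nome powers of these add
  up to \<open>\<kappa>\<close>, and the remaining products are holomorphic near 0 in the local
  parameter.\<close>

lemma meromorphic_at_cusp:
  assumes A: "det A = 1" and BA: "B ** A = A ** translation (N ^ 2)" and B: "det B = 1"
    and \<nu>: "\<And>\<tau>. \<tau> \<in> uhp \<Longrightarrow> f (moebius B \<tau>) = \<nu> * f \<tau>"
  shows "\<exists>\<kappa> g. exp (2 * of_real pi * \<i> * \<kappa>) = \<nu> \<and> g meromorphic_on {0} \<and>
        (\<forall>\<tau>\<in>uhp. f (moebius A \<tau>) =
           exp (2 * of_real pi * \<i> * \<kappa> * \<tau> / of_nat (N ^ 2)) * g (nome (\<tau> / of_nat (N ^ 2))))"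
proof -
  define w where "w = N ^ 2"
  have w: "w > 0" using N by (simp add: w_def)
  have "\<forall>j. \<exists>\<alpha> \<delta> :: nat. \<exists>\<beta> :: int. \<exists>s. \<alpha> > 0 \<and> \<delta> > 0 \<and> \<alpha> * \<delta> = w \<and> s \<noteq> 0 \<and> 
      (\<forall>\<tau>\<in>uhp. dedekind_eta (moebius A \<tau> + of_nat j / of_nat N) ^ 12 =
       s * (of_int (A $ 2 $ 1) * \<tau> + of_int (A $ 2 $ 2)) ^ 6 * dedekind_eta ((of_nat \<alpha> * \<tau> + of_int \<beta>) / of_nat \<delta>) ^ 12)"
  proof
    fix j :: nat
    have "A $ 1 $ 1 * A $ 2 $ 2 - A $ 1 $ 2 * A $ 2 $ 1 = 1"
      using A by (simp add: det_2)
    from dedekind_eta_power_12_shift_cusp[OF this N, of "int j"] show "\<exists>\<alpha> \<delta> :: nat. \<exists>\<beta> :: int. \<exists>s. \<alpha> > 0 \<and> \<delta> > 0 \<and> \<alpha> * \<delta> = w \<and> s \<noteq> 0 \<and> 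
      (\<forall>\<tau>\<in>uhp. dedekind_eta (moebius A \<tau> + of_nat j / of_nat N) ^ 12 =
       s * (of_int (A $ 2 $ 1) * \<tau> + of_int (A $ 2 $ 2)) ^ 6 * dedekind_eta ((of_nat \<alpha> * \<tau> + of_int \<beta>) / of_nat \<delta>) ^ 12)"
      unfolding moebius_def w_def by (metis of_int_of_nat_eq)
  qed
  then obtain \<alpha> \<delta> :: "nat \<Rightarrow> nat" and \<beta> :: "nat \<Rightarrow> int" and s where
    \<alpha>: "\<And>j. \<alpha> j > 0" and \<delta>: "\<And>j. \<delta> j > 0" and \<alpha>\<delta>: "\<And>j. \<alpha> j * \<delta> j = w" and
    eq: "\<And>j \<tau>. \<tau> \<in> uhp \<Longrightarrow> dedekind_eta (moebius A \<tau> + of_nat j / of_nat N) ^ 12 =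
       s j * (of_int (A $ 2 $ 1) * \<tau> + of_int (A $ 2 $ 2)) ^ 6 * dedekind_eta ((of_nat (\<alpha> j) * \<tau> + of_int (\<beta> j)) / of_nat (\<delta> j)) ^ 12"
    by metis
  define \<sigma> where "\<sigma> = (\<lambda>j \<tau>. (of_nat (\<alpha> j) * \<tau> + of_int (\<beta> j)) / (of_nat (\<delta> j) :: complex))"
  have \<sigma>_uhp: "\<sigma> j \<tau> \<in> uhp" if "\<tau> \<in> uhp" for j \<tau>
  proof -
    have "Im (\<sigma> j \<tau>) = of_nat (\<alpha> j) * Im \<tau> / of_nat (\<delta> j)"
      using \<delta>[of j] by (simp add: \<sigma>_def Im_divide power2_eq_square)
    thus ?thesis using that \<alpha>[of j] \<delta>[of j] by (simp add: uhp_def)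
  qed
  obtain k where k: "\<And>\<tau>. \<tau> \<in> uhp \<Longrightarrow> f (moebius A \<tau>) = k * (\<Prod>j\<in>S. dedekind_eta (\<sigma> j \<tau>) powi e j)"
  proof (rule f_moebius[OF A])
    show "\<sigma> j holomorphic_on uhp" for j
      unfolding \<sigma>_def using \<delta>[of j] by (intro holomorphic_intros) auto
  qed (use eq moebius_denom_nonzero[OF A] \<sigma>_uhp in \<open>auto simp: \<sigma>_def\<close>)
  \<comment> \<open>Since \<open>\<alpha> \<delta> = w\<close>, the nome of \<open>(\<alpha> \<tau> + \<beta>) / \<delta>\<close> is a root of unity times the power
    \<open>\<alpha>\<^sup>2\<close> of the local parameter \<open>nome (\<tau> / w)\<close>.\<close>
  define \<kappa> :: complex where "\<kappa> = (\<Sum>j\<in>S. of_int (e j) * of_nat (\<alpha> j) ^ 2 / 24)"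
  define \<zeta> where "\<zeta> = (\<lambda>j. nome (of_int (\<beta> j) / of_nat (\<delta> j)))"
  define P where "P = (\<lambda>j x. qpoch (\<zeta> j * x ^ (\<alpha> j) ^ 2) (\<zeta> j * x ^ (\<alpha> j) ^ 2))"
  define g where "g = (\<lambda>x. k * (\<Prod>j\<in>S. nome (of_int (\<beta> j) / of_nat (\<delta> j) / 24) powi e j) * (\<Prod>j\<in>S. P j x powi e j))"
  have "P j meromorphic_on {0}" for j
  proof -
    have "P j holomorphic_on ball 0 1"
      unfolding P_def
    proof (intro holomorphic_intros)
      fix z :: complex assume "z \<in> ball 0 1"
      hence "norm z ^ (\<alpha> j) ^ 2 < 1"
        using \<alpha>[of j] by (subst power_less_one_iff) auto
      moreover have "norm (\<zeta> j) = 1"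
        by (simp add: \<zeta>_def norm_nome Im_divide)
      ultimately show "norm (\<zeta> j * z ^ (\<alpha> j) ^ 2) < 1"
        by (simp add: norm_mult norm_power)
    qed auto
    hence "P j analytic_on {0}"
      by (rule holomorphic_on_imp_analytic_at) auto
    thus ?thesis
      by (rule analytic_on_imp_meromorphic_on)
  qed
  hence g: "g meromorphic_on {0}"
    unfolding g_def by (intro meromorphic_intros)
  have F: "f (moebius A \<tau>) = nome (\<kappa> * \<tau> / of_nat w) * g (nome (\<tau> / of_nat w))" if \<tau>: "\<tau> \<in> uhp" for \<tau>
  proof -
    have "dedekind_eta (\<sigma> j \<tau>) powi e j =
       nome (of_int (\<beta> j) / of_nat (\<delta> j) / 24) powi e j * nome (\<tau> / of_nat w * (of_int (e j) * of_nat (\<alpha> j) ^ 2 / 24)) *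
       P j (nome (\<tau> / of_nat w)) powi e j" for j
    proof -
      have \<sigma>: "\<sigma> j \<tau> = of_int (\<beta> j) / of_nat (\<delta> j) + of_nat (\<alpha> j ^ 2) * (\<tau> / of_nat w)"
        using \<alpha>[of j] \<delta>[of j] by (simp add: \<sigma>_def \<alpha>\<delta>[of j, symmetric] field_simps power2_eq_square)
      hence "\<sigma> j \<tau> / 24 = of_int (\<beta> j) / of_nat (\<delta> j) / 24 + \<tau> / of_nat w * (of_nat (\<alpha> j) ^ 2 / 24)"
        by (simp add: add_divide_distrib)
      moreover have "nome (\<sigma> j \<tau>) = \<zeta> j * nome (\<tau> / of_nat w) ^ (\<alpha> j) ^ 2"
        unfolding \<sigma> nome_add nome_mult_of_nat \<zeta>_def ..
      moreover have "nome (\<tau> / of_nat w * (of_nat (\<alpha> j) ^ 2 / 24)) powi e j = nome (\<tau> / of_nat w * (of_int (e j) * of_nat (\<alpha> j) ^ 2 / 24))"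
        by (simp add: nome_def exp_power_int mult_ac)
      ultimately show ?thesis
        by (simp only: dedekind_eta_altdef nome_add power_int_mult_distrib P_def)
    qed
    hence "f (moebius A \<tau>) = k * (\<Prod>j\<in>S. nome (of_int (\<beta> j) / of_nat (\<delta> j) / 24) powi e j) *
       (\<Prod>j\<in>S. nome (\<tau> / of_nat w * (of_int (e j) * of_nat (\<alpha> j) ^ 2 / 24))) * (\<Prod>j\<in>S. P j (nome (\<tau> / of_nat w)) powi e j)"
      by (simp add: k[OF \<tau>] prod.distrib)
    also have "(\<Prod>j\<in>S. nome (\<tau> / of_nat w * (of_int (e j) * of_nat (\<alpha> j) ^ 2 / 24))) = nome (\<kappa> * \<tau> / of_nat w)"
      using S unfolding nome_def \<kappa>_def
      by (subst exp_sum[symmetric]) (auto simp: sum_distrib_left sum_distrib_right sum_divide_distrib mult_ac)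
    finally show ?thesis
      by (simp add: g_def mult_ac)
  qed
  \<comment> \<open>\<open>\<kappa>\<close> was read off from the expansion. To see that it belongs
    to \<open>\<nu>\<close>, the value of \<open>f\<close> at
    \<open>moebius A (\<i> + of_nat w)\<close> is computed both through \<open>B\<close> and through
    the expansion.\<close>
  have "nome \<kappa> = \<nu>"
  proof -
    have Ai: "moebius A \<i> \<in> uhp"
      using moebius_uhp[OF A] by simp
    have iw: "\<i> + of_nat w \<in> uhp"
      by (simp add: uhp_def)
    have "moebius A (\<i> + of_nat w) = moebius (A ** translation w) \<i>"
      by (simp add: moebius_mult[OF A det_translation] moebius_translation)
    also have "\<dots> = moebius B (moebius A \<i>)"
      by (simp add: moebius_mult[OF B A] w_def flip: BA)
    finally have "f (moebius A (\<i> + of_nat w)) = \<nu> * f (moebius A \<i>)"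
      using \<nu>[OF Ai] by simp
    moreover have "f (moebius A (\<i> + of_nat w)) = nome \<kappa> * f (moebius A \<i>)"
      using w by (simp add: F iw add_divide_distrib nome_add distrib_left)
    ultimately show ?thesis
      using f_nonzero[OF Ai] by simp
  qed
  thus ?thesis
    using g F unfolding nome_def[of \<kappa>] nome_def[of "\<kappa> * _ / _"] w_def by (intro exI[of _ \<kappa>] exI[of _ g]) (simp add: mult.assoc)
qed

text \<open>A permutation of the shifts preserving \<open>e\<close>, with a common factor
  \<open>J\<close>, leaves the twelfth power of \<open>f\<close> invariant; so \<open>f\<close> is
  multiplied by a twelfth root of unity.\<close>

theorem gmf_if_shifts_permuted:
  assumes inv: "\<And>A. A \<in> Gamma0 (N ^ 2) \<Longrightarrow> \<exists>p J. bij_betw p S S \<and> (\<forall>j\<in>S. e (p j) = e j) \<and>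
     (\<forall>\<tau>\<in>uhp. J \<tau> \<noteq> 0 \<and> (\<forall>j\<in>S. dedekind_eta (moebius A \<tau> + of_nat j / of_nat N) ^ 12 =
        J \<tau> * dedekind_eta (\<tau> + of_nat (p j) / of_nat N) ^ 12))"
  shows "gmf_with_twelfth_root_char (Gamma0 (N ^ 2)) f"
proof -
  let ?\<Gamma> = "Gamma0 (N ^ 2)"
  have det: "det A = 1" if "A \<in> ?\<Gamma>" for A
    using that by (simp add: Gamma0_def)
  have ex: "\<exists>\<nu>. \<nu> ^ 12 = 1 \<and> (\<forall>\<tau>\<in>uhp. f (moebius A \<tau>) = \<nu> * f \<tau>)" if A: "A \<in> ?\<Gamma>" for A
  proof -
    from inv[OF A] obtain p J where p: "bij_betw p S S" "\<And>j. j \<in> S \<Longrightarrow> e (p j) = e j" and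
      J: "\<And>\<tau>. \<tau> \<in> uhp \<Longrightarrow> J \<tau> \<noteq> 0" and
      eq: "\<And>\<tau> j. \<tau> \<in> uhp \<Longrightarrow> j \<in> S \<Longrightarrow> dedekind_eta (moebius A \<tau> + of_nat j / of_nat N) ^ 12 =
        J \<tau> * dedekind_eta (\<tau> + of_nat (p j) / of_nat N) ^ 12"
      by blast
    obtain k where k: "k ^ 12 = K ^ 12 * (\<Prod>j\<in>S. 1 powi e j)"
      "\<And>\<tau>. \<tau> \<in> uhp \<Longrightarrow> f (moebius A \<tau>) = k * (\<Prod>j\<in>S. dedekind_eta (\<tau> + of_nat (p j) / of_nat N) powi e j)"
    proof (rule f_moebius[OF det[OF A], where s = "\<lambda>_. 1" and J = J and \<sigma> = "\<lambda>j \<tau>. \<tau> + of_nat (p j) / of_nat N"])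
      show "(\<lambda>\<tau>. \<tau> + of_nat (p j) / of_nat N) holomorphic_on uhp" for j
        using N by (intro holomorphic_intros) auto
    qed (use eq J shift_in_uhp in auto)
    have "f (moebius A \<tau>) = k / K * f \<tau>" if "\<tau> \<in> uhp" for \<tau>
    proof -
      have "(\<Prod>j\<in>S. dedekind_eta (\<tau> + of_nat (p j) / of_nat N) powi e j) =
         (\<Prod>j\<in>S. dedekind_eta (\<tau> + of_nat (p j) / of_nat N) powi e (p j))"
        by (simp add: p(2))
      also have "\<dots> = (\<Prod>j\<in>S. dedekind_eta (\<tau> + of_nat j / of_nat N) powi e j)"
        by (rule prod.reindex_bij_betw[OF p(1)])
      finally show ?thesis
        using K that by (simp add: k(2) f_eq)
    qed
    moreover have "(k / K) ^ 12 = 1"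
      using k(1) K by (simp add: power_divide)
    ultimately show ?thesis by blast
  qed
  \<comment> \<open>Evaluation at the base point \<open>\<i>\<close> recovers the multiplier because
    \<open>f\<close> has no zeros; this also yields multiplicativity.\<close>
  define \<nu> where "\<nu> = (\<lambda>A. f (moebius A \<i>) / f \<i>)"
  have \<nu>: "\<nu> A ^ 12 = 1" "\<And>\<tau>. \<tau> \<in> uhp \<Longrightarrow> f (moebius A \<tau>) = \<nu> A * f \<tau>" if A: "A \<in> ?\<Gamma>" for A
  proof -
    obtain \<mu> where \<mu>: "\<mu> ^ 12 = 1" "\<And>\<tau>. \<tau> \<in> uhp \<Longrightarrow> f (moebius A \<tau>) = \<mu> * f \<tau>"
      using ex[OF A] by blast
    hence "\<nu> A = \<mu>"
      using f_nonzero[of \<i>] by (simp add: \<nu>_def)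
    thus "\<nu> A ^ 12 = 1" "\<And>\<tau>. \<tau> \<in> uhp \<Longrightarrow> f (moebius A \<tau>) = \<nu> A * f \<tau>"
      using \<mu> by auto
  qed
  have "group_char ?\<Gamma> \<nu>"
    unfolding group_char_def
  proof (intro conjI ballI)
    fix A B assume AB: "A \<in> ?\<Gamma>" "B \<in> ?\<Gamma>"
    show "\<nu> A \<noteq> 0"
      using \<nu>(1)[OF AB(1)] by auto
    have "\<nu> (A ** B) * f \<i> = f (moebius A (moebius B \<i>))"
      using f_nonzero[of \<i>] by (simp add: \<nu>_def moebius_mult[OF det[OF AB(1)] det[OF AB(2)]])
    also have "\<dots> = \<nu> A * \<nu> B * f \<i>"
      using AB by (simp add: \<nu>(2) moebius_uhp det)
    finally show "\<nu> (A ** B) = \<nu> A * \<nu> B"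
      using f_nonzero[of \<i>] by simp
  qed
  moreover have "meromorphic_at_cusps ?\<Gamma> \<nu> f"
    unfolding meromorphic_at_cusps_def
  proof
    fix A assume "A \<in> carrier SL2Z"
    hence A: "det A = 1" by (simp add: SL2Z_def)
    obtain B where B: "B \<in> ?\<Gamma>" "B ** A = A ** translation (N ^ 2)"
      using Gamma0_conj_translation[OF A] by blast
    show "\<exists>w>0. \<exists>B\<in>?\<Gamma>. \<exists>\<kappa> g. B ** A = A ** translation w \<and> exp (2 * of_real pi * \<i> * \<kappa>) = \<nu> B \<and>
        g meromorphic_on {0} \<and> (\<forall>\<tau>\<in>uhp. f (moebius A \<tau>) =
           exp (2 * of_real pi * \<i> * \<kappa> * \<tau> / of_nat w) * g (nome (\<tau> / of_nat w)))"
      using meromorphic_at_cusp[OF A B(2) det[OF B(1)] \<nu>(2)[OF B(1)]] B N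
      by (intro exI[of _ "N ^ 2"] conjI bexI[of _ B]) auto
  qed
  ultimately have "generalized_modular_function ?\<Gamma> \<nu> f"
    unfolding generalized_modular_function_def
    using \<nu>(2) N holomorphic_f by (auto intro: subgroup_Gamma0 finite_rcosets_Gamma0)
  moreover have "norm (\<nu> A) = 1" if "A \<in> ?\<Gamma>" for A
    using \<nu>(1)[OF that] by (metis norm_ge_zero norm_one norm_power power_eq_1_iff zero_neq_numeral)
  ultimately show ?thesis
    unfolding gmf_with_twelfth_root_char_def using \<nu>(1) by blast
qed

end

section \<open>Quadratic characters modulo 3, 4 and 5\<close>

text \<open>The factors are eta functions at shifted points, stripped of their fractional nome
  powers.\<close>

definition qshift_prod :: "nat \<Rightarrow> nat set \<Rightarrow> (nat \<Rightarrow> int) \<Rightarrow> complex \<Rightarrow> complex" where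
  "qshift_prod N S e \<tau> =
     (\<Prod>j\<in>S. qpoch (nome (\<tau> + of_nat j / of_nat N)) (nome (\<tau> + of_nat j / of_nat N)) powi e j)"

text \<open>As the exponents add up to 0, the factors \<open>nome (\<tau> / 24)\<close> cancel, and
  the contributions of \<open>j / N\<close> form the constant.\<close>

lemma eta_shift_product_qshift_prod:
  assumes "N > 0" "finite S" "(\<Sum>j\<in>S. e j) = 0" "\<And>\<tau>. \<tau> \<in> uhp \<Longrightarrow> f \<tau> = qshift_prod N S e \<tau>"
  shows "eta_shift_product N S e (inverse (\<Prod>j\<in>S. nome (of_nat j / of_nat N / 24) powi e j)) f"
proof
  fix \<tau> assume \<tau>: "\<tau> \<in> uhp"
  have "(\<Prod>j\<in>S. dedekind_eta (\<tau> + of_nat j / of_nat N) powi e j) =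
     (\<Prod>j\<in>S. nome (\<tau> / 24) powi e j) * (\<Prod>j\<in>S. nome (of_nat j / of_nat N / 24) powi e j) * f \<tau>"
    by (simp add: dedekind_eta_altdef assms(4)[OF \<tau>] qshift_prod_def add_divide_distrib nome_add
          power_int_mult_distrib prod.distrib nome_add[of \<tau>])
  also have "(\<Prod>j\<in>S. nome (\<tau> / 24) powi e j) = 1"
    by (simp add: prod_power_int_const assms(3))
  finally show "f \<tau> = inverse (\<Prod>j\<in>S. nome (of_nat j / of_nat N / 24) powi e j) *
      (\<Prod>j\<in>S. dedekind_eta (\<tau> + of_nat j / of_nat N) powi e j)"
    using assms(2) by simp
qed (use assms in auto)

lemma has_prod_power_int:
  fixes f :: "nat \<Rightarrow> complex"
  assumes "f has_prod a"
  shows "(\<lambda>n. f n powi k) has_prod (a powi k)"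
  using assms unfolding power_int_def by (auto intro!: has_prod_power has_prod_inverse)

lemma has_prod_qshift_prod:
  assumes "\<tau> \<in> uhp"
  shows "(\<lambda>n. \<Prod>j\<in>S. (1 - nome (of_nat j / of_nat N) ^ (n + 1) * nome \<tau> ^ (n + 1)) powi e j)
     has_prod qshift_prod N S e \<tau>"
proof -
  have "(\<lambda>n. \<Prod>j\<in>S. (1 - nome (\<tau> + of_nat j / of_nat N) * nome (\<tau> + of_nat j / of_nat N) ^ n) powi e j)
     has_prod qshift_prod N S e \<tau>"
    unfolding qshift_prod_def using assms
    by (intro has_prod_prod has_prod_power_int qpoch_has_prod norm_nome_less_1 uhp_add_Reals) (simp_all add: Im_divide)
  thus ?thesis
    by (simp add: nome_add power_mult_distrib mult_ac)
qed

text \<open>The products are compared factor by factor; \<open>G n\<close> is the common value of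
  the factors with index \<open>n\<close>, later taken in the explicit form of the theorem.\<close>

lemma eta_char_eq_qshift_prod:
  assumes "\<tau> \<in> uhp"
    and "\<And>n. n > 0 \<Longrightarrow> (\<Prod>a = 1..conductor X. (1 - nome (of_nat a / of_nat (conductor X)) * nome \<tau> ^ n)
          powr cnj (X (int (a * n)))) = G n"
    and "\<And>n. n > 0 \<Longrightarrow> (\<Prod>j\<in>S. (1 - nome (of_nat j / of_nat N) ^ n * nome \<tau> ^ n) powi e j) = G n"
  shows "eta_char X \<tau> = qshift_prod N S e \<tau>" "(\<lambda>n. G (n + 1)) has_prod eta_char X \<tau>"
proof -
  have *: "exp (2 * of_real pi * \<i> * of_nat a / of_nat (conductor X)) = nome (of_nat a / of_nat (conductor X))" for a
    by (simp add: nome_def)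
  have "(\<lambda>n. \<Prod>j\<in>S. (1 - nome (of_nat j / of_nat N) ^ (n + 1) * nome \<tau> ^ (n + 1)) powi e j) = (\<lambda>n. G (n + 1))"
    by (intro ext assms(3)) simp
  hence "(\<lambda>n. G (n + 1)) has_prod qshift_prod N S e \<tau>"
    using has_prod_qshift_prod[OF assms(1), where S = S and N = N and e = e] by simp
  moreover have "eta_char X \<tau> = (\<Prod>n. G (n + 1))"
    unfolding eta_char_def * by (intro prodinf_cong assms(2)) simp
  ultimately show "eta_char X \<tau> = qshift_prod N S e \<tau>" "(\<lambda>n. G (n + 1)) has_prod eta_char X \<tau>"
    by (auto simp: has_prod_iff)
qed

lemma nome_root_power:
  assumes "N > 0"
  shows "nome (of_nat j / of_nat N) ^ n = nome (of_nat ((n mod N * j) mod N) / of_nat N)"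
proof -
  have "n * j = (n * j) div N * N + (n mod N * j) mod N"
    by (simp add: mod_mult_left_eq)
  hence "of_nat (n * j) = of_nat ((n * j) div N) * of_nat N + (of_nat ((n mod N * j) mod N) :: complex)"
    by (simp only: of_nat_add[symmetric] of_nat_mult[symmetric])
  hence "of_nat n * (of_nat j / of_nat N) = of_nat ((n * j) div N) + (of_nat ((n mod N * j) mod N) / of_nat N :: complex)"
    using assms by (simp add: field_simps)
  thus ?thesis
    by (simp only: nome_power nome_add nome_of_nat mult_1)
qed

lemma one_minus_root_nonzero:
  assumes "norm x < 1" "Im r = 0"
  shows "1 - nome r * x \<noteq> 0"
proof
  assume "1 - nome r * x = 0"
  hence "norm (nome r * x) = 1" by simp
  thus False using assms by (simp add: norm_mult norm_nome)
qed

section \<open>The three characters and their conductors\<close>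

lemma conductor_eqI:
  assumes "dirichlet_char N X"
    and "\<And>u X'. u < N \<Longrightarrow> dirichlet_char u X' \<Longrightarrow> (\<And>a. X a \<noteq> 0 \<Longrightarrow> X' a = X a) \<Longrightarrow> False"
  shows "conductor X = N"
  unfolding conductor_def
proof (rule Least_equality)
  show "\<exists>X'. dirichlet_char N X' \<and> (\<forall>a. X a \<noteq> 0 \<longrightarrow> X' a = X a)"
    using assms(1) by blast
  show "N \<le> u" if "\<exists>X'. dirichlet_char u X' \<and> (\<forall>a. X a \<noteq> 0 \<longrightarrow> X' a = X a)" for u
    using assms(2)[of u] that by (metis not_le)
qed

lemma legendre_char_3:
  "legendre_char 3 a = (if a mod 3 = 0 then 0 else if a mod 3 = 1 then 1 else -1)"
proof -
  have "QuadRes 3 a \<longleftrightarrow> a mod 3 = 1" if "a mod 3 \<noteq> 0"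
  proof
    assume "QuadRes 3 a"
    then obtain y where "y ^ 2 mod 3 = a mod 3"
      by (auto simp: QuadRes_def cong_def)
    hence "(y mod 3) * (y mod 3) mod 3 = a mod 3"
      by (simp add: power2_eq_square mod_mult_eq)
    moreover have "y mod 3 = 0 \<or> y mod 3 = 1 \<or> y mod 3 = 2" by presburger
    ultimately show "a mod 3 = 1"
      using that by auto
  next
    assume "a mod 3 = 1"
    thus "QuadRes 3 a"
      unfolding QuadRes_def cong_def by (intro exI[of _ 1]) simp
  qed
  thus ?thesis
    by (auto simp: legendre_char_def Legendre_def cong_def)
qed

lemma legendre_char_5:
  "legendre_char 5 a = (if a mod 5 = 0 then 0 else if a mod 5 = 1 \<or> a mod 5 = 4 then 1 else -1)"
proof -
  have "QuadRes 5 a \<longleftrightarrow> a mod 5 = 1 \<or> a mod 5 = 4" if "a mod 5 \<noteq> 0"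
  proof
    assume "QuadRes 5 a"
    then obtain y where "y ^ 2 mod 5 = a mod 5"
      by (auto simp: QuadRes_def cong_def)
    hence "(y mod 5) * (y mod 5) mod 5 = a mod 5"
      by (simp add: power2_eq_square mod_mult_eq)
    moreover have "y mod 5 = 0 \<or> y mod 5 = 1 \<or> y mod 5 = 2 \<or> y mod 5 = 3 \<or> y mod 5 = 4" by presburger
    ultimately show "a mod 5 = 1 \<or> a mod 5 = 4"
      using that by auto
  next
    assume "a mod 5 = 1 \<or> a mod 5 = 4"
    thus "QuadRes 5 a"
      unfolding QuadRes_def cong_def by (auto intro: exI[of _ 1] exI[of _ 2])
  qed
  thus ?thesis
    by (auto simp: legendre_char_def Legendre_def cong_def)
qed

lemma coprime_prime_iff_mod:
  assumes "prime (p :: int)"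
  shows "coprime a p \<longleftrightarrow> a mod p \<noteq> 0"
proof -
  have "coprime a p \<longleftrightarrow> \<not> p dvd a"
    using assms prime_imp_coprime[of p a] coprime_common_divisor[of a p p] not_prime_unit[of p]
    by (auto simp: coprime_commute)
  thus ?thesis
    by (simp add: dvd_eq_mod_eq_0)
qed

lemma dirichlet_char_legendre_3: "dirichlet_char 3 (legendre_char 3)"
  unfolding dirichlet_char_def
proof (intro conjI allI)
  fix a b :: int
  have "a mod 3 = 0 \<or> a mod 3 = 1 \<or> a mod 3 = 2" "b mod 3 = 0 \<or> b mod 3 = 1 \<or> b mod 3 = 2" by presburger+
  moreover have "(a * b) mod 3 = ((a mod 3) * (b mod 3)) mod 3"
    by (simp add: mod_mult_eq)
  ultimately show "legendre_char 3 (a * b) = legendre_char 3 a * legendre_char 3 b"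
    unfolding legendre_char_3 by (elim disjE) simp_all
next
  fix a :: int
  show "legendre_char 3 a \<noteq> 0 \<longleftrightarrow> coprime a (int 3)"
    using coprime_prime_iff_mod[of 3 a] by (simp add: legendre_char_3)
qed (simp_all add: legendre_char_3)

lemma dirichlet_char_legendre_5: "dirichlet_char 5 (legendre_char 5)"
  unfolding dirichlet_char_def
proof (intro conjI allI)
  fix a b :: int
  have "a mod 5 = 0 \<or> a mod 5 = 1 \<or> a mod 5 = 2 \<or> a mod 5 = 3 \<or> a mod 5 = 4"
    "b mod 5 = 0 \<or> b mod 5 = 1 \<or> b mod 5 = 2 \<or> b mod 5 = 3 \<or> b mod 5 = 4" by presburger+
  moreover have "(a * b) mod 5 = ((a mod 5) * (b mod 5)) mod 5"
    by (simp add: mod_mult_eq)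
  ultimately show "legendre_char 5 (a * b) = legendre_char 5 a * legendre_char 5 b"
    unfolding legendre_char_5 by (elim disjE) simp_all
next
  fix a :: int
  show "legendre_char 5 a \<noteq> 0 \<longleftrightarrow> coprime a (int 5)"
    using coprime_prime_iff_mod[of 5 a] by (simp add: legendre_char_5)
qed (simp_all add: legendre_char_5)

lemma conductor_legendre_3: "conductor (legendre_char 3) = 3"
proof (rule conductor_eqI[OF dirichlet_char_legendre_3])
  fix u X' assume u: "u < 3" "dirichlet_char u X'" and eq: "\<And>a. legendre_char 3 a \<noteq> 0 \<Longrightarrow> X' a = legendre_char 3 a"
  have X: "X' 1 = 1" "X' 2 = -1"
    using eq[of 1] eq[of 2] by (simp_all add: legendre_char_3)
  have per: "X' (a + int u) = X' a" and nz: "X' a \<noteq> 0 \<longleftrightarrow> coprime a (int u)" for a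
    using u(2) by (auto simp: dirichlet_char_def)
  have "u > 0" using u by (simp add: dirichlet_char_def)
  with u consider "u = 1" | "u = 2" by linarith
  thus False
  proof cases
    case 1
    thus False using X per[of 1] by simp
  next
    case 2
    thus False using X nz[of 2] by auto
  qed
qed

text \<open>Modulus 1 would make the values at 1 and 2 equal; moduli 2 and 4 would force a zero at
  2, and modulus 3 a zero at 3.\<close>

lemma conductor_legendre_5: "conductor (legendre_char 5) = 5"
proof (rule conductor_eqI[OF dirichlet_char_legendre_5])
  fix u X' assume u: "u < 5" "dirichlet_char u X'" and eq: "\<And>a. legendre_char 5 a \<noteq> 0 \<Longrightarrow> X' a = legendre_char 5 a"
  have X: "X' 1 = 1" "X' 2 = -1" "X' 3 = -1"
    using eq[of 1] eq[of 2] eq[of 3] by (simp_all add: legendre_char_5)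
  have per: "X' (a + int u) = X' a" and nz: "X' a \<noteq> 0 \<longleftrightarrow> coprime a (int u)" for a
    using u(2) by (auto simp: dirichlet_char_def)
  have "u > 0" using u by (simp add: dirichlet_char_def)
  with u consider "u = 1" | "u = 2 \<or> u = 4" | "u = 3" by linarith
  thus False
  proof cases
    case 1
    thus False using X per[of 1] by simp
  next
    case 2
    thus False using X nz[of 2] by auto
  next
    case 3
    thus False using X nz[of 3] by auto
  qed
qed

text \<open>\<open>\<psi> 3\<close> is a square root of \<open>\<psi> 9 = \<psi> 1 = 1\<close>, and
  the value 1 would make \<open>\<psi>\<close> principal.\<close>

lemma dirichlet_char_4_nonprincipal:
  assumes "dirichlet_char 4 \<psi>" "\<psi> \<noteq> principal_char 4"
  shows "\<psi> a = (if a mod 4 = 1 then 1 else if a mod 4 = 3 then -1 else 0)"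
proof -
  have mult: "\<psi> (a * b) = \<psi> a * \<psi> b" and per: "\<psi> (a + 4) = \<psi> a" and nz: "\<psi> a \<noteq> 0 \<longleftrightarrow> coprime a 4" for a b
    using assms(1) by (auto simp: dirichlet_char_def)
  have per': "\<psi> (a + 4 * k) = \<psi> a" for a k
  proof (induction k rule: int_induct[where k = 0])
    case (step1 i)
    thus ?case using per[of "a + 4 * i"] by (simp add: algebra_simps)
  next
    case (step2 i)
    thus ?case using per[of "a + 4 * (i - 1)"] by (simp add: algebra_simps)
  qed simp
  have mod: "\<psi> a = \<psi> (a mod 4)" for a
    using per'[of "a mod 4" "a div 4"] by simp
  have 4: "coprime a 4 \<longleftrightarrow> a mod 4 = 1 \<or> a mod 4 = 3" for a :: int
  proof -
    have "coprime a 4 \<longleftrightarrow> odd a"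
      using coprime_power_right_iff[of a 2 2] by simp
    also have "\<dots> \<longleftrightarrow> a mod 4 = 1 \<or> a mod 4 = 3" by presburger
    finally show ?thesis .
  qed
  have "\<psi> 1 = \<psi> 1 * \<psi> 1" "\<psi> 1 \<noteq> 0"
    using mult[of 1 1] nz[of 1] by auto
  hence 1: "\<psi> 1 = 1" by simp
  have "\<psi> 3 * \<psi> 3 = \<psi> (9 mod 4)"
    using mult[of 3 3] mod[of 9] by simp
  hence "\<psi> 3 ^ 2 = 1" using 1 by (simp add: power2_eq_square)
  hence "\<psi> 3 = 1 \<or> \<psi> 3 = -1" by (simp add: power2_eq_1_iff)
  moreover have "\<psi> 3 \<noteq> 1"
  proof
    assume 3: "\<psi> 3 = 1"
    have "\<psi> a = principal_char 4 a" for a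
      using mod[of a] nz[of a] 4[of a] 1 3 by (auto simp: principal_char_def)
    thus False using assms(2) by blast
  qed
  ultimately have 3: "\<psi> 3 = -1" by blast
  show ?thesis
    using mod[of a] nz[of a] 4[of a] 1 3 by auto
qed

lemma conductor_4:
  assumes "dirichlet_char 4 \<psi>" "\<psi> \<noteq> principal_char 4"
  shows "conductor \<psi> = 4"
proof (rule conductor_eqI[OF assms(1)])
  fix u X' assume u: "u < 4" "dirichlet_char u X'" and eq: "\<And>a. \<psi> a \<noteq> 0 \<Longrightarrow> X' a = \<psi> a"
  have X: "X' 1 = 1" "X' 3 = -1"
    using eq[of 1] eq[of 3] by (simp_all add: dirichlet_char_4_nonprincipal[OF assms])
  have per: "X' (a + int u) = X' a" and nz: "X' a \<noteq> 0 \<longleftrightarrow> coprime a (int u)" for a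
    using u(2) by (auto simp: dirichlet_char_def)
  have "u > 0" using u by (simp add: dirichlet_char_def)
  with u consider "u = 1" | "u = 2" | "u = 3" by linarith
  thus False
  proof cases
    case 1
    thus False using X per[of 1] per[of 2] by simp
  next
    case 2
    thus False using X per[of 1] by simp
  next
    case 3
    thus False using X nz[of 3] by auto
  qed
qed

text \<open>For odd \<open>N\<close> the residues modulo \<open>N\<close> are represented by even numbers: conjugation by the
  translation by \<open>j/N\<close> is then trivial modulo 2, so that the sign does not depend on \<open>j\<close>.\<close>

lemma odd_shift_Gamma0:
  fixes A :: "int^2^2" and N :: nat
  assumes A: "A \<in> Gamma0 (N ^ 2)" and N: "odd N" and jj: "even j" "even j'"
    and k: "int N dvd int j * A $ 2 $ 2 - int j' * A $ 1 $ 1" and \<tau>: "\<tau> \<in> uhp"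
  shows "dedekind_eta (moebius A \<tau> + of_nat j / of_nat N) ^ 12 =
    (if even (A $ 1 $ 1 * A $ 1 $ 2 + A $ 1 $ 2 * A $ 2 $ 1 + A $ 2 $ 1 * A $ 2 $ 2) then 1 else -1) *
    (of_int (A $ 2 $ 1) * \<tau> + of_int (A $ 2 $ 2)) ^ 6 * dedekind_eta (\<tau> + of_nat j' / of_nat N) ^ 12"
proof -
  obtain m where m: "A $ 2 $ 1 = int N ^ 2 * m"
    using A by (auto simp: Gamma0_def elim: dvdE)
  obtain k where k: "int j * A $ 2 $ 2 - int j' * A $ 1 $ 1 = int N * k"
    using k by (auto elim: dvdE)
  have "A $ 1 $ 1 * A $ 2 $ 2 - A $ 1 $ 2 * (int N ^ 2 * m) = 1"
    using A by (simp add: Gamma0_def det_2 flip: m)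
  moreover have "int N \<noteq> 0"
    using odd_pos[OF N] by simp
  \<comment> \<open>With \<open>N\<close> odd, evenness passes from \<open>N * k\<close> to
    \<open>k\<close>; then the entries of the conjugated matrix agree with those of \<open>A\<close>
    modulo 2.\<close>
  moreover have "even k"
  proof -
    have "even (int j * A $ 2 $ 2 - int j' * A $ 1 $ 1)"
      using jj by simp
    thus ?thesis unfolding k using N by simp
  qed
  ultimately show ?thesis
    using dedekind_eta_power_12_shift_Gamma0[of "A $ 1 $ 1" "A $ 2 $ 2" "A $ 1 $ 2" "int N" m "A $ 2 $ 1" "int j" "int j'" k \<tau>] m k \<tau> jj
    by (simp add: moebius_def)
qed

lemma Gamma0_det_cong:
  assumes "A \<in> Gamma0 (N ^ 2)"
  shows "int N ^ 2 dvd A $ 1 $ 1 * A $ 2 $ 2 - 1"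
proof -
  have "A $ 1 $ 1 * A $ 2 $ 2 - 1 = A $ 1 $ 2 * A $ 2 $ 1"
    using assms by (simp add: Gamma0_def det_2)
  thus ?thesis
    using assms by (simp add: Gamma0_def)
qed

text \<open>Since the product of the diagonal entries is 1 modulo \<open>N\<close>, the required
  \<open>p\<close> is multiplication by the square of the lower right entry on residues, under which
  a quadratic character is unchanged.\<close>

lemma gmf_qshift_prod_odd:
  assumes N: "odd N" and S: "finite S" "\<And>j. j \<in> S \<Longrightarrow> even j" and e: "(\<Sum>j\<in>S. e j) = 0"
    and f: "\<And>\<tau>. \<tau> \<in> uhp \<Longrightarrow> f \<tau> = qshift_prod N S e \<tau>"
    and p: "\<And>A. A \<in> Gamma0 (N ^ 2) \<Longrightarrow> \<exists>p. bij_betw p S S \<and> 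
       (\<forall>j\<in>S. e (p j) = e j \<and> int N dvd int j * A $ 2 $ 2 - int (p j) * A $ 1 $ 1)"
  shows "gmf_with_twelfth_root_char (Gamma0 (N ^ 2)) f" "cuspidal_divisor f"
proof -
  interpret E: eta_shift_product N S e "inverse (\<Prod>j\<in>S. nome (of_nat j / of_nat N / 24) powi e j)" f
    using N S e f by (intro eta_shift_product_qshift_prod) (auto intro: odd_pos)
  show "cuspidal_divisor f"
    by (rule E.cuspidal_divisor_f)
  show "gmf_with_twelfth_root_char (Gamma0 (N ^ 2)) f"
  proof (rule E.gmf_if_shifts_permuted)
    fix A assume A: "A \<in> Gamma0 (N ^ 2)"
    then obtain p where p: "bij_betw p S S" "\<And>j. j \<in> S \<Longrightarrow> e (p j) = e j"
      "\<And>j. j \<in> S \<Longrightarrow> int N dvd int j * A $ 2 $ 2 - int (p j) * A $ 1 $ 1"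
      using assms(6) by blast
    define J where "J = (\<lambda>\<tau>. (if even (A $ 1 $ 1 * A $ 1 $ 2 + A $ 1 $ 2 * A $ 2 $ 1 + A $ 2 $ 1 * A $ 2 $ 2) then 1 else -1) *
      (of_int (A $ 2 $ 1) * \<tau> + of_int (A $ 2 $ 2)) ^ 6 :: complex)"
    have "det A = 1"
      using A by (simp add: Gamma0_def)
    hence "J \<tau> \<noteq> 0" if "\<tau> \<in> uhp" for \<tau>
      using moebius_denom_nonzero[of A \<tau>] that by (simp add: J_def)
    moreover have "dedekind_eta (moebius A \<tau> + of_nat j / of_nat N) ^ 12 =
        J \<tau> * dedekind_eta (\<tau> + of_nat (p j) / of_nat N) ^ 12" if "\<tau> \<in> uhp" "j \<in> S" for \<tau> j
    proof -
      have "p j \<in> S"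
        using p(1) that(2) by (rule bij_betw_apply)
      show ?thesis
        unfolding J_def
        by (rule odd_shift_Gamma0[OF A N S(2)[OF that(2)] S(2)[OF \<open>p j \<in> S\<close>] p(3)[OF that(2)] that(1)])
    qed
    ultimately show "\<exists>p J. bij_betw p S S \<and> (\<forall>j\<in>S. e (p j) = e j) \<and>
     (\<forall>\<tau>\<in>uhp. J \<tau> \<noteq> 0 \<and> (\<forall>j\<in>S. dedekind_eta (moebius A \<tau> + of_nat j / of_nat N) ^ 12 =
        J \<tau> * dedekind_eta (\<tau> + of_nat (p j) / of_nat N) ^ 12))"
      by (intro exI[of _ p] exI[of _ J] conjI ballI p(1,2))
  qed
qed

text \<open>The values at \<open>j\<close> of the three characters, on the representatives \<open>{2, 4}\<close>, \<open>{1, 3}\<close> and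
  \<open>{2, 4, 6, 8}\<close> of the units modulo 3, 4 and 5.\<close>

abbreviation "shift_exponent_3 \<equiv> (\<lambda>j::nat. if j = 4 then 1 else -1 :: int)"
abbreviation "shift_exponent_4 \<equiv> (\<lambda>j::nat. if j = 1 then 1 else -1 :: int)"
abbreviation "shift_exponent_5 \<equiv> (\<lambda>j::nat. if j = 4 \<or> j = 6 then 1 else -1 :: int)"

text \<open>Modulo 3 the only square of a unit is 1, so the identity permutation serves.\<close>

lemma gmf_qshift_prod_3:
  assumes "\<And>\<tau>. \<tau> \<in> uhp \<Longrightarrow> f \<tau> = qshift_prod 3 {2, 4} shift_exponent_3 \<tau>"
  shows "gmf_with_twelfth_root_char (Gamma0 9) f" "cuspidal_divisor f"
proof -
  have p: "\<exists>p. bij_betw p {2, 4} {2, 4} \<and> 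
       (\<forall>j\<in>{2, 4}. shift_exponent_3 (p j) = shift_exponent_3 j \<and> int 3 dvd int j * A $ 2 $ 2 - int (p j) * A $ 1 $ 1)"
    if "A \<in> Gamma0 (3 ^ 2)" for A
  proof -
    define a d where "a = A $ 1 $ 1" and "d = A $ 2 $ 2"
    have "3 dvd a * d - 1"
      using Gamma0_det_cong[OF that] by (auto simp: a_def d_def intro: dvd_trans[of 3 9])
    hence ad: "((a mod 3) * (d mod 3)) mod 3 = 1"
      using mod_eq_dvd_iff[of "a * d" 3 1] by (simp add: mod_mult_eq)
    have "a mod 3 = 0 \<or> a mod 3 = 1 \<or> a mod 3 = 2" "d mod 3 = 0 \<or> d mod 3 = 1 \<or> d mod 3 = 2"
      by presburger+
    with ad have "a mod 3 = d mod 3"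
      by (elim disjE) simp_all
    hence "3 dvd d - a"
      using mod_eq_dvd_iff[of d 3 a] by simp
    hence "int 3 dvd int j * (d - a)" for j
      by simp
    thus ?thesis
      by (intro exI[of _ id]) (simp add: a_def d_def algebra_simps)
  qed
  have S: "odd (3 :: nat)" "finite {2, 4 :: nat}" "\<And>j. j \<in> {2, 4 :: nat} \<Longrightarrow> even j" "(\<Sum>j\<in>{2, 4 :: nat}. shift_exponent_3 j) = 0"
    by auto
  show "cuspidal_divisor f"
    by (rule gmf_qshift_prod_odd(2)[OF S assms p])
  have "gmf_with_twelfth_root_char (Gamma0 (3 ^ 2)) f"
    by (rule gmf_qshift_prod_odd(1)[OF S assms p])
  thus "gmf_with_twelfth_root_char (Gamma0 9) f"
    by simp
qed

text \<open>The squares of units modulo 5 are 1 and -1. On the even representatives -1 acts as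
  \<open>10 - j\<close>, which keeps the exponents because -1 is itself a square modulo 5.\<close>

lemma gmf_qshift_prod_5:
  assumes "\<And>\<tau>. \<tau> \<in> uhp \<Longrightarrow> f \<tau> = qshift_prod 5 {2, 4, 6, 8} shift_exponent_5 \<tau>"
  shows "gmf_with_twelfth_root_char (Gamma0 25) f" "cuspidal_divisor f"
proof -
  have p: "\<exists>p. bij_betw p {2, 4, 6, 8} {2, 4, 6, 8} \<and> 
       (\<forall>j\<in>{2, 4, 6, 8}. shift_exponent_5 (p j) = shift_exponent_5 j \<and> int 5 dvd int j * A $ 2 $ 2 - int (p j) * A $ 1 $ 1)"
    if "A \<in> Gamma0 (5 ^ 2)" for A
  proof -
    define a d where "a = A $ 1 $ 1" and "d = A $ 2 $ 2"
    have "5 dvd a * d - 1"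
      using Gamma0_det_cong[OF that] by (auto simp: a_def d_def intro: dvd_trans[of 5 25])
    hence ad: "((a mod 5) * (d mod 5)) mod 5 = 1"
      using mod_eq_dvd_iff[of "a * d" 5 1] by (simp add: mod_mult_eq)
    have "a mod 5 = 0 \<or> a mod 5 = 1 \<or> a mod 5 = 2 \<or> a mod 5 = 3 \<or> a mod 5 = 4"
      "d mod 5 = 0 \<or> d mod 5 = 1 \<or> d mod 5 = 2 \<or> d mod 5 = 3 \<or> d mod 5 = 4"
      by presburger+
    with ad have "d mod 5 = a mod 5 \<or> (d mod 5 + a mod 5) mod 5 = 0"
      by (elim disjE) simp_all
    hence "5 dvd d - a \<or> 5 dvd d + a"
      using mod_eq_dvd_iff[of d 5 a] by (simp add: mod_add_eq mod_eq_0_iff_dvd)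
    thus ?thesis
    proof
      assume "5 dvd d - a"
      hence "int 5 dvd int j * (d - a)" for j
        by simp
      thus ?thesis
        by (intro exI[of _ id]) (simp add: a_def d_def algebra_simps)
    next
      assume "5 dvd d + a"
      hence dvd: "int 5 dvd int j * (d + a) - 10 * a" for j :: nat
        by (intro dvd_diff) auto
      have "bij_betw (\<lambda>j. 10 - j) {2, 4, 6, 8} {2, 4, 6, 8 :: nat}"
        by (auto simp: bij_betw_def inj_on_def)
      moreover have "\<forall>j\<in>{2, 4, 6, 8}. shift_exponent_5 (10 - j) = shift_exponent_5 j \<and> int 5 dvd int j * d - int (10 - j) * a"
      proof (intro ballI conjI)
        fix j :: nat assume j: "j \<in> {2, 4, 6, 8}"
        show "shift_exponent_5 (10 - j) = shift_exponent_5 j"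
          using j by auto
        have "int j * (d + a) - 10 * a = int j * d - int (10 - j) * a"
          using j by (auto simp: algebra_simps)
        thus "int 5 dvd int j * d - int (10 - j) * a"
          using dvd[of j] by (simp only:)
      qed
      ultimately show ?thesis
        unfolding a_def d_def by blast
    qed
  qed
  have S: "odd (5 :: nat)" "finite {2, 4, 6, 8 :: nat}" "\<And>j. j \<in> {2, 4, 6, 8 :: nat} \<Longrightarrow> even j" "(\<Sum>j\<in>{2, 4, 6, 8 :: nat}. shift_exponent_5 j) = 0"
    by auto
  show "cuspidal_divisor f"
    by (rule gmf_qshift_prod_odd(2)[OF S assms p])
  have "gmf_with_twelfth_root_char (Gamma0 (5 ^ 2)) f"
    by (rule gmf_qshift_prod_odd(1)[OF S assms p])
  thus "gmf_with_twelfth_root_char (Gamma0 25) f"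
    by simp
qed

text \<open>Here \<open>N\<close> is even and the shifts are odd. The conjugated matrix has odd
  upper left and even lower left entry, so the sign is governed by its upper right entry, which has
  the parity of \<open>b + l - m\<close> for both shifts.\<close>

lemma gmf_qshift_prod_4:
  assumes "\<And>\<tau>. \<tau> \<in> uhp \<Longrightarrow> f \<tau> = qshift_prod 4 {1, 3} shift_exponent_4 \<tau>"
  shows "gmf_with_twelfth_root_char (Gamma0 16) f" "cuspidal_divisor f"
proof -
  interpret E: eta_shift_product 4 "{1, 3}" shift_exponent_4
     "inverse (\<Prod>j\<in>{1, 3}. nome (of_nat j / of_nat 4 / 24) powi shift_exponent_4 j)" f
    using assms by (intro eta_shift_product_qshift_prod) auto
  show "cuspidal_divisor f"
    by (rule E.cuspidal_divisor_f)
  have "gmf_with_twelfth_root_char (Gamma0 (4 ^ 2)) f"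
  proof (rule E.gmf_if_shifts_permuted)
    fix A assume A: "A \<in> Gamma0 (4 ^ 2)"
    define a b c d where "a = A $ 1 $ 1" and "b = A $ 1 $ 2" and "c = A $ 2 $ 1" and "d = A $ 2 $ 2"
    obtain m where m: "c = 4 ^ 2 * m"
      using A by (auto simp: Gamma0_def c_def elim: dvdE)
    have "a * d - b * c = 1"
      using A by (simp add: Gamma0_def det_2 a_def b_def c_def d_def)
    hence det: "a * d - b * (4 ^ 2 * m) = 1"
      by (simp only: m)
    hence "a * d = 2 * (8 * (b * m)) + 1"
      by simp
    hence "odd (a * d)"
      by simp
    hence odd: "odd a" "odd d" by auto
    have "a * d - 1 = 4 * (4 * (b * m))"
      using det by simp
    hence "4 dvd a * d - 1"
      by (metis dvd_triv_left)
    hence ad: "((a mod 4) * (d mod 4)) mod 4 = 1"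
      using mod_eq_dvd_iff[of "a * d" 4 1] by (simp add: mod_mult_eq)
    have "a mod 4 = 0 \<or> a mod 4 = 1 \<or> a mod 4 = 2 \<or> a mod 4 = 3" "d mod 4 = 0 \<or> d mod 4 = 1 \<or> d mod 4 = 2 \<or> d mod 4 = 3"
      by presburger+
    with ad have "d mod 4 = a mod 4"
      by (elim disjE) simp_all
    then obtain l where l: "d - a = 4 * l"
      using mod_eq_dvd_iff[of d 4 a] by (auto elim: dvdE)
    define J where "J = (\<lambda>\<tau>. (if even (b + l - m) then 1 else -1) * (of_int c * \<tau> + of_int d) ^ 6 :: complex)"
    have "det A = 1"
      using A by (simp add: Gamma0_def)
    hence "J \<tau> \<noteq> 0" if "\<tau> \<in> uhp" for \<tau>
      using moebius_denom_nonzero[of A \<tau>] that by (simp add: J_def c_def d_def)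
    moreover have "dedekind_eta (moebius A \<tau> + of_nat j / of_nat 4) ^ 12 =
        J \<tau> * dedekind_eta (\<tau> + of_nat j / of_nat 4) ^ 12" if \<tau>: "\<tau> \<in> uhp" and j: "j \<in> {1, 3}" for \<tau> j
    proof -
      have "int j * d - int j * a = 4 * (int j * l)"
        using l by (simp add: algebra_simps)
      moreover have "odd j" using j by auto
      hence "even ((a + int j * 4 * m) * (b + int j * l - int j * int j * m) + (b + int j * l - int j * int j * m) * c +
          c * (d - int j * 4 * m)) \<longleftrightarrow> even (b + l - m)"
        using odd by (simp add: m)
      ultimately show ?thesis
        using dedekind_eta_power_12_shift_Gamma0[of a d b 4 m c "int j" "int j" "int j * l" \<tau>] det m \<tau>
        by (simp only: J_def) (simp add: moebius_def a_def b_def c_def d_def)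
    qed
    ultimately show "\<exists>p J. bij_betw p {1, 3} {1, 3} \<and> (\<forall>j\<in>{1, 3}. shift_exponent_4 (p j) = shift_exponent_4 j) \<and>
     (\<forall>\<tau>\<in>uhp. J \<tau> \<noteq> 0 \<and> (\<forall>j\<in>{1, 3}. dedekind_eta (moebius A \<tau> + of_nat j / of_nat 4) ^ 12 =
        J \<tau> * dedekind_eta (\<tau> + of_nat (p j) / of_nat 4) ^ 12))"
      by (intro exI[of _ id] exI[of _ J]) auto
  qed
  thus "gmf_with_twelfth_root_char (Gamma0 16) f" by simp
qed

section \<open>The explicit products as products of shifted eta functions\<close>

lemma complex_powr_0_1:
  fixes z :: complex
  assumes "z \<noteq> 0"
  shows "z powr 0 = 1" "z powr 1 = z" "z powr (-1) = inverse z"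
  using assms by (simp_all add: powr_minus)

lemma norm_nome_power_less_1: "\<tau> \<in> uhp \<Longrightarrow> n > 0 \<Longrightarrow> norm (nome \<tau> ^ n) < 1"
  using norm_nome_less_1[of \<tau>] by (simp add: norm_power power_less_one_iff)

text \<open>If 3 does not divide \<open>n\<close>, multiplication by \<open>n\<close> permutes the
  units modulo 3. If 3 divides \<open>n\<close>, all exponents in \<open>eta_char\<close> are 0 and
  the two shifted factors cancel.\<close>

lemma eta_char_legendre_3:
  assumes \<tau>: "\<tau> \<in> uhp"
  shows "eta_char (legendre_char 3) \<tau> = qshift_prod 3 {2, 4} shift_exponent_3 \<tau>" (is ?A)
    and "(\<lambda>n. ((1 - nome (1 / 3) * nome \<tau> ^ (n + 1)) / (1 - nome (2 / 3) * nome \<tau> ^ (n + 1)))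
          powr legendre_char 3 (int (n + 1))) has_prod eta_char (legendre_char 3) \<tau>" (is ?B)
proof -
  define G where "G = (\<lambda>n. ((1 - nome (1 / 3) * nome \<tau> ^ n) / (1 - nome (2 / 3) * nome \<tau> ^ n))
          powr legendre_char 3 (int n))"
  have "(\<Prod>a = 1..conductor (legendre_char 3). (1 - nome (of_nat a / of_nat (conductor (legendre_char 3))) * nome \<tau> ^ n)
          powr cnj (legendre_char 3 (int (a * n)))) = G n \<and>
        (\<Prod>j\<in>{2, 4}. (1 - nome (of_nat j / of_nat 3) ^ n * nome \<tau> ^ n) powi shift_exponent_3 j) = G n"
    if n: "n > 0" for n
  proof -
    define x where "x = nome \<tau> ^ n"
    have "norm x < 1"
      using norm_nome_power_less_1[OF \<tau> n] by (simp add: x_def)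
    \<comment> \<open>Nonvanishing matters even for exponent 0, because
      \<open>0 powr 0 = 0\<close>.\<close>
    hence nz: "1 - nome (1 / 3) * x \<noteq> 0" "1 - nome (2 / 3) * x \<noteq> 0" "1 - nome 1 * x \<noteq> 0"
      by (simp_all only: one_minus_root_nonzero Im_divide_numeral one_complex.sel complex_Im_numeral div_0 not_False_eq_True)
    have root: "nome (of_nat j / of_nat 3) ^ n = nome (of_nat ((n mod 3 * j) mod 3) / of_nat 3)" for j
      by (rule nome_root_power) simp
    have 13: "{1..3::nat} = {1, 2, 3}" by auto
    have "n mod 3 = 0 \<or> n mod 3 = 1 \<or> n mod 3 = 2" by presburger
    thus ?thesis
    proof (elim disjE)
      assume r: "n mod 3 = 0"
      have "int (1 * n) mod 3 = 0" "int (2 * n) mod 3 = 0" "int (3 * n) mod 3 = 0" "int n mod 3 = 0"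
        using r by presburger+
      thus ?thesis
        using nz r unfolding conductor_legendre_3 G_def root 13 x_def[symmetric]
        by (simp add: legendre_char_3 complex_powr_0_1 power_int_minus)
    next
      assume r: "n mod 3 = 1"
      have "int (1 * n) mod 3 = 1" "int (2 * n) mod 3 = 2" "int (3 * n) mod 3 = 0" "int n mod 3 = 1"
        using r by presburger+
      thus ?thesis
        using nz r unfolding conductor_legendre_3 G_def root 13 x_def[symmetric]
        by (simp add: legendre_char_3 complex_powr_0_1 power_int_minus field_simps)
    next
      assume r: "n mod 3 = 2"
      have "int (1 * n) mod 3 = 2" "int (2 * n) mod 3 = 1" "int (3 * n) mod 3 = 0" "int n mod 3 = 2"
        using r by presburger+
      thus ?thesis
        using nz r unfolding conductor_legendre_3 G_def root 13 x_def[symmetric]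
        by (simp add: legendre_char_3 complex_powr_0_1 power_int_minus field_simps)
    qed
  qed
  hence 1: "(\<Prod>a = 1..conductor (legendre_char 3). (1 - nome (of_nat a / of_nat (conductor (legendre_char 3))) * nome \<tau> ^ n)
          powr cnj (legendre_char 3 (int (a * n)))) = G n" 
    and 2: "(\<Prod>j\<in>{2, 4}. (1 - nome (of_nat j / of_nat 3) ^ n * nome \<tau> ^ n) powi shift_exponent_3 j) = G n" if "n > 0" for n
    using that by blast+
  show ?A
    by (rule eta_char_eq_qshift_prod(1)[OF \<tau> 1 2])
  show ?B
    using eta_char_eq_qshift_prod(2)[OF \<tau> 1 2] by (simp only: G_def)
qed

text \<open>The residue 2 is neither a unit nor zero modulo 4: there \<open>\<psi>\<close> vanishes,
  and the two shifted factors are both \<open>1 + x\<close> and cancel.\<close>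

lemma eta_char_4:
  assumes \<tau>: "\<tau> \<in> uhp" and \<psi>: "dirichlet_char 4 \<psi>" "\<psi> \<noteq> principal_char 4"
  shows "eta_char \<psi> \<tau> = qshift_prod 4 {1, 3} shift_exponent_4 \<tau>" (is ?A)
    and "(\<lambda>n. ((1 - \<i> * nome \<tau> ^ (n + 1)) / (1 + \<i> * nome \<tau> ^ (n + 1))) powr \<psi> (int (n + 1)))
          has_prod eta_char \<psi> \<tau>" (is ?B)
proof -
  define G where "G = (\<lambda>n. ((1 - \<i> * nome \<tau> ^ n) / (1 + \<i> * nome \<tau> ^ n)) powr \<psi> (int n))"
  have nome4: "nome (1 / 4) = \<i>" "nome (3 / 4) = - \<i>" "nome (2 / 4) = -1"
    using nome_add[of "1/2" "1/4"] by (simp_all add: nome_quarter nome_half)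
  have "(\<Prod>a = 1..conductor \<psi>. (1 - nome (of_nat a / of_nat (conductor \<psi>)) * nome \<tau> ^ n)
          powr cnj (\<psi> (int (a * n)))) = G n \<and>
        (\<Prod>j\<in>{1, 3}. (1 - nome (of_nat j / of_nat 4) ^ n * nome \<tau> ^ n) powi shift_exponent_4 j) = G n"
    if n: "n > 0" for n
  proof -
    define x where "x = nome \<tau> ^ n"
    have "norm x < 1"
      using norm_nome_power_less_1[OF \<tau> n] by (simp add: x_def)
    hence "1 - nome (1 / 4) * x \<noteq> 0" "1 - nome (2 / 4) * x \<noteq> 0" "1 - nome (3 / 4) * x \<noteq> 0" "1 - nome 1 * x \<noteq> 0"
      by (simp_all only: one_minus_root_nonzero Im_divide_numeral one_complex.sel complex_Im_numeral div_0 not_False_eq_True)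
    hence nz: "1 - \<i> * x \<noteq> 0" "1 + x \<noteq> 0" "1 + \<i> * x \<noteq> 0" "1 - x \<noteq> 0"
      unfolding nome4 by simp_all
    have root: "nome (of_nat j / of_nat 4) ^ n = nome (of_nat ((n mod 4 * j) mod 4) / of_nat 4)" for j
      by (rule nome_root_power) simp
    have 14: "{1..4::nat} = {1, 2, 3, 4}" by auto
    have "n mod 4 = 0 \<or> n mod 4 = 1 \<or> n mod 4 = 2 \<or> n mod 4 = 3" by presburger
    thus ?thesis
    proof (elim disjE)
      assume r: "n mod 4 = 0"
      have "int (1 * n) mod 4 = 0" "int (2 * n) mod 4 = 0" "int (3 * n) mod 4 = 0" "int (4 * n) mod 4 = 0" "int n mod 4 = 0"
        using r by presburger+
      thus ?thesis
        using nz r unfolding conductor_4[OF \<psi>] G_def root 14 x_def[symmetric]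
        by (simp add: dirichlet_char_4_nonprincipal[OF \<psi>] complex_powr_0_1 power_int_minus nome4 nome_half)
    next
      assume r: "n mod 4 = 1"
      have "int (1 * n) mod 4 = 1" "int (2 * n) mod 4 = 2" "int (3 * n) mod 4 = 3" "int (4 * n) mod 4 = 0" "int n mod 4 = 1"
        using r by presburger+
      thus ?thesis
        using nz r unfolding conductor_4[OF \<psi>] G_def root 14 x_def[symmetric]
        by (simp add: dirichlet_char_4_nonprincipal[OF \<psi>] complex_powr_0_1 power_int_minus nome4 nome_half field_simps)
    next
      assume r: "n mod 4 = 2"
      have "int (1 * n) mod 4 = 2" "int (2 * n) mod 4 = 0" "int (3 * n) mod 4 = 2" "int (4 * n) mod 4 = 0" "int n mod 4 = 2"
        using r by presburger+
      thus ?thesis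
        using nz r unfolding conductor_4[OF \<psi>] G_def root 14 x_def[symmetric]
        by (simp add: dirichlet_char_4_nonprincipal[OF \<psi>] complex_powr_0_1 power_int_minus nome4 nome_half)
    next
      assume r: "n mod 4 = 3"
      have "int (1 * n) mod 4 = 3" "int (2 * n) mod 4 = 2" "int (3 * n) mod 4 = 1" "int (4 * n) mod 4 = 0" "int n mod 4 = 3"
        using r by presburger+
      thus ?thesis
        using nz r unfolding conductor_4[OF \<psi>] G_def root 14 x_def[symmetric]
        by (simp add: dirichlet_char_4_nonprincipal[OF \<psi>] complex_powr_0_1 power_int_minus nome4 nome_half field_simps)
    qed
  qed
  hence 1: "(\<Prod>a = 1..conductor \<psi>. (1 - nome (of_nat a / of_nat (conductor \<psi>)) * nome \<tau> ^ n)
          powr cnj (\<psi> (int (a * n)))) = G n" 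
    and 2: "(\<Prod>j\<in>{1, 3}. (1 - nome (of_nat j / of_nat 4) ^ n * nome \<tau> ^ n) powi shift_exponent_4 j) = G n" if "n > 0" for n
    using that by blast+
  show ?A
    by (rule eta_char_eq_qshift_prod(1)[OF \<tau> 1 2])
  show ?B
    using eta_char_eq_qshift_prod(2)[OF \<tau> 1 2] by (simp only: G_def)
qed

text \<open>For a primitive fifth root \<open>w\<close>, the sum \<open>y = w + w ^ 4\<close>
  satisfies \<open>y ^ 2 + y = 1\<close>. Being twice a positive cosine, it is the positive
  solution; the other pair of roots sums to the second solution.\<close>

lemma fifth_roots:
  shows "nome (1 / 5) + nome (4 / 5) = of_real ((sqrt 5 - 1) / 2)"
    and "nome (2 / 5) + nome (3 / 5) = of_real ((- sqrt 5 - 1) / 2)"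
    and "nome (1 / 5) * nome (4 / 5) = 1" and "nome (2 / 5) * nome (3 / 5) = 1"
proof -
  define w where "w = nome (1 / 5)"
  have w5: "w ^ 5 = 1"
    by (simp add: w_def nome_power)
  have w: "nome (2 / 5) = w ^ 2" "nome (3 / 5) = w ^ 3" "nome (4 / 5) = w ^ 4"
    by (simp_all add: w_def nome_power)
  have "w \<noteq> 1"
    using nome_inverse_neq_1[of 5] by (simp add: w_def)
  moreover have "(w - 1) * (1 + w + w ^ 2 + w ^ 3 + w ^ 4) = w ^ 5 - 1"
    by (simp add: algebra_simps power_numeral_reduce)
  hence "(w - 1) * (1 + w + w ^ 2 + w ^ 3 + w ^ 4) = 0"
    by (simp only: w5 diff_self)
  ultimately have sum: "1 + w + w ^ 2 + w ^ 3 + w ^ 4 = 0" by simp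
  define y where "y = w + w ^ 4"
  have w4: "w ^ 4 = cnj w"
  proof -
    have "norm w = 1"
      by (simp add: w_def norm_nome)
    hence "w * cnj w = 1"
      using complex_norm_square[of w] by simp
    moreover have "cnj w * w ^ 5 = (w * cnj w) * w ^ 4"
      by (simp add: algebra_simps power_numeral_reduce)
    ultimately have "cnj w * w ^ 5 = w ^ 4"
      by simp
    thus ?thesis by (simp add: w5)
  qed
  have y: "y = of_real (2 * cos (2 * pi / 5))"
    unfolding y_def w4 by (simp add: complex_eq_iff w_def nome_def Re_exp Im_exp)
  have "y * y + y - 1 = 0"
    proof -
    have "y * y + y - 1 = w ^ 5 * w ^ 3 + 2 * w ^ 5 + w ^ 2 + w + w ^ 4 - 1"
      by (simp add: y_def algebra_simps power_numeral_reduce)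
    also have "\<dots> = 1 + w + w ^ 2 + w ^ 3 + w ^ 4"
      by (simp add: w5)
    finally show ?thesis
      by (simp only: sum)
  qed
  hence "of_real ((2 * cos (2 * pi / 5)) ^ 2 + 2 * cos (2 * pi / 5) - 1) = (0 :: complex)"
    by (simp only: y power2_eq_square of_real_add of_real_mult of_real_diff of_real_1)
  hence "(2 * cos (2 * pi / 5)) ^ 2 + 2 * cos (2 * pi / 5) - 1 = (0 :: real)"
    by (simp only: of_real_eq_0_iff)
  hence "(2 * (2 * cos (2 * pi / 5)) + 1) ^ 2 = (5 :: real)"
    by (simp add: power2_eq_square algebra_simps)
  moreover have "cos (2 * pi / 5) > 0"
    by (rule cos_gt_zero) auto
  ultimately have "2 * (2 * cos (2 * pi / 5)) + 1 = sqrt 5"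
    by (intro real_sqrt_unique[symmetric]) auto
  hence "2 * cos (2 * pi / 5) = (sqrt 5 - 1) / 2"
    by simp
  hence y': "y = of_real ((sqrt 5 - 1) / 2)"
    by (simp only: y)
  thus "nome (1 / 5) + nome (4 / 5) = of_real ((sqrt 5 - 1) / 2)"
    by (simp only: y_def w w_def[symmetric])
  have "w ^ 2 + w ^ 3 = - 1 - y"
    using sum by (simp add: y_def algebra_simps eq_neg_iff_add_eq_0)
  also have "\<dots> = of_real ((- sqrt 5 - 1) / 2)"
    unfolding y' by (simp add: field_simps)
  finally show "nome (2 / 5) + nome (3 / 5) = of_real ((- sqrt 5 - 1) / 2)"
    by (simp add: w)
  show "nome (1 / 5) * nome (4 / 5) = 1" "nome (2 / 5) * nome (3 / 5) = 1"
    by (simp_all flip: nome_add)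
qed

text \<open>The linear coefficient is minus the sum of two conjugate fifth roots, hence
  \<open>+ (1 - sqrt 5) / 2\<close> in the first case. The minus sign in the English display would
  replace the fifth roots by their negatives, which are primitive tenth roots of unity.\<close>

lemma fifth_root_factors:
  shows "1 + of_real ((1 - sqrt 5) / 2) * x + x ^ 2 = (1 - nome (1 / 5) * x) * (1 - nome (4 / 5) * x)"
    and "1 + of_real ((1 + sqrt 5) / 2) * x + x ^ 2 = (1 - nome (2 / 5) * x) * (1 - nome (3 / 5) * x)"
proof -
  have *: "(1 - a * x) * (1 - b * x) = 1 - (a + b) * x + (a * b) * x ^ 2" for a b :: complex
    by (simp add: algebra_simps power2_eq_square)
  show "1 + of_real ((1 - sqrt 5) / 2) * x + x ^ 2 = (1 - nome (1 / 5) * x) * (1 - nome (4 / 5) * x)"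
    unfolding * fifth_roots by (simp add: field_simps)
  show "1 + of_real ((1 + sqrt 5) / 2) * x + x ^ 2 = (1 - nome (2 / 5) * x) * (1 - nome (3 / 5) * x)"
    unfolding * fifth_roots by (simp add: field_simps)
qed

lemma eta_char_legendre_5:
  assumes \<tau>: "\<tau> \<in> uhp"
  shows "eta_char (legendre_char 5) \<tau> = qshift_prod 5 {2, 4, 6, 8} shift_exponent_5 \<tau>" (is ?A)
    and "(\<lambda>n. ((1 + of_real ((1 - sqrt 5) / 2) * nome \<tau> ^ (n + 1) + nome \<tau> ^ (2 * (n + 1))) /
              (1 + of_real ((1 + sqrt 5) / 2) * nome \<tau> ^ (n + 1) + nome \<tau> ^ (2 * (n + 1))))
             powr legendre_char 5 (int (n + 1)))
          has_prod eta_char (legendre_char 5) \<tau>" (is ?B)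
proof -
  define G where "G = (\<lambda>n. ((1 - nome (1 / 5) * nome \<tau> ^ n) * (1 - nome (4 / 5) * nome \<tau> ^ n) / 
          ((1 - nome (2 / 5) * nome \<tau> ^ n) * (1 - nome (3 / 5) * nome \<tau> ^ n))) powr legendre_char 5 (int n))"
  have "(\<Prod>a = 1..conductor (legendre_char 5). (1 - nome (of_nat a / of_nat (conductor (legendre_char 5))) * nome \<tau> ^ n)
          powr cnj (legendre_char 5 (int (a * n)))) = G n \<and>
        (\<Prod>j\<in>{2, 4, 6, 8}. (1 - nome (of_nat j / of_nat 5) ^ n * nome \<tau> ^ n) powi shift_exponent_5 j) = G n"
    if n: "n > 0" for n
  proof -
    define x where "x = nome \<tau> ^ n"
    have "norm x < 1"
      using norm_nome_power_less_1[OF \<tau> n] by (simp add: x_def)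
    hence nz: "1 - nome (1 / 5) * x \<noteq> 0" "1 - nome (2 / 5) * x \<noteq> 0" "1 - nome (3 / 5) * x \<noteq> 0"
      "1 - nome (4 / 5) * x \<noteq> 0" "1 - nome 1 * x \<noteq> 0"
      by (simp_all only: one_minus_root_nonzero Im_divide_numeral one_complex.sel complex_Im_numeral div_0 not_False_eq_True)
    have root: "nome (of_nat j / of_nat 5) ^ n = nome (of_nat ((n mod 5 * j) mod 5) / of_nat 5)" for j
      by (rule nome_root_power) simp
    have quot: "a * b / (c * d) = a * b * (inverse c * inverse d)" for a b c d :: complex
      by (simp add: divide_inverse)
    have 15: "{1..5::nat} = {1, 2, 3, 4, 5}" by auto
    have "n mod 5 = 0 \<or> n mod 5 = 1 \<or> n mod 5 = 2 \<or> n mod 5 = 3 \<or> n mod 5 = 4" by presburger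
    thus ?thesis
    proof (elim disjE)
      assume r: "n mod 5 = 0"
      have "int (1 * n) mod 5 = 0" "int (2 * n) mod 5 = 0" "int (3 * n) mod 5 = 0" "int (4 * n) mod 5 = 0" 
        "int (5 * n) mod 5 = 0" "int n mod 5 = 0"
        using r by presburger+
      thus ?thesis
        using nz r unfolding conductor_legendre_5 G_def root 15 x_def[symmetric]
        by (simp add: legendre_char_5 complex_powr_0_1 power_int_minus)
    next
      assume r: "n mod 5 = 1"
      have "int (1 * n) mod 5 = 1" "int (2 * n) mod 5 = 2" "int (3 * n) mod 5 = 3" "int (4 * n) mod 5 = 4" 
        "int (5 * n) mod 5 = 0" "int n mod 5 = 1"
        using r by presburger+
      thus ?thesis
        using nz r unfolding conductor_legendre_5 G_def root 15 x_def[symmetric]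
        by (simp add: legendre_char_5 complex_powr_0_1 power_int_minus quot mult_ac)
    next
      assume r: "n mod 5 = 2"
      have "int (1 * n) mod 5 = 2" "int (2 * n) mod 5 = 4" "int (3 * n) mod 5 = 1" "int (4 * n) mod 5 = 3" 
        "int (5 * n) mod 5 = 0" "int n mod 5 = 2"
        using r by presburger+
      thus ?thesis
        using nz r unfolding conductor_legendre_5 G_def root 15 x_def[symmetric]
        by (simp add: legendre_char_5 complex_powr_0_1 power_int_minus quot mult_ac)
    next
      assume r: "n mod 5 = 3"
      have "int (1 * n) mod 5 = 3" "int (2 * n) mod 5 = 1" "int (3 * n) mod 5 = 4" "int (4 * n) mod 5 = 2" 
        "int (5 * n) mod 5 = 0" "int n mod 5 = 3"
        using r by presburger+
      thus ?thesis
        using nz r unfolding conductor_legendre_5 G_def root 15 x_def[symmetric]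
        by (simp add: legendre_char_5 complex_powr_0_1 power_int_minus quot mult_ac)
    next
      assume r: "n mod 5 = 4"
      have "int (1 * n) mod 5 = 4" "int (2 * n) mod 5 = 3" "int (3 * n) mod 5 = 2" "int (4 * n) mod 5 = 1" 
        "int (5 * n) mod 5 = 0" "int n mod 5 = 4"
        using r by presburger+
      thus ?thesis
        using nz r unfolding conductor_legendre_5 G_def root 15 x_def[symmetric]
        by (simp add: legendre_char_5 complex_powr_0_1 power_int_minus quot mult_ac)
    qed
  qed
  hence 1: "(\<Prod>a = 1..conductor (legendre_char 5). (1 - nome (of_nat a / of_nat (conductor (legendre_char 5))) * nome \<tau> ^ n)
          powr cnj (legendre_char 5 (int (a * n)))) = G n" 
    and 2: "(\<Prod>j\<in>{2, 4, 6, 8}. (1 - nome (of_nat j / of_nat 5) ^ n * nome \<tau> ^ n) powi shift_exponent_5 j) = G n" if "n > 0" for n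
    using that by blast+
  show ?A
    by (rule eta_char_eq_qshift_prod(1)[OF \<tau> 1 2])
  have "nome \<tau> ^ (2 * n) = (nome \<tau> ^ n) ^ 2" for n
    by (rule power_even_eq)
  thus ?B
    using eta_char_eq_qshift_prod(2)[OF \<tau> 1 2] by (simp only: G_def fifth_root_factors)
qed

section \<open>Logarithmic coefficients and eta quotients\<close>

text \<open>This is \<open>\<sigma>\<^sub>-\<^sub>1(k)\<close>.\<close>

definition log_coeff :: "nat \<Rightarrow> real" where
  "log_coeff k = (\<Sum>(n, j) \<in> {(n, j). (n + 1) * (j + 1) = k}. 1 / real (j + 1))"

lemma finite_factor_pairs: "finite {(n, j). (n + 1) * (j + 1) = (k :: nat)}"
proof (rule finite_subset)
  show "{(n, j). (n + 1) * (j + 1) = k} \<subseteq> {..k} \<times> {..k}" by auto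
qed auto

lemma log_coeff_0 [simp]: "log_coeff 0 = 0"
  by (simp add: log_coeff_def)

lemma log_coeff_pos:
  assumes "k > 0"
  shows "log_coeff k > 0"
  unfolding log_coeff_def
proof (rule sum_pos2[OF finite_factor_pairs])
  show "(k - 1, 0) \<in> {(n, j). (n + 1) * (j + 1) = k}"
    using assms by simp
qed auto

text \<open>Minus the logarithm of the product of all \<open>1 - q ^ n\<close> with
  \<open>n \<ge> 1\<close>, in the branch vanishing at \<open>q = 0\<close>.\<close>

definition eta_log :: "complex \<Rightarrow> complex" where
  "eta_log q = (\<Sum>k. of_real (log_coeff k) * q ^ k)"

text \<open>The double series of \<open>q ^ ((n + 1) * (j + 1)) / (j + 1)\<close> is dominated by
  \<open>r ^ n * r ^ j\<close>. Summed over \<open>j\<close> first it gives the logarithms; grouped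
  by \<open>k = (n + 1) * (j + 1)\<close> it gives the power series.\<close>

lemma eta_log_sums_aux:
  assumes "norm q < 1"
  shows "(\<lambda>k. of_real (log_coeff k) * q ^ k) sums eta_log q \<and> (\<lambda>n. ln (1 - q ^ (n + 1))) sums (- eta_log q)"
proof -
  define g where "g = (\<lambda>(n, j). q ^ ((n + 1) * (j + 1)) / of_nat (j + 1))"
  define r where "r = norm q"
  have r: "0 \<le> r" "r < 1"
    using assms by (auto simp: r_def)
  have geo: "(\<lambda>j. r ^ j) summable_on (UNIV :: nat set)"
    using r by (intro summable_nonneg_imp_summable_on summable_geometric) auto
  have "Infinite_Sum.abs_summable_on (\<lambda>(n, j). r ^ n * r ^ j) ((UNIV :: nat set) \<times> (UNIV :: nat set))"
    unfolding Infinite_Sum.abs_summable_on_Sigma_iff using r geo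
    by (auto simp: abs_mult infsum_cmult_right' power_abs infsum_nonneg intro!: summable_on_cmult_right summable_on_cmult_left)
  hence "Infinite_Sum.abs_summable_on g (UNIV \<times> UNIV)"
  proof (rule Infinite_Sum.abs_summable_on_comparison_test)
    fix x :: "nat \<times> nat" 
    obtain n j where x: "x = (n, j)" by (cases x)
    have "norm (g x) = r ^ ((n + 1) * (j + 1)) / real (j + 1)"
      by (simp add: g_def x norm_divide norm_power r_def norm_mult del: of_nat_Suc)
    also have "\<dots> \<le> r ^ ((n + 1) * (j + 1)) / 1"
      using r by (intro divide_left_mono) auto
    also have "\<dots> \<le> r ^ (n + j)"
      using r by (simp only: div_by_1) (intro power_decreasing, auto)
    also have "\<dots> = norm (case x of (n, j) \<Rightarrow> r ^ n * r ^ j)"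
      using r by (simp add: x power_add abs_mult)
    finally show "norm (g x) \<le> norm (case x of (n, j) \<Rightarrow> r ^ n * r ^ j)" .
  qed
  hence g: "g summable_on UNIV \<times> UNIV"
    by (rule abs_summable_summable)
  define T where "T = infsum g (UNIV \<times> UNIV)"
  have T: "(g has_sum T) (UNIV \<times> UNIV)"
    unfolding T_def using g by (rule has_sum_infsum)
  have inner: "((\<lambda>j. g (n, j)) has_sum (- ln (1 - q ^ (n + 1)))) UNIV" for n
  proof -
    have "(\<lambda>j. g (n, j)) summable_on UNIV"
      using summable_on_SigmaD1[of "\<lambda>n j. g (n, j)" UNIV "\<lambda>_. UNIV" n] g by simp
    hence 1: "((\<lambda>j. g (n, j)) has_sum infsum (\<lambda>j. g (n, j)) UNIV) UNIV"
      by (rule has_sum_infsum)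
    have "norm (- (q ^ (n + 1))) < 1"
      unfolding norm_minus_cancel norm_power using r by (subst power_less_one_iff) (auto simp: r_def)
    from Ln_series'[OF this] have "(\<lambda>j. - ((q ^ (n + 1)) ^ j / of_nat j)) sums ln (1 - q ^ (n + 1))"
      by simp
    hence "(\<lambda>j. (q ^ (n + 1)) ^ j / of_nat j) sums (- ln (1 - q ^ (n + 1)))"
      using sums_minus by fastforce
    \<comment> \<open>The dropped term with \<open>j = 0\<close> is
      \<open>1 / 0 = 0\<close>.\<close>
    hence "(\<lambda>j. (q ^ (n + 1)) ^ Suc j / of_nat (Suc j)) sums (- ln (1 - q ^ (n + 1)))"
      by (subst sums_Suc_iff) simp
    moreover have "(\<lambda>j. (q ^ (n + 1)) ^ Suc j / of_nat (Suc j)) = (\<lambda>j. g (n, j))"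
      unfolding g_def power_mult[symmetric] by simp
    ultimately have "(\<lambda>j. g (n, j)) sums (- ln (1 - q ^ (n + 1)))" by simp
    with has_sum_imp_sums[OF 1] have "infsum (\<lambda>j. g (n, j)) UNIV = - ln (1 - q ^ (n + 1))"
      using sums_unique2 by blast
    thus ?thesis using 1 by simp
  qed
  have "((\<lambda>n. - ln (1 - q ^ (n + 1))) has_sum T) UNIV"
    by (rule has_sum_SigmaD[OF T inner])
  hence "(\<lambda>n. - ln (1 - q ^ (n + 1))) sums T"
    by (rule has_sum_imp_sums)
  hence 1: "(\<lambda>n. ln (1 - q ^ (n + 1))) sums (- T)"
    using sums_minus by fastforce
  let ?D = "\<lambda>k. {(n, j). (n + 1) * (j + 1) = (k :: nat)}"
  have "((\<lambda>x. g (snd x)) has_sum T) (Sigma UNIV ?D)"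
  proof (subst has_sum_reindex_bij_witness[where i = "\<lambda>(n, j). ((n + 1) * (j + 1), (n, j))" and j = snd and T = "UNIV \<times> UNIV" and h = g])
    show "(g has_sum T) (UNIV \<times> UNIV)" by (rule T)
  qed auto
  hence "((\<lambda>k. of_real (log_coeff k) * q ^ k) has_sum T) UNIV"
  proof (rule has_sum_SigmaD)
    fix k :: nat
    have "((\<lambda>y. g (snd (k, y))) has_sum (\<Sum>y\<in>?D k. g (snd (k, y)))) (?D k)"
      by (rule has_sum_finite[OF finite_factor_pairs])
    also have "(\<Sum>y\<in>?D k. g (snd (k, y))) = of_real (log_coeff k) * q ^ k"
      unfolding log_coeff_def of_real_sum sum_distrib_right
      by (intro sum.cong) (auto simp: g_def)
    finally show "((\<lambda>y. g (snd (k, y))) has_sum of_real (log_coeff k) * q ^ k) (?D k)" .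
  qed
  hence 2: "(\<lambda>k. of_real (log_coeff k) * q ^ k) sums T"
    by (rule has_sum_imp_sums)
  hence "T = eta_log q"
    unfolding eta_log_def by (rule sums_unique)
  with 1 2 show ?thesis by simp
qed

lemma eta_log_sums: "norm q < 1 \<Longrightarrow> (\<lambda>k. of_real (log_coeff k) * q ^ k) sums eta_log q"
  and ln_sums_eta_log: "norm q < 1 \<Longrightarrow> (\<lambda>n. ln (1 - q ^ (n + 1))) sums (- eta_log q)"
  using eta_log_sums_aux by blast+

text \<open>The principal power is the exponential of \<open>s\<close> times the principal
  logarithm, so summing logarithms works for every complex \<open>s\<close>.\<close>

lemma prodinf_powr_eq_exp_eta_log:
  assumes "norm q < 1"
  shows "(\<Prod>n. (1 - q ^ (n + 1)) powr s) = exp (- (s * eta_log q))"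
proof -
  have "1 - q ^ (n + 1) \<noteq> 0" for n
  proof
    assume "1 - q ^ (n + 1) = 0"
    hence "norm q ^ (n + 1) = 1"
      by (metis eq_iff_diff_eq_0 norm_one norm_power)
    moreover have "norm q ^ (n + 1) < 1"
      using assms by (subst power_less_one_iff) auto
    ultimately show False by simp
  qed
  hence "(1 - q ^ (n + 1)) powr s = exp (s * ln (1 - q ^ (n + 1)))" for n
    by (simp add: powr_def)
  moreover have "(\<lambda>n. exp (s * ln (1 - q ^ (n + 1)))) has_prod exp (s * - eta_log q)"
    using sums_imp_has_prod_exp[OF sums_mult[OF ln_sums_eta_log[OF assms]]] by (auto simp: has_prod_def)
  ultimately show ?thesis
    by (simp add: has_prod_iff)
qed

lemma qpoch_eq_exp_eta_log:
  assumes "norm q < 1"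
  shows "qpoch q q = exp (- eta_log q)"
  using prodinf_powr_eq_exp_eta_log[OF assms, of 1] by (simp add: qpoch_def)

lemma dedekind_eta_eq_exp:
  assumes "\<tau> \<in> uhp"
  shows "dedekind_eta \<tau> = exp (2 * of_real pi * \<i> * \<tau> / 24 - eta_log (nome \<tau>))"
proof -
  have "nome (\<tau> / 24) = exp (2 * of_real pi * \<i> * \<tau> / 24)"
    by (simp add: nome_def)
  thus ?thesis
    by (simp only: dedekind_eta_altdef qpoch_eq_exp_eta_log[OF norm_nome_less_1[OF assms]] exp_add[symmetric] add_uminus_conv_diff)
qed

lemma dedekind_eta_pow_eq_exp:
  "\<tau> \<in> uhp \<Longrightarrow> dedekind_eta_pow s \<tau> = exp (s * (2 * of_real pi * \<i> * \<tau> / 24 - eta_log (nome \<tau>)))"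
  unfolding dedekind_eta_pow_def
  by (subst prodinf_powr_eq_exp_eta_log) (simp_all add: norm_nome_less_1 algebra_simps flip: exp_add)

text \<open>Here the nome is real, hence so is the exponent, and the principal logarithm undoes the
  exponential.\<close>

lemma dedekind_eta_powr_imaginary_axis:
  assumes "y > 0" "\<tau> = \<i> * of_real y"
  shows "dedekind_eta \<tau> powr s = exp (s * (2 * of_real pi * \<i> * \<tau> / 24 - eta_log (nome \<tau>)))"
proof -
  have \<tau>: "\<tau> \<in> uhp"
    using assms by (simp add: uhp_def)
  define w where "w = 2 * of_real pi * \<i> * \<tau> / 24 - eta_log (nome \<tau>)"
  define r where "r = exp (- 2 * pi * y)"
  have nome: "nome \<tau> = of_real r"
    by (simp add: nome_def assms r_def exp_of_real[symmetric] mult_ac)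
  have "(\<lambda>k. of_real (log_coeff k) * nome \<tau> ^ k) sums eta_log (nome \<tau>)"
    by (rule eta_log_sums[OF norm_nome_less_1[OF \<tau>]])
  hence "(\<lambda>k. Im (of_real (log_coeff k) * nome \<tau> ^ k)) sums Im (eta_log (nome \<tau>))"
    by (rule sums_Im)
  moreover have "Im (of_real (log_coeff k) * nome \<tau> ^ k) = 0" for k
    by (simp add: nome flip: of_real_power)
  ultimately have "Im (eta_log (nome \<tau>)) = 0"
    using sums_unique2[OF sums_zero] by (metis (no_types, lifting) sums_cong)
  hence "Im w = 0"
    by (simp add: w_def assms)
  hence "ln (exp w) = w"
    by (intro Ln_exp) auto
  moreover have "dedekind_eta \<tau> = exp w"
    using dedekind_eta_eq_exp[OF \<tau>] by (simp add: w_def)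
  ultimately show ?thesis
    by (simp add: powr_def w_def)
qed

lemma qshift_prod_eq_exp:
  assumes "\<tau> \<in> uhp" "finite S"
  shows "qshift_prod N S e \<tau> = exp (- (\<Sum>j\<in>S. of_int (e j) * eta_log (nome (of_nat j / of_nat N) * nome \<tau>)))"
proof -
  have "\<tau> + of_nat j / of_nat N \<in> uhp" for j
    using assms by (intro uhp_add_Reals) (simp_all add: Im_divide)
  hence "qpoch (nome (\<tau> + of_nat j / of_nat N)) (nome (\<tau> + of_nat j / of_nat N)) powi e j =
      exp (- (of_int (e j) * eta_log (nome (of_nat j / of_nat N) * nome \<tau>)))" for j
    by (simp only: qpoch_eq_exp_eta_log[OF norm_nome_less_1] exp_power_int mult_minus_right)
       (simp only: nome_add mult.commute)
  thus ?thesis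
    using assms(2) by (simp add: qshift_prod_def exp_sum sum_negf[symmetric])
qed

section \<open>Tools for excluding eta quotients\<close>

lemma eta_log_dilate_sums:
  assumes "norm q < 1" "t > 0"
  shows "(\<lambda>k. of_real (if t dvd k then log_coeff (k div t) else 0) * q ^ k) sums eta_log (q ^ t)"
proof -
  have "norm (q ^ t) < 1"
    using assms by (simp add: norm_power power_less_one_iff)
  from eta_log_sums[OF this]
  have "(\<lambda>m. of_real (if t dvd t * m then log_coeff (t * m div t) else 0) * q ^ (t * m)) sums eta_log (q ^ t)"
    using assms by (simp add: power_mult)
  thus ?thesis
    by (subst (asm) sums_mono_reindex) (use assms in \<open>auto simp: strict_mono_def elim!: dvdE\<close>)
qed

text \<open>By continuity at 0 the constant is \<open>P 0 = p 0 = 0\<close>; a nonzero coefficient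
  would then make the zero at 0 isolated.\<close>

lemma power_series_zero_coeffs:
  fixes p :: "nat \<Rightarrow> complex"
  assumes sums: "\<And>x. norm x < 1 \<Longrightarrow> (\<lambda>k. p k * x ^ k) sums P x"
    and const: "\<And>x. norm x < 1 \<Longrightarrow> x \<noteq> 0 \<Longrightarrow> P x = C" and "p 0 = 0" "k > 0"
  shows "p k = 0"
proof (rule ccontr)
  assume pk: "p k \<noteq> 0"
  have sums': "(\<lambda>k. p k * (x - 0) ^ k) sums P x" if "norm (x - 0) < 1" for x
    using sums[of x] that by simp
  have P0: "P 0 = 0"
    using sums[of 0] powser_sums_zero[of p] assms(3) sums_unique2 by force
  have "P holomorphic_on ball 0 1"
    by (rule power_series_holomorphic[OF sums']) (simp add: dist_norm)
  hence "isCont P 0"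
    by (intro continuous_on_interior[OF holomorphic_on_imp_continuous_on]) auto
  hence "(P \<longlongrightarrow> P 0) (at 0)"
    by (simp add: isCont_def)
  moreover have "eventually (\<lambda>x. P x = C) (at 0)"
    unfolding eventually_at by (intro exI[of _ 1]) (auto simp: const)
  hence "(P \<longlongrightarrow> C) (at 0)"
    by (rule tendsto_eventually)
  ultimately have "P 0 = C"
    using tendsto_unique[OF at_neq_bot] by blast
  with P0 have C: "C = 0" by simp
  obtain s where s: "s > 0" "\<And>z. z \<in> cball 0 s - {0} \<Longrightarrow> P z \<noteq> 0"
    using powser_0_nonzero[of 1 0 p P k, OF _ sums' P0 pk \<open>k > 0\<close>] by auto
  define z :: complex where "z = of_real (min s (1 / 2))"
  have "z \<in> cball 0 s - {0}" "norm z < 1" "z \<noteq> 0"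
    using s(1) by (auto simp: z_def)
  thus False
    using s(2)[of z] const[of z] C by auto
qed

text \<open>Values with the same exponential differ by multiples of \<open>2 * pi * \<i>\<close>, so
  the range is discrete.\<close>

lemma exp_constant_imp_constant:
  assumes "connected A" "continuous_on A F" "\<And>x. x \<in> A \<Longrightarrow> exp (F x) = (c :: complex)"
  shows "F constant_on A"
proof (rule continuous_discrete_range_constant[OF assms(1,2)])
  fix x assume x: "x \<in> A"
  have "2 * pi \<le> norm (F y - F x)" if "y \<in> A" "F y \<noteq> F x" for y
  proof -
    have "exp (F y) = exp (F x)"
      using assms(3) x that by simp
    then obtain n :: int where n: "F y = F x + (of_int (2 * n) * pi) * \<i>"
      unfolding exp_eq by blast
    hence "n \<noteq> 0" using that by auto
    have "norm (F y - F x) = 2 * pi * \<bar>real_of_int n\<bar>"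
      by (simp add: n norm_mult)
    also have "\<dots> \<ge> 2 * pi * 1"
      using \<open>n \<noteq> 0\<close> by (intro mult_left_mono) auto
    finally show ?thesis by simp
  qed
  thus "\<exists>e>0. \<forall>y. y \<in> A \<and> F y \<noteq> F x \<longrightarrow> e \<le> norm (F y - F x)"
    by (intro exI[of _ "2 * pi"]) auto
qed

text \<open>In \<open>u + N * \<Prod>Q\<close> every prime factor of \<open>M\<close> divides
  exactly one summand: if it divides \<open>u\<close>, it divides neither \<open>N\<close> nor
  \<open>\<Prod>Q\<close>; otherwise it belongs to \<open>Q\<close>.\<close>

lemma coprime_in_residue_class:
  fixes u N M :: nat
  assumes "coprime u N" "M > 0" "u > 0"
  obtains k where "k > 0" "k mod N = u mod N" "coprime k M"
proof -
  define Q where "Q = {p. prime p \<and> p dvd M \<and> \<not> p dvd u}"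
  have fin: "finite Q"
    by (rule finite_subset[OF _ finite_divisors_nat[OF assms(2)]]) (auto simp: Q_def)
  define k where "k = u + N * \<Prod>Q"
  have "coprime k M"
  proof (rule ccontr)
    assume "\<not> coprime k M"
    hence "gcd k M \<noteq> 1"
      using coprime_iff_gcd_eq_1 by blast
    then obtain p where "prime p" "p dvd gcd k M"
      using prime_factor_nat by blast
    hence p: "prime p" "p dvd k" "p dvd M"
      by auto
    show False
    proof (cases "p dvd u")
      case True
      hence "p dvd N * \<Prod>Q"
        using p(2) unfolding k_def by (simp add: dvd_add_right_iff)
      moreover have "\<not> p dvd N"
        using True assms(1) p(1) coprime_common_divisor not_prime_unit by blast
      ultimately have "p dvd \<Prod>Q"
        using p(1) prime_dvd_mult_iff by blast
      then obtain p' where "p' \<in> Q" "p dvd p'"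
        using p(1) fin prime_dvd_prod_iff[of Q p "\<lambda>x. x"] by auto
      hence "p = p'"
        using p(1) primes_dvd_imp_eq by (auto simp: Q_def)
      thus False
        using True \<open>p' \<in> Q\<close> by (simp add: Q_def)
    next
      case False
      hence "p \<in> Q" using p by (simp add: Q_def)
      hence "p dvd \<Prod>Q"
        using dvd_prodI[OF fin, of p "\<lambda>x. x"] by simp
      hence "p dvd u"
        using p(2) unfolding k_def by (metis dvd_add_left_iff dvd_mult)
      thus False using False by blast
    qed
  qed
  moreover have "k > 0" "k mod N = u mod N"
    using assms(3) by (simp_all add: k_def)
  ultimately show ?thesis
    by (intro that)
qed

text \<open>\<open>gs k\<close> is the Gauss sum multiplying \<open>log_coeff k\<close> in the
  \<open>k\<close>-th coefficient of minus the logarithm of \<open>f\<close>. It depends on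
  \<open>k\<close> modulo \<open>N\<close> only, so \<open>u\<close> may be replaced by a number
  prime to the level \<open>M\<close>.\<close>

theorem not_eta_quotient_qshift_prod:
  fixes e :: "nat \<Rightarrow> int" and S :: "nat set" and N :: nat
  defines "gs \<equiv> \<lambda>k. \<Sum>j\<in>S. of_int (e j) * nome (of_nat j / of_nat N) ^ k"
  assumes N: "N > 0" and S: "finite S" and f: "\<And>\<tau>. \<tau> \<in> uhp \<Longrightarrow> f \<tau> = qshift_prod N S e \<tau>"
    and u: "coprime u N" "u > 0" "gs u \<noteq> gs 1"
  shows "\<not> is_eta_quotient f"
proof
  assume "is_eta_quotient f"
  then obtain M c a where M: "M > 0" and
    quot: "(\<forall>\<tau>\<in>uhp. f \<tau> = c * (\<Prod>t | t dvd M. dedekind_eta (of_nat t * \<tau>) powr a t)) \<or>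
         (\<forall>\<tau>\<in>uhp. f \<tau> = c * (\<Prod>t | t dvd M. dedekind_eta_pow (a t) (of_nat t * \<tau>)))"
    unfolding is_eta_quotient_def by blast
  define D where "D = {t. t dvd M}"
  have D: "finite D" "\<And>t. t \<in> D \<Longrightarrow> t > 0"
    using M by (auto simp: D_def intro: Nat.gr0I)
  define W where "W = (\<lambda>\<tau>. \<Sum>t\<in>D. a t * (2 * of_real pi * \<i> * (of_nat t * \<tau>) / 24 - eta_log (nome (of_nat t * \<tau>))))"
  define B where "B = (\<lambda>q. \<Sum>j\<in>S. of_int (e j) * eta_log (nome (of_nat j / of_nat N) * q))"
  \<comment> \<open>On the imaginary axis the values of \<open>\<eta>\<close> are positive, so that both readings of the power agree.\<close>
  have axis: "exp (- B (nome \<tau>)) = c * exp (W \<tau>)" if y: "y > 0" "\<tau> = \<i> * of_real y" for y \<tau>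
  proof -
    have \<tau>: "\<tau> \<in> uhp" using y by (simp add: uhp_def)
    have t: "of_nat t * \<tau> = \<i> * of_real (of_nat t * y)" "of_nat t * y > 0" "of_nat t * \<tau> \<in> uhp" if "t \<in> D" for t
      using y D(2)[OF that] by (simp_all add: uhp_def)
    have "f \<tau> = c * (\<Prod>t\<in>D. exp (a t * (2 * of_real pi * \<i> * (of_nat t * \<tau>) / 24 - eta_log (nome (of_nat t * \<tau>)))))"
      using quot
    proof
      assume "\<forall>\<tau>\<in>uhp. f \<tau> = c * (\<Prod>t | t dvd M. dedekind_eta (of_nat t * \<tau>) powr a t)"
      hence "f \<tau> = c * (\<Prod>t\<in>D. dedekind_eta (of_nat t * \<tau>) powr a t)"
        using \<tau> by (simp add: D_def)
      also have "(\<Prod>t\<in>D. dedekind_eta (of_nat t * \<tau>) powr a t) = 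
          (\<Prod>t\<in>D. exp (a t * (2 * of_real pi * \<i> * (of_nat t * \<tau>) / 24 - eta_log (nome (of_nat t * \<tau>)))))"
        by (intro prod.cong refl dedekind_eta_powr_imaginary_axis[OF t(2,1)])
      finally show ?thesis .
    next
      assume "\<forall>\<tau>\<in>uhp. f \<tau> = c * (\<Prod>t | t dvd M. dedekind_eta_pow (a t) (of_nat t * \<tau>))"
      hence "f \<tau> = c * (\<Prod>t\<in>D. dedekind_eta_pow (a t) (of_nat t * \<tau>))"
        using \<tau> by (simp add: D_def)
      also have "(\<Prod>t\<in>D. dedekind_eta_pow (a t) (of_nat t * \<tau>)) = 
          (\<Prod>t\<in>D. exp (a t * (2 * of_real pi * \<i> * (of_nat t * \<tau>) / 24 - eta_log (nome (of_nat t * \<tau>)))))"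
        by (intro prod.cong refl dedekind_eta_pow_eq_exp t(3))
      finally show ?thesis .
    qed
    thus ?thesis
      unfolding f[OF \<tau>] qshift_prod_eq_exp[OF \<tau> S] B_def W_def exp_sum[OF D(1)] .
  qed
  \<comment> \<open>These are the coefficients of the logarithm of \<open>f\<close> minus that of
    the eta quotient, apart from the linear term \<open>E * \<tau>\<close> that comes from the
    fractional nome powers.\<close>
  define p where "p = (\<lambda>k. (\<Sum>t\<in>D. a t * of_real (if t dvd k then log_coeff (k div t) else 0)) - gs k * of_real (log_coeff k))"
  define P where "P = (\<lambda>q. (\<Sum>t\<in>D. a t * eta_log (q ^ t)) - B q)"
  have P_sums: "(\<lambda>k. p k * q ^ k) sums P q" if q: "norm q < 1" for q
  proof -
    have "(\<lambda>k. (\<Sum>t\<in>D. a t * (of_real (if t dvd k then log_coeff (k div t) else 0) * q ^ k)) -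
       (\<Sum>j\<in>S. of_int (e j) * (of_real (log_coeff k) * (nome (of_nat j / of_nat N) * q) ^ k))) sums P q"
      unfolding P_def B_def using q D
      by (intro sums_diff sums_sum sums_mult eta_log_dilate_sums eta_log_sums) (auto simp: norm_mult norm_nome Im_divide)
    moreover have "(\<Sum>t\<in>D. a t * (of_real (if t dvd k then log_coeff (k div t) else 0) * q ^ k)) =
        (\<Sum>t\<in>D. a t * of_real (if t dvd k then log_coeff (k div t) else 0)) * q ^ k" for k
      unfolding sum_distrib_right by (intro sum.cong) auto
    moreover have "(\<Sum>j\<in>S. of_int (e j) * (of_real (log_coeff k) * (nome (of_nat j / of_nat N) * q) ^ k)) =
        gs k * of_real (log_coeff k) * q ^ k" for k
      unfolding gs_def sum_distrib_right by (intro sum.cong) (auto simp: power_mult_distrib)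
    ultimately show ?thesis
      by (simp only: p_def left_diff_distrib)
  qed
  define E where "E = (\<Sum>t\<in>D. a t * (2 * of_real pi * \<i> * of_nat t / 24))"
  define \<Phi> where "\<Phi> = (\<lambda>\<tau>. P (nome \<tau>) - E * \<tau>)"
  have W: "W \<tau> = E * \<tau> - (\<Sum>t\<in>D. a t * eta_log (nome \<tau> ^ t))" for \<tau>
    unfolding W_def E_def sum_distrib_right sum_subtractf[symmetric]
    by (intro sum.cong refl, simp only: nome_mult_of_nat) (simp add: field_simps)
  have exp_axis: "exp (\<Phi> \<tau>) = c" if "y > 0" "\<tau> = \<i> * of_real y" for y \<tau>
  proof -
    have "\<Phi> \<tau> = - B (nome \<tau>) - W \<tau>"
      by (simp add: \<Phi>_def P_def W)
    thus ?thesis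
      using axis[OF that] by (simp add: exp_diff)
  qed
  have "P holomorphic_on ball 0 1"
    by (rule power_series_holomorphic[of _ _ p]) (use P_sums in \<open>auto simp: dist_norm\<close>)
  hence "(P \<circ> nome) holomorphic_on uhp"
    by (rule holomorphic_on_compose_gen[rotated]) (auto intro!: holomorphic_intros simp: norm_nome_less_1)
  hence hol: "\<Phi> holomorphic_on uhp"
    unfolding \<Phi>_def by (intro holomorphic_intros) (simp_all add: o_def)
  \<comment> \<open>The identity is known on the imaginary axis; the identity theorem extends it,
    with \<open>\<i>\<close> as accumulation point.\<close>
  have "exp (\<Phi> \<tau>) - c = 0" if "\<tau> \<in> uhp" for \<tau>
  proof (rule analytic_continuation[where f = "\<lambda>\<tau>. exp (\<Phi> \<tau>) - c" and S = uhp and U = "{\<i> * of_real y |y. y > 0}" and \<xi> = \<i>])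
    show "(\<lambda>\<tau>. exp (\<Phi> \<tau>) - c) holomorphic_on uhp"
      using hol by (intro holomorphic_intros)
    show "\<i> islimpt {\<i> * of_real y |y. y > 0}"
      unfolding islimpt_approachable
    proof (intro allI impI)
      fix \<epsilon> :: real assume "\<epsilon> > 0"
      hence "\<i> * of_real (1 + \<epsilon> / 2) \<in> {\<i> * of_real y |y. y > 0}" "\<i> * of_real (1 + \<epsilon> / 2) \<noteq> \<i>"
        by (auto simp: complex_eq_iff intro!: exI[of _ "1 + \<epsilon> / 2"])
      moreover have "dist (\<i> * of_real (1 + \<epsilon> / 2)) \<i> < \<epsilon>"
      proof -
        have "\<i> * of_real (1 + \<epsilon> / 2) - \<i> = \<i> * of_real (\<epsilon> / 2)"
          by (simp add: algebra_simps)
        hence "norm (\<i> * of_real (1 + \<epsilon> / 2) - \<i>) = \<bar>\<epsilon> / 2\<bar>"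
          by (simp only: norm_mult norm_of_real norm_ii mult_1)
        thus ?thesis
          using \<open>\<epsilon> > 0\<close> by (simp add: dist_norm)
      qed
      ultimately show "\<exists>x'\<in>{\<i> * of_real y |y. y > 0}. x' \<noteq> \<i> \<and> dist x' \<i> < \<epsilon>"
        by blast
    qed
    show "exp (\<Phi> z) - c = 0" if "z \<in> {\<i> * of_real y |y. y > 0}" for z
      using that exp_axis by auto
  qed (use that open_uhp connected_uhp in \<open>auto simp: uhp_def\<close>)
  hence "\<Phi> constant_on uhp"
    using hol connected_uhp by (intro exp_constant_imp_constant[of _ _ c] holomorphic_on_imp_continuous_on) auto
  then obtain C where C: "\<And>\<tau>. \<tau> \<in> uhp \<Longrightarrow> \<Phi> \<tau> = C"
    unfolding constant_on_def by blast
  \<comment> \<open>\<open>P (nome \<tau>)\<close> has period 1, so this comparison isolates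
    \<open>E\<close>.\<close>
  have "\<Phi> (\<i> + 1) = \<Phi> \<i>"
    using C[of "\<i> + 1"] C[of \<i>] by (simp add: uhp_def)
  hence "E = 0"
    by (simp add: \<Phi>_def nome_add distrib_left)
  have P_const: "P x = C" if x: "norm x < 1" "x \<noteq> 0" for x
  proof -
    define \<tau> where "\<tau> = ln x / (2 * of_real pi * \<i>)"
    have "nome \<tau> = x"
      using x by (simp add: nome_def \<tau>_def)
    moreover from this have "\<tau> \<in> uhp"
      using x norm_nome_less_1_iff by metis
    ultimately show ?thesis
      using C[of \<tau>] \<open>E = 0\<close> by (simp add: \<Phi>_def)
  qed
  have "p 0 = 0"
    by (simp add: p_def)
  have p0: "p k = 0" if "k > 0" for k
    by (rule power_series_zero_coeffs[OF P_sums P_const \<open>p 0 = 0\<close> that])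
  have coeff: "gs k = a 1" if k: "k > 0" "coprime k M" for k
  proof -
    \<comment> \<open>For \<open>k\<close> prime to \<open>M\<close> only the dilation
      \<open>t = 1\<close> contributes.\<close>
    have "t dvd k \<longleftrightarrow> t = 1" if "t \<in> D" for t
      using that k(2) coprime_common_divisor[of k M t] by (auto simp: D_def)
    hence "(\<Sum>t\<in>D. a t * of_real (if t dvd k then log_coeff (k div t) else 0)) =
        (\<Sum>t\<in>D. if t = 1 then a 1 * of_real (log_coeff k) else (0 :: complex))"
      by (intro sum.cong) auto
    also have "\<dots> = a 1 * of_real (log_coeff k)"
      using D(1) by (simp add: sum.delta D_def)
    finally have "(a 1 - gs k) * of_real (log_coeff k) = 0"
      using p0[OF k(1)] by (simp add: p_def left_diff_distrib)
    thus ?thesis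
      using log_coeff_pos[OF k(1)] by simp
  qed
  obtain k where k: "k > 0" "k mod N = u mod N" "coprime k M"
    using coprime_in_residue_class[OF u(1) M u(2)] by blast
  have "gs k = gs u"
    unfolding gs_def using nome_root_power[OF N, of _ k] nome_root_power[OF N, of _ u] k(2) by simp
  moreover have "gs k = gs 1"
    using coeff[OF k(1,3)] coeff[of 1] by simp
  ultimately show False
    using u(3) by simp
qed

section \<open>Distinct Gauss sums for the three characters, and the conclusion\<close>

lemma not_eta_quotient_3:
  assumes "\<And>\<tau>. \<tau> \<in> uhp \<Longrightarrow> f \<tau> = qshift_prod 3 {2, 4} shift_exponent_3 \<tau>"
  shows "\<not> is_eta_quotient f"
proof (rule not_eta_quotient_qshift_prod[OF _ _ assms])
  have root: "nome (of_nat j / of_nat 3) ^ k = nome (of_nat ((k mod 3 * j) mod 3) / of_nat 3)" for j k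
    by (rule nome_root_power) simp
  have "nome (1 / 3) \<noteq> 1"
    using nome_inverse_neq_1[of 3] by simp
  moreover have "nome (2 / 3) = nome (1 / 3) * nome (1 / 3)"
    by (simp flip: nome_add)
  ultimately have "nome (1 / 3) \<noteq> nome (2 / 3)"
    by simp
  \<comment> \<open>The choice \<open>u = 2\<close> exchanges the two primitive cube roots and so
    changes the sign of their nonzero difference.\<close>
  thus "(\<Sum>j\<in>{2, 4}. of_int (shift_exponent_3 j) * nome (of_nat j / of_nat 3) ^ 2) \<noteq>
    (\<Sum>j\<in>{2, 4}. of_int (shift_exponent_3 j) * nome (of_nat j / of_nat 3) ^ 1)"
    unfolding root by simp
qed auto

lemma not_eta_quotient_4:
  assumes "\<And>\<tau>. \<tau> \<in> uhp \<Longrightarrow> f \<tau> = qshift_prod 4 {1, 3} shift_exponent_4 \<tau>"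
  shows "\<not> is_eta_quotient f"
proof (rule not_eta_quotient_qshift_prod[OF _ _ assms])
  have root: "nome (of_nat j / of_nat 4) ^ k = nome (of_nat ((k mod 4 * j) mod 4) / of_nat 4)" for j k
    by (rule nome_root_power) simp
  have "nome (3 / 4) = - \<i>"
    using nome_add[of "1/2" "1/4"] by (simp add: nome_quarter nome_half)
  \<comment> \<open>The choice \<open>u = 3\<close> exchanges \<open>\<i>\<close> and
    \<open>- \<i>\<close>, turning the sum \<open>2 * \<i>\<close> into its negative.\<close>
  thus "(\<Sum>j\<in>{1, 3}. of_int (shift_exponent_4 j) * nome (of_nat j / of_nat 4) ^ 3) \<noteq>
    (\<Sum>j\<in>{1, 3}. of_int (shift_exponent_4 j) * nome (of_nat j / of_nat 4) ^ 1)"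
    unfolding root by (simp add: nome_quarter complex_eq_iff)
  show "coprime 3 (4 :: nat)"
    using coprime_Suc_right_nat[of 3] by simp
qed auto

lemma not_eta_quotient_5:
  assumes "\<And>\<tau>. \<tau> \<in> uhp \<Longrightarrow> f \<tau> = qshift_prod 5 {2, 4, 6, 8} shift_exponent_5 \<tau>"
  shows "\<not> is_eta_quotient f"
proof (rule not_eta_quotient_qshift_prod[OF _ _ assms])
  have root: "nome (of_nat j / of_nat 5) ^ k = nome (of_nat ((k mod 5 * j) mod 5) / of_nat 5)" for j k
    by (rule nome_root_power) simp
  define x y where "x = nome (1 / 5) + nome (4 / 5)" and "y = nome (2 / 5) + nome (3 / 5)"
  \<comment> \<open>This is the Gauss sum for \<open>k = 1\<close>; \<open>u = 2\<close> is a
    nonsquare modulo 5, so it exchanges \<open>x\<close> and \<open>y\<close>.\<close>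
  have "x - y = of_real (sqrt 5)"
    unfolding x_def y_def fifth_roots by (simp add: field_simps)
  hence "x - y \<noteq> 0" by simp
  hence "y - x \<noteq> x - y"
    by (auto simp: algebra_simps)
  thus "(\<Sum>j\<in>{2, 4, 6, 8}. of_int (shift_exponent_5 j) * nome (of_nat j / of_nat 5) ^ 2) \<noteq>
    (\<Sum>j\<in>{2, 4, 6, 8}. of_int (shift_exponent_5 j) * nome (of_nat j / of_nat 5) ^ 1)"
    unfolding root by (simp add: x_def y_def algebra_simps)
  show "coprime 2 (5 :: nat)"
    by simp
qed auto

theorem theorem2:
  fixes \<psi> :: "int \<Rightarrow> complex"
  assumes "dirichlet_char 4 \<psi>" and "\<psi> \<noteq> principal_char 4"
  shows
    "(gmf_with_twelfth_root_char (Gamma0 9) (eta_char (legendre_char 3)) \<and>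
      gmf_with_twelfth_root_char (Gamma0 16) (eta_char \<psi>) \<and>
      gmf_with_twelfth_root_char (Gamma0 25) (eta_char (legendre_char 5))) \<and>
     (\<forall>f \<in> {eta_char (legendre_char 3), eta_char \<psi>, eta_char (legendre_char 5)}.
        cuspidal_divisor f \<and> \<not> is_eta_quotient f) \<and>
     (\<forall>\<tau>\<in>uhp.
        (\<lambda>n. ((1 - exp (2 * of_real pi * \<i> / 3) * nome \<tau> ^ (n + 1)) /
              (1 - exp (4 * of_real pi * \<i> / 3) * nome \<tau> ^ (n + 1)))
             powr legendre_char 3 (int (n + 1)))
          has_prod eta_char (legendre_char 3) \<tau> \<and>
        (\<lambda>n. ((1 - \<i> * nome \<tau> ^ (n + 1)) / (1 + \<i> * nome \<tau> ^ (n + 1)))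
             powr \<psi> (int (n + 1)))
          has_prod eta_char \<psi> \<tau> \<and>
        (\<lambda>n. ((1 + of_real ((1 - sqrt 5) / 2) * nome \<tau> ^ (n + 1) + nome \<tau> ^ (2 * (n + 1))) /
              (1 + of_real ((1 + sqrt 5) / 2) * nome \<tau> ^ (n + 1) + nome \<tau> ^ (2 * (n + 1))))
             powr legendre_char 5 (int (n + 1)))
          has_prod eta_char (legendre_char 5) \<tau>)"
proof -
  have nome3: "exp (2 * of_real pi * \<i> / 3) = nome (1 / 3)" "exp (4 * of_real pi * \<i> / 3) = nome (2 / 3)"
    by (simp_all add: nome_def mult.assoc)
  note q3 = eta_char_legendre_3(1) and q4 = eta_char_4(1)[OF _ assms] and q5 = eta_char_legendre_5(1)
  show ?thesis
    using gmf_qshift_prod_3[OF q3] gmf_qshift_prod_4[OF q4] gmf_qshift_prod_5[OF q5]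
      not_eta_quotient_3[OF q3] not_eta_quotient_4[OF q4] not_eta_quotient_5[OF q5]
      eta_char_legendre_3(2) eta_char_4(2)[OF _ assms] eta_char_legendre_5(2)
    unfolding nome3 by blast
qed

end
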